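(* Let $G$ be a globular graph, let $\Sigma=\Sigma_{\min}^c$ be the minimal complete pasting diagram on $G$, and let $\mathcal A$ be a simplicial category. The map $$\mathrm{sCat}(\mathfrak C[\Sigma],\mathcal A)\to L(G,\mathcal A),\qquad u\mapsto \Lambda_u,$$ from the set of simplicial functors $\mathfrak C[\Sigma]\to\mathcal A$ to the set of labelings of $G$ in $\mathcal A$, which sends a simplicial functor $u$ to its associated labeling $\Lambda_u$, is a bijection.
   Context: **Globular graphs.** Graphs are finite directed graphs (multiple edges allowed). Paths are directed and may be trivial (a single vertex); $p\cdot q$ is concatenation. A source of a graph is a vertex with a directed path to every other vertex; a target is a source of the opposite graph. An $st$-graph is a plane graph with a unique source $s$ and a unique target $t$, both incident with the exterior face. A face $\phi$ is globular if its clockwise oriented boundary is $p\cdot q^{op}$ for nontrivial directed paths $p,q$. For an interior face, $\operatorname{dom}\phi=p$, $\operatorname{cod}\phi=q$; for the exterior face the opposite convention is used, $\operatorname{dom}=q$, $\operatorname{cod}=p$ (so $\operatorname{dom}G\cdot(\operatorname{cod}G)^{op}$ runs clockwise around $G$). Put $s(\phi)=s(p)$, $t(\phi)=t(p)$. A globular graph is an $st$-graph all of whose faces are globular; the single-vertex graph is also allowed (trivial globular graph). $\operatorname{dom}G,\operatorname{cod}G,\partial G$ are those of the exterior face. Subgraphs carry the induced embedding. An interior face $\phi$ is also regarded as the subgraph $\operatorname{dom}\phi\cup\operatorname{cod}\phi$. For vertices $x,y$, $G_{x,y}\subseteq G$ is the subgraph of all directed paths from $x$ to $y$; it is empty or globular.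 **Nerve of $G$.** A glob is a globular subgraph $\gamma$ each of whose edges is incident with the exterior face of $\gamma$. On the set $PG$ of directed paths from $s(G)$ to $t(G)$, $p\le q$ iff there are a glob $\gamma\subseteq G$ and possibly trivial paths $a,b$ with $p=a\cdot\operatorname{dom}\gamma\cdot b$, $q=a\cdot\operatorname{cod}\gamma\cdot b$; $\gamma$ is then a witness for $p\le q$. $\mathrm N(G)$ is the nerve of the poset $(PG,\le)$. **Pasting diagrams.** If $H_1,H_2\subseteq G$ are globular subgraphs with $t(H_1)=s(H_2)$, their join is $H_1\vee H_2=H_1\cup H_2$. A pasting diagram $\Sigma=(G,S)$ is a globular graph $G$ with a set $S$ of globular subgraphs of $G$ containing all paths and closed under taking globular subgraphs. It is complete if $S$ is closed under joins (whenever defined). $\Sigma_{\min}=(G,S_{\min})$ with $S_{\min}$ the set of all interior faces of $G$ and all paths in $G$; the minimal complete pasting diagram $\Sigma_{\min}^c=(G,S_{\min}^c)$ is the smallest complete pasting diagram on $G$ with $S_{\min}\subseteq S_{\min}^c$. The restriction is $\Sigma_{x,y}=(G_{x,y},\{A\in S: A\subseteq G_{x,y}\})$. The nerve $\mathrm N(\Sigma)\subseteq \mathrm N(G)$ consists of the simplices $(p_0\le\dots\le p_n)$ for which there is $A\in S$ such that all relations $p_{i-1}\le p_i$ have witnesses $\gamma_i\subseteq A$. (If $G_{x,y}=\emptyset$, then $\mathrm N(\Sigma_{x,y})=\emptyset$.) **The category $\mathfrak C[\Sigma]$.** A simplicial category is a category enriched in simplicial sets. For complete $\Sigma$, $\mathfrak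 C[\Sigma]$ has objects the vertices of $G$, mapping spaces $\mathfrak C[\Sigma](x,y)=\mathrm N(\Sigma_{x,y})$, identities the trivial paths, and composition given by concatenation: $(p_i)_i\in\mathfrak C[\Sigma](x,y)_n$ and $(q_i)_i\in\mathfrak C[\Sigma](y,z)_n$ compose to $(p_i\cdot q_i)_i\in\mathfrak C[\Sigma](x,z)_n$. **Labelings.** A labeling $\Lambda$ of $G$ in $\mathcal A$ consists of an object $\Lambda x\in\mathcal A$ for each vertex $x$; a $0$-simplex $\Lambda e\in\mathcal A(\Lambda x,\Lambda y)$ for each edge $e$ from $x$ to $y$; and a $1$-simplex $\Lambda\phi\in\mathcal A(\Lambda s(\phi),\Lambda t(\phi))$ for each interior face $\phi$, such that $d_0\Lambda\phi=\Lambda e_r\circ\dots\circ\Lambda e_1$ and $d_1\Lambda\phi=\Lambda f_k\circ\dots\circ\Lambda f_1$, where $\operatorname{dom}\phi=f_1\cdots f_k$ and $\operatorname{cod}\phi=e_1\cdots e_r$. $L(G,\mathcal A)$ is the set of labelings. The labeling $\Lambda_u$ associated with a simplicial functor $u\colon\mathfrak C[\Sigma]\to\mathcal A$ is $\Lambda_u x=u(x)$, $\Lambda_u e=u(e)$, $\Lambda_u\phi=u(\phi)$, where $e$ and $\phi$ are regarded as the $0$-simplex $(e)$ and the $1$-simplex $(\operatorname{dom}\phi\le\operatorname{cod}\phi)$ of the respective mapping spaces of $\mathfrak C[\Sigma]$. *)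

theory Defs
  imports
    "HOL-Complex_Analysis.Winding_Numbers"
    "HOL-Library.FuncSet"
    "Graph_Theory.Digraph_Component"
begin

section \<open>Plane directed multigraphs\<close>

text \<open>
  Graphs are those of the AFP entry Graph\_Theory (parallel arcs and loops are allowed); a directed
  path with given end points is an arc walk, so the trivial path is the empty list. The drawing is
  kept separate from the graph, so that a subgraph automatically carries the induced embedding.
\<close>

record ('v, 'e) drawing =
  vpt :: "'v \<Rightarrow> complex"
  crv :: "'e \<Rightarrow> real \<Rightarrow> complex"

definition edge_interior :: "('v, 'e) drawing \<Rightarrow> 'e \<Rightarrow> complex set" where
  "edge_interior D e = crv D e ` {0<..<1}"

definition plane_graph :: "('v, 'e) drawing \<Rightarrow> ('v, 'e) pre_digraph \<Rightarrow> bool" where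
  "plane_graph D G \<longleftrightarrow>
     fin_digraph G \<and>
     inj_on (vpt D) (verts G) \<and>
     (\<forall>e\<in>arcs G. simple_path (crv D e) \<and>
        pathstart (crv D e) = vpt D (tail G e) \<and> pathfinish (crv D e) = vpt D (head G e) \<and>
        edge_interior D e \<inter> vpt D ` verts G = {}) \<and>
     (\<forall>e\<in>arcs G. \<forall>f\<in>arcs G. e \<noteq> f \<longrightarrow> edge_interior D e \<inter> edge_interior D f = {})"

definition support :: "('v, 'e) drawing \<Rightarrow> ('v, 'e) pre_digraph \<Rightarrow> complex set" where
  "support D G = vpt D ` verts G \<union> (\<Union>e\<in>arcs G. path_image (crv D e))"

definition faces :: "('v, 'e) drawing \<Rightarrow> ('v, 'e) pre_digraph \<Rightarrow> complex set set" where
  "faces D G = components (- support D G)"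

definition exterior :: "('v, 'e) drawing \<Rightarrow> ('v, 'e) pre_digraph \<Rightarrow> complex set" where
  "exterior D G = outside (support D G)"

definition interior_faces :: "('v, 'e) drawing \<Rightarrow> ('v, 'e) pre_digraph \<Rightarrow> complex set set" where
  "interior_faces D G = faces D G - {exterior D G}"

fun walk_curve :: "('v, 'e) drawing \<Rightarrow> 'e list \<Rightarrow> real \<Rightarrow> complex" where
  "walk_curve D [] = undefined"
| "walk_curve D [e] = crv D e"
| "walk_curve D (e # f # es) = crv D e +++ walk_curve D (f # es)"

text \<open>
  The clockwise oriented boundary of the face \<open>\<phi>\<close> is \<open>p \<cdot> q\<^sup>o\<^sup>p\<close>: the closed curve runs over
  exactly the frontier of \<open>\<phi>\<close>, along each side of an edge at most once, and keeps \<open>\<phi>\<close> on its right.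
  The last condition is expressed by winding numbers: the winding number in \<open>\<phi>\<close> is one less than
  elsewhere. Thus it is \<open>-1\<close> on an interior face (and \<open>0\<close> off its closure), while for the exterior
  face it is \<open>0\<close> there and \<open>1\<close> in the bounded regions. An edge with \<open>\<phi>\<close> on both sides occurs both in
  \<open>p\<close> and in \<open>q\<close>.
\<close>

definition cw_boundary ::
    "('v, 'e) drawing \<Rightarrow> ('v, 'e) pre_digraph \<Rightarrow> complex set \<Rightarrow> 'e list \<Rightarrow> 'e list \<Rightarrow> bool" where
  "cw_boundary D G \<phi> p q \<longleftrightarrow>
     p \<noteq> [] \<and> q \<noteq> [] \<and>
     (\<exists>x y. pre_digraph.trail G x p y \<and> pre_digraph.trail G x q y) \<and>
     (let c = walk_curve D p +++ reversepath (walk_curve D q) in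
        path_image c = frontier \<phi> \<and>
        (\<forall>z\<in>\<phi>. \<forall>z'. z' \<notin> closure \<phi> \<longrightarrow> winding_number c z = winding_number c z' - 1))"


section \<open>Globular graphs\<close>

definition is_source :: "('v, 'e) pre_digraph \<Rightarrow> 'v \<Rightarrow> bool" where
  "is_source G s \<longleftrightarrow> s \<in> verts G \<and> (\<forall>v\<in>verts G. \<exists>p. pre_digraph.awalk G s p v)"

definition is_target :: "('v, 'e) pre_digraph \<Rightarrow> 'v \<Rightarrow> bool" where
  "is_target G t \<longleftrightarrow> t \<in> verts G \<and> (\<forall>v\<in>verts G. \<exists>p. pre_digraph.awalk G v p t)"

definition src :: "('v, 'e) pre_digraph \<Rightarrow> 'v" where
  "src G = (THE s. is_source G s)"

definition tgt :: "('v, 'e) pre_digraph \<Rightarrow> 'v" where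
  "tgt G = (THE t. is_target G t)"

definition st_graph :: "('v, 'e) drawing \<Rightarrow> ('v, 'e) pre_digraph \<Rightarrow> bool" where
  "st_graph D G \<longleftrightarrow>
     plane_graph D G \<and> (\<exists>!s. is_source G s) \<and> (\<exists>!t. is_target G t) \<and>
     vpt D (src G) \<in> frontier (exterior D G) \<and> vpt D (tgt G) \<in> frontier (exterior D G)"

definition globular_face ::
    "('v, 'e) drawing \<Rightarrow> ('v, 'e) pre_digraph \<Rightarrow> complex set \<Rightarrow> bool" where
  "globular_face D G \<phi> \<longleftrightarrow> (\<exists>p q. cw_boundary D G \<phi> p q)"

definition trivial_graph :: "('v, 'e) pre_digraph \<Rightarrow> bool" where
  "trivial_graph G \<longleftrightarrow> (\<exists>v. verts G = {v}) \<and> arcs G = {}"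

definition globular :: "('v, 'e) drawing \<Rightarrow> ('v, 'e) pre_digraph \<Rightarrow> bool" where
  "globular D G \<longleftrightarrow>
     trivial_graph G \<or> st_graph D G \<and> (\<forall>\<phi>\<in>faces D G. globular_face D G \<phi>)"

definition face_dom :: "('v, 'e) drawing \<Rightarrow> ('v, 'e) pre_digraph \<Rightarrow> complex set \<Rightarrow> 'e list" where
  "face_dom D G \<phi> =
     (let (p, q) = (THE (p, q). cw_boundary D G \<phi> p q) in if \<phi> = exterior D G then q else p)"

definition face_cod :: "('v, 'e) drawing \<Rightarrow> ('v, 'e) pre_digraph \<Rightarrow> complex set \<Rightarrow> 'e list" where
  "face_cod D G \<phi> =
     (let (p, q) = (THE (p, q). cw_boundary D G \<phi> p q) in if \<phi> = exterior D G then p else q)"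

definition face_src :: "('v, 'e) drawing \<Rightarrow> ('v, 'e) pre_digraph \<Rightarrow> complex set \<Rightarrow> 'v" where
  "face_src D G \<phi> = tail G (hd (face_dom D G \<phi>))"

definition face_tgt :: "('v, 'e) drawing \<Rightarrow> ('v, 'e) pre_digraph \<Rightarrow> complex set \<Rightarrow> 'v" where
  "face_tgt D G \<phi> = head G (last (face_dom D G \<phi>))"

definition graph_dom :: "('v, 'e) drawing \<Rightarrow> ('v, 'e) pre_digraph \<Rightarrow> 'e list" where
  "graph_dom D G = (if trivial_graph G then [] else face_dom D G (exterior D G))"

definition graph_cod :: "('v, 'e) drawing \<Rightarrow> ('v, 'e) pre_digraph \<Rightarrow> 'e list" where
  "graph_cod D G = (if trivial_graph G then [] else face_cod D G (exterior D G))"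

definition path_graph :: "('v, 'e) pre_digraph \<Rightarrow> 'v \<Rightarrow> 'e list \<Rightarrow> ('v, 'e) pre_digraph" where
  "path_graph G x p =
     \<lparr>verts = set (pre_digraph.awalk_verts G x p), arcs = set p, tail = tail G, head = head G\<rparr>"

definition face_graph ::
    "('v, 'e) drawing \<Rightarrow> ('v, 'e) pre_digraph \<Rightarrow> complex set \<Rightarrow> ('v, 'e) pre_digraph" where
  "face_graph D G \<phi> =
     union (path_graph G (face_src D G \<phi>) (face_dom D G \<phi>))
           (path_graph G (face_src D G \<phi>) (face_cod D G \<phi>))"

definition between :: "('v, 'e) pre_digraph \<Rightarrow> 'v \<Rightarrow> 'v \<Rightarrow> ('v, 'e) pre_digraph" where
  "between G x y =
     \<lparr>verts = (\<Union>p\<in>{p. pre_digraph.awalk G x p y}. set (pre_digraph.awalk_verts G x p)),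
      arcs = (\<Union>p\<in>{p. pre_digraph.awalk G x p y}. set p),
      tail = tail G, head = head G\<rparr>"


section \<open>Nerves and pasting diagrams\<close>

definition glob :: "('v, 'e) drawing \<Rightarrow> ('v, 'e) pre_digraph \<Rightarrow> bool" where
  "glob D H \<longleftrightarrow>
     globular D H \<and> (\<forall>e\<in>arcs H. path_image (crv D e) \<subseteq> frontier (exterior D H))"

definition st_paths :: "('v, 'e) pre_digraph \<Rightarrow> 'e list set" where
  "st_paths G = {p. pre_digraph.awalk G (src G) p (tgt G)}"

definition witness ::
    "('v, 'e) drawing \<Rightarrow> ('v, 'e) pre_digraph \<Rightarrow> ('v, 'e) pre_digraph \<Rightarrow> 'e list \<Rightarrow> 'e list \<Rightarrow> bool" where
  "witness D G \<gamma> p q \<longleftrightarrow>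
     subgraph \<gamma> G \<and> glob D \<gamma> \<and>
     (\<exists>a b. pre_digraph.awalk G (src G) a (src \<gamma>) \<and> pre_digraph.awalk G (tgt \<gamma>) b (tgt G) \<and>
        p = a @ graph_dom D \<gamma> @ b \<and> q = a @ graph_cod D \<gamma> @ b)"

definition path_le ::
    "('v, 'e) drawing \<Rightarrow> ('v, 'e) pre_digraph \<Rightarrow> 'e list \<Rightarrow> 'e list \<Rightarrow> bool" where
  "path_le D G p q \<longleftrightarrow> p \<in> st_paths G \<and> q \<in> st_paths G \<and> (\<exists>\<gamma>. witness D G \<gamma> p q)"

definition graph_nerve :: "('v, 'e) drawing \<Rightarrow> ('v, 'e) pre_digraph \<Rightarrow> nat \<Rightarrow> 'e list list set" where
  "graph_nerve D G n =
     {ps. length ps = Suc n \<and> set ps \<subseteq> st_paths G \<and> successively (path_le D G) ps}"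

definition nerve ::
    "('v, 'e) drawing \<Rightarrow> ('v, 'e) pre_digraph \<Rightarrow> ('v, 'e) pre_digraph set \<Rightarrow> nat \<Rightarrow> 'e list list set" where
  "nerve D G S n =
     {ps \<in> graph_nerve D G n.
        \<exists>A\<in>S. \<forall>i<n. \<exists>\<gamma>. subgraph \<gamma> A \<and> witness D G \<gamma> (ps ! i) (ps ! Suc i)}"

definition paths_of :: "('v, 'e) pre_digraph \<Rightarrow> ('v, 'e) pre_digraph set" where
  "paths_of G = {path_graph G x p |x p y. pre_digraph.awalk G x p y}"

definition pasting_diagram ::
    "('v, 'e) drawing \<Rightarrow> ('v, 'e) pre_digraph \<Rightarrow> ('v, 'e) pre_digraph set \<Rightarrow> bool" where
  "pasting_diagram D G S \<longleftrightarrow>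
     globular D G \<and>
     S \<subseteq> {H. subgraph H G \<and> globular D H} \<and>
     paths_of G \<subseteq> S \<and>
     (\<forall>H\<in>S. \<forall>K. subgraph K H \<and> globular D K \<longrightarrow> K \<in> S)"

definition complete_pasting_diagram ::
    "('v, 'e) drawing \<Rightarrow> ('v, 'e) pre_digraph \<Rightarrow> ('v, 'e) pre_digraph set \<Rightarrow> bool" where
  "complete_pasting_diagram D G S \<longleftrightarrow>
     pasting_diagram D G S \<and> (\<forall>H\<in>S. \<forall>K\<in>S. tgt H = src K \<longrightarrow> union H K \<in> S)"

definition S_min :: "('v, 'e) drawing \<Rightarrow> ('v, 'e) pre_digraph \<Rightarrow> ('v, 'e) pre_digraph set" where
  "S_min D G = face_graph D G ` interior_faces D G \<union> paths_of G"

definition S_min_complete ::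
    "('v, 'e) drawing \<Rightarrow> ('v, 'e) pre_digraph \<Rightarrow> ('v, 'e) pre_digraph set" where
  "S_min_complete D G = \<Inter> {S. complete_pasting_diagram D G S \<and> S_min D G \<subseteq> S}"

definition restricted ::
    "('v, 'e) pre_digraph \<Rightarrow> ('v, 'e) pre_digraph set \<Rightarrow> 'v \<Rightarrow> 'v \<Rightarrow> ('v, 'e) pre_digraph set" where
  "restricted G S x y = {A \<in> S. subgraph A (between G x y)}"


section \<open>Simplicial categories\<close>

text \<open>
  \<open>Simp X n\<close> is the set of \<open>n\<close>-simplices; \<open>Face X n i\<close> is \<open>d\<^sub>i\<close> and \<open>Degen X n i\<close> is \<open>s\<^sub>i\<close> on
  \<open>n\<close>-simplices.
\<close>

record 's sset =
  Simp :: "nat \<Rightarrow> 's set"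
  Face :: "nat \<Rightarrow> nat \<Rightarrow> 's \<Rightarrow> 's"
  Degen :: "nat \<Rightarrow> nat \<Rightarrow> 's \<Rightarrow> 's"

definition simplicial_set :: "'s sset \<Rightarrow> bool" where
  "simplicial_set X \<longleftrightarrow>
     (\<forall>n. \<forall>a\<in>Simp X (Suc n). \<forall>i\<le>Suc n. Face X (Suc n) i a \<in> Simp X n) \<and>
     (\<forall>n. \<forall>a\<in>Simp X n. \<forall>i\<le>n. Degen X n i a \<in> Simp X (Suc n)) \<and>
     (\<forall>n. \<forall>a\<in>Simp X (Suc (Suc n)). \<forall>j\<le>Suc (Suc n). \<forall>i<j.
        Face X (Suc n) i (Face X (Suc (Suc n)) j a) =
        Face X (Suc n) (j - 1) (Face X (Suc (Suc n)) i a)) \<and>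
     (\<forall>n. \<forall>a\<in>Simp X n. \<forall>j\<le>n. \<forall>i\<le>Suc n.
        Face X (Suc n) i (Degen X n j a) =
          (if i < j then Degen X (n - 1) (j - 1) (Face X n i a)
           else if i \<le> Suc j then a
           else Degen X (n - 1) j (Face X n (i - 1) a))) \<and>
     (\<forall>n. \<forall>a\<in>Simp X n. \<forall>j\<le>n. \<forall>i\<le>j.
        Degen X (Suc n) i (Degen X n j a) = Degen X (Suc n) (Suc j) (Degen X n i a))"

text \<open>
  \<open>Cmp C x y z n g f\<close> is \<open>g \<circ> f\<close> for \<open>n\<close>-simplices \<open>f\<close> of \<open>Hom C x y\<close> and \<open>g\<close> of \<open>Hom C y z\<close>.
\<close>

record ('o, 's) scat =
  Obj :: "'o set"
  Hom :: "'o \<Rightarrow> 'o \<Rightarrow> 's sset"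
  Idn :: "'o \<Rightarrow> 's"
  Cmp :: "'o \<Rightarrow> 'o \<Rightarrow> 'o \<Rightarrow> nat \<Rightarrow> 's \<Rightarrow> 's \<Rightarrow> 's"

text \<open>The identity of \<open>x\<close> as a totally degenerate \<open>n\<close>-simplex.\<close>

primrec idn :: "('o, 's) scat \<Rightarrow> 'o \<Rightarrow> nat \<Rightarrow> 's" where
  "idn C x 0 = Idn C x"
| "idn C x (Suc n) = Degen (Hom C x x) n 0 (idn C x n)"

definition simplicial_category :: "('o, 's) scat \<Rightarrow> bool" where
  "simplicial_category C \<longleftrightarrow>
     (\<forall>x\<in>Obj C. \<forall>y\<in>Obj C. simplicial_set (Hom C x y)) \<and>
     (\<forall>x\<in>Obj C. Idn C x \<in> Simp (Hom C x x) 0) \<and>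
     (\<forall>x\<in>Obj C. \<forall>y\<in>Obj C. \<forall>z\<in>Obj C. \<forall>n.
        \<forall>f\<in>Simp (Hom C x y) n. \<forall>g\<in>Simp (Hom C y z) n.
          Cmp C x y z n g f \<in> Simp (Hom C x z) n \<and>
          (\<forall>i\<le>n. n > 0 \<longrightarrow>
             Face (Hom C x z) n i (Cmp C x y z n g f) =
             Cmp C x y z (n - 1) (Face (Hom C y z) n i g) (Face (Hom C x y) n i f)) \<and>
          (\<forall>i\<le>n.
             Degen (Hom C x z) n i (Cmp C x y z n g f) =
             Cmp C x y z (Suc n) (Degen (Hom C y z) n i g) (Degen (Hom C x y) n i f))) \<and>
     (\<forall>w\<in>Obj C. \<forall>x\<in>Obj C. \<forall>y\<in>Obj C. \<forall>z\<in>Obj C. \<forall>n.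
        \<forall>f\<in>Simp (Hom C w x) n. \<forall>g\<in>Simp (Hom C x y) n. \<forall>h\<in>Simp (Hom C y z) n.
          Cmp C w x z n (Cmp C x y z n h g) f = Cmp C w y z n h (Cmp C w x y n g f)) \<and>
     (\<forall>x\<in>Obj C. \<forall>y\<in>Obj C. \<forall>n. \<forall>f\<in>Simp (Hom C x y) n.
        Cmp C x x y n f (idn C x n) = f \<and> Cmp C x y y n (idn C y n) f = f)"

text \<open>
  A functor is a pair of its object map and its maps on simplices; both are required to be
  \<^const>\<open>undefined\<close> outside their domains, so that equality of functors is equality of pairs.
\<close>

definition sCat ::
    "('a, 's) scat \<Rightarrow> ('o, 'm) scat \<Rightarrow> (('a \<Rightarrow> 'o) \<times> ('a \<Rightarrow> 'a \<Rightarrow> nat \<Rightarrow> 's \<Rightarrow> 'm)) set" where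
  "sCat C A =
     {(F, u).
        F \<in> Obj C \<rightarrow>\<^sub>E Obj A \<and>
        (\<forall>x y n a. \<not> (x \<in> Obj C \<and> y \<in> Obj C \<and> a \<in> Simp (Hom C x y) n) \<longrightarrow> u x y n a = undefined) \<and>
        (\<forall>x\<in>Obj C. \<forall>y\<in>Obj C. \<forall>n. \<forall>a\<in>Simp (Hom C x y) n.
           u x y n a \<in> Simp (Hom A (F x) (F y)) n \<and>
           (\<forall>i\<le>n. n > 0 \<longrightarrow>
              u x y (n - 1) (Face (Hom C x y) n i a) = Face (Hom A (F x) (F y)) n i (u x y n a)) \<and>
           (\<forall>i\<le>n.
              u x y (Suc n) (Degen (Hom C x y) n i a) = Degen (Hom A (F x) (F y)) n i (u x y n a))) \<and>
        (\<forall>x\<in>Obj C. u x x 0 (Idn C x) = Idn A (F x)) \<and>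
        (\<forall>x\<in>Obj C. \<forall>y\<in>Obj C. \<forall>z\<in>Obj C. \<forall>n.
           \<forall>a\<in>Simp (Hom C x y) n. \<forall>b\<in>Simp (Hom C y z) n.
             u x z n (Cmp C x y z n b a) = Cmp A (F x) (F y) (F z) n (u y z n b) (u x y n a))}"

definition path_sset ::
    "('v, 'e) drawing \<Rightarrow> ('v, 'e) pre_digraph \<Rightarrow> ('v, 'e) pre_digraph set \<Rightarrow> 'e list list sset" where
  "path_sset D G S =
     \<lparr>Simp = nerve D G S,
      Face = (\<lambda>n i ps. take i ps @ drop (Suc i) ps),
      Degen = (\<lambda>n i ps. take (Suc i) ps @ drop i ps)\<rparr>"

definition path_scat ::
    "('v, 'e) drawing \<Rightarrow> ('v, 'e) pre_digraph \<Rightarrow> ('v, 'e) pre_digraph set \<Rightarrow> ('v, 'e list list) scat" where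
  "path_scat D G S =
     \<lparr>Obj = verts G,
      Hom = (\<lambda>x y. path_sset D (between G x y) (restricted G S x y)),
      Idn = (\<lambda>x. [[]]),
      Cmp = (\<lambda>x y z n qs ps. map2 (@) ps qs)\<rparr>"


section \<open>Labelings\<close>

text \<open>The composite of the labels along a nontrivial path, the first edge being applied first.\<close>

fun path_label ::
    "('v, 'e) pre_digraph \<Rightarrow> ('o, 'm) scat \<Rightarrow> ('v \<Rightarrow> 'o) \<Rightarrow> ('e \<Rightarrow> 'm) \<Rightarrow> 'e list \<Rightarrow> 'm" where
  "path_label G A V E [] = undefined"
| "path_label G A V E [e] = E e"
| "path_label G A V E (e # f # es) =
     Cmp A (V (tail G e)) (V (head G e)) (V (head G (last (f # es)))) 0
       (path_label G A V E (f # es)) (E e)"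

text \<open>
  A labeling consists of its values on vertices, edges and interior faces, each \<^const>\<open>undefined\<close>
  elsewhere.
\<close>

definition labelings ::
    "('v, 'e) drawing \<Rightarrow> ('v, 'e) pre_digraph \<Rightarrow> ('o, 'm) scat \<Rightarrow>
     (('v \<Rightarrow> 'o) \<times> ('e \<Rightarrow> 'm) \<times> (complex set \<Rightarrow> 'm)) set" where
  "labelings D G A =
     {(V, E, L).
        V \<in> verts G \<rightarrow>\<^sub>E Obj A \<and>
        E \<in> (\<Pi>\<^sub>E e\<in>arcs G. Simp (Hom A (V (tail G e)) (V (head G e))) 0) \<and>
        L \<in> (\<Pi>\<^sub>E \<phi>\<in>interior_faces D G.
               Simp (Hom A (V (face_src D G \<phi>)) (V (face_tgt D G \<phi>))) 1) \<and>
        (\<forall>\<phi>\<in>interior_faces D G.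
           Face (Hom A (V (face_src D G \<phi>)) (V (face_tgt D G \<phi>))) 1 0 (L \<phi>) =
             path_label G A V E (face_cod D G \<phi>) \<and>
           Face (Hom A (V (face_src D G \<phi>)) (V (face_tgt D G \<phi>))) 1 1 (L \<phi>) =
             path_label G A V E (face_dom D G \<phi>))}"

definition associated_labeling ::
    "('v, 'e) drawing \<Rightarrow> ('v, 'e) pre_digraph \<Rightarrow>
     ('v \<Rightarrow> 'o) \<times> ('v \<Rightarrow> 'v \<Rightarrow> nat \<Rightarrow> 'e list list \<Rightarrow> 'm) \<Rightarrow>
     ('v \<Rightarrow> 'o) \<times> ('e \<Rightarrow> 'm) \<times> (complex set \<Rightarrow> 'm)" where
  "associated_labeling D G = (\<lambda>(F, u).
     (\<lambda>x\<in>verts G. F x,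
      \<lambda>e\<in>arcs G. u (tail G e) (head G e) 0 [[e]],
      \<lambda>\<phi>\<in>interior_faces D G.
        u (face_src D G \<phi>) (face_tgt D G \<phi>) 1 [face_dom D G \<phi>, face_cod D G \<phi>]))"

end

theory Submission
  imports Defs
begin

text \<open>
  The simplices of the path category turn out to be free on arcs and interior faces, which is why a functor
  is the same thing as a labeling. The proof has a topological, a combinatorial and a formal part.

  \<^bold>\<open>Topology.\<close> A globular graph has no directed cycle (\<open>acyclic\<close>): the source and the target lie on
  the exterior face, so an arc inside a directed cycle could be extended to a walk across the cycle,
  and rerouting the cycle along it would enclose fewer arcs. Hence a cycle that encloses as few arcs
  as possible bounds a face, but no curve \<open>p \<cdot> q\<^sup>o\<^sup>p\<close> runs once around a directed cycle. Acyclicity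
  provides a rank function on the vertices, and with it the boundary of each interior face is seen
  to be a bigon: two paths that meet only in their end points (\<open>interior_face_bigon\<close>).

  \<^bold>\<open>Combinatorics.\<close> A chain is a sequence of arcs and interior faces, each of which starts where the
  preceding one ends. Chains are globs whose sides are composed of the sides of the pieces
  (\<open>word_glob\<close>); they are closed under joins by construction and under globular subgraphs because
  they are recognised by a local condition on outgoing arcs that subgraphs inherit
  (\<open>word_of_thin\<close>). So they are exactly the elements of \<open>S_min_complete\<close>
  (\<open>S_min_complete_chains\<close>). An \<open>n\<close>-simplex of the nerve is then a chain in which each face switches
  from its domain to its codomain at some row (\<open>nerve_nwords\<close>). If each face of the chain does
  switch strictly between the first and the last row, the chain and its switching rows are
  determined by the simplex (\<open>nword_unique\<close>).

  \<^bold>\<open>Category theory.\<close> A face that switches at row \<open>j\<close> is the image of the \<open>1\<close>-simplex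
  \<open>dom \<le> cod\<close> under the simplicial operator of the monotone map \<open>[n] \<rightarrow> [1]\<close> with \<open>j\<close> zeros. So a
  functor is determined by its labeling (\<open>functor_from_labels\<close>); and the composite of the images of
  the labels under these operators defines a functor for each labeling, where the conditions on
  \<open>d\<^sub>0\<close> and \<open>d\<^sub>1\<close> of a label ensure that passing to the normal form does not change the value
  (\<open>normal_form\<close>, \<open>ufun_functor\<close>).
\<close>

(* connectedness is meant in the topological sense *)
hide_const (open) Digraph_Component.connected

section \<open>Plane curves made of arcs\<close>

text \<open>
  Unlike the winding number of the curve of a walk, this sum makes sense for trivial walks and is
  additive; off the curve of a nontrivial walk the two agree.
\<close>

definition wind :: "('v, 'e) drawing \<Rightarrow> 'e list \<Rightarrow> complex \<Rightarrow> complex" where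
  "wind D p z = (\<Sum>e\<leftarrow>p. winding_number (crv D e) z)"

definition img :: "('v, 'e) drawing \<Rightarrow> 'e set \<Rightarrow> complex set" where
  "img D S = (\<Union>e\<in>S. path_image (crv D e))"

lemma wind_Nil [simp]: "wind D [] z = 0"
  and wind_Cons [simp]: "wind D (e # p) z = winding_number (crv D e) z + wind D p z"
  and wind_append [simp]: "wind D (p @ q) z = wind D p z + wind D q z"
  by (simp_all add: wind_def)

lemma img_empty [simp]: "img D {} = {}"
  and img_insert [simp]: "img D (insert e S) = path_image (crv D e) \<union> img D S"
  and img_Un [simp]: "img D (S \<union> T) = img D S \<union> img D T"
  by (auto simp: img_def)

lemma img_mono: "S \<subseteq> T \<Longrightarrow> img D S \<subseteq> img D T"
  by (auto simp: img_def)

locale plane_digraph =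
  fixes D :: "('v, 'e) drawing" and G :: "('v, 'e) pre_digraph"
  assumes plane: "plane_graph D G"

sublocale plane_digraph \<subseteq> fin_digraph G
  using plane by (simp add: plane_graph_def)

context plane_digraph
begin

lemma crv:
  assumes "e \<in> arcs G"
  shows "simple_path (crv D e)" "path (crv D e)"
    "pathstart (crv D e) = vpt D (tail G e)" "pathfinish (crv D e) = vpt D (head G e)"
    "edge_interior D e \<inter> vpt D ` verts G = {}"
  using assms plane by (auto simp: plane_graph_def simple_path_imp_path)

lemma vpt_inj: "u \<in> verts G \<Longrightarrow> v \<in> verts G \<Longrightarrow> vpt D u = vpt D v \<longleftrightarrow> u = v"
  using plane by (auto simp: plane_graph_def inj_on_def)

lemma edge_interior_disjoint:
  "e \<in> arcs G \<Longrightarrow> f \<in> arcs G \<Longrightarrow> e \<noteq> f \<Longrightarrow> edge_interior D e \<inter> edge_interior D f = {}"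
  using plane by (auto simp: plane_graph_def)

lemma edge_image:
  assumes "e \<in> arcs G"
  shows "path_image (crv D e) = {vpt D (tail G e), vpt D (head G e)} \<union> edge_interior D e"
proof -
  have "{0..1::real} = {0,1} \<union> {0<..<1}" by auto
  then show ?thesis
    using crv(3,4)[OF assms]
    by (auto simp: path_image_def edge_interior_def pathstart_def pathfinish_def)
qed

lemma edge_interior_ne: "edge_interior D e \<noteq> {}"
  by (auto simp: edge_interior_def)

lemma edge_interior_connected:
  assumes "e \<in> arcs G" shows "connected (edge_interior D e)"
proof -
  have "continuous_on {0<..<1} (crv D e)"
    using crv(2)[OF assms] by (auto simp: path_def intro: continuous_on_subset)
  then show ?thesis
    by (auto simp: edge_interior_def intro!: connected_continuous_image)
qed

lemma edge_image_closure:
  assumes "e \<in> arcs G" shows "path_image (crv D e) \<subseteq> closure (edge_interior D e)"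
proof -
  have c: "continuous_on (closure {0<..<1}) (crv D e)"
    using crv(2)[OF assms] by (auto simp: path_def)
  have "crv D e ` closure {0<..<1} \<subseteq> closure (crv D e ` {0<..<1})"
    by (rule image_closure_subset[OF c]) (auto intro: closure_subset[THEN subsetD])
  then show ?thesis by (simp add: edge_interior_def path_image_def)
qed

lemma compact_img: "S \<subseteq> arcs G \<Longrightarrow> compact (img D S)"
  unfolding img_def
  by (intro compact_UN) (auto intro: finite_subset compact_path_image crv(2))

lemma vpt_in_img:
  assumes "S \<subseteq> arcs G" "v \<in> verts G"
  shows "vpt D v \<in> img D S \<longleftrightarrow> v \<in> tail G ` S \<union> head G ` S"
proof -
  have "vpt D v \<in> path_image (crv D e) \<longleftrightarrow> v = tail G e \<or> v = head G e" if "e \<in> S" for e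
  proof -
    have e: "e \<in> arcs G" using that assms by auto
    have "vpt D v \<notin> edge_interior D e" using crv(5)[OF e] assms(2) by auto
    then show ?thesis using e assms(2) vpt_inj by (auto simp: edge_image)
  qed
  then show ?thesis by (auto simp: img_def)
qed

lemma edge_interior_img:
  assumes "S \<subseteq> arcs G" "e \<in> arcs G" "e \<notin> S"
  shows "edge_interior D e \<inter> img D S = {}"
proof -
  have "edge_interior D e \<inter> path_image (crv D f) = {}" if "f \<in> S" for f
  proof -
    have f: "f \<in> arcs G" "e \<noteq> f" using that assms by auto
    show ?thesis
      using edge_interior_disjoint[OF assms(2) f] crv(5)[OF assms(2)] f
      by (auto simp: edge_image)
  qed
  then show ?thesis by (auto simp: img_def)
qed

lemma img_subset_iff:
  assumes "S \<subseteq> arcs G" "T \<subseteq> arcs G"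
  shows "img D S \<subseteq> img D T \<longleftrightarrow> S \<subseteq> T"
proof
  assume sub: "img D S \<subseteq> img D T"
  show "S \<subseteq> T"
  proof
    fix e assume e: "e \<in> S"
    have "edge_interior D e \<subseteq> img D S"
      using e assms edge_image[of e] by (auto simp: img_def)
    then show "e \<in> T"
      using edge_interior_img[OF assms(2), of e] edge_interior_ne[of e] sub e assms by blast
  qed
qed (rule img_mono)

lemma img_eq_iff: "S \<subseteq> arcs G \<Longrightarrow> T \<subseteq> arcs G \<Longrightarrow> img D S = img D T \<longleftrightarrow> S = T"
  by (metis img_subset_iff order_antisym subset_refl)

lemma img_Int:
  assumes "S \<subseteq> arcs G" "T \<subseteq> arcs G" "S \<inter> T = {}"
  shows "img D S \<inter> img D T =
    vpt D ` ((tail G ` S \<union> head G ` S) \<inter> (tail G ` T \<union> head G ` T))"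
proof -
  have "z \<in> vpt D ` ((tail G ` S \<union> head G ` S) \<inter> (tail G ` T \<union> head G ` T))"
    if "z \<in> path_image (crv D e)" "z \<in> path_image (crv D f)" "e \<in> S" "f \<in> T" for e f z
  proof -
    have ef: "e \<in> arcs G" "f \<in> arcs G" "e \<noteq> f" using that assms by auto
    have "z \<notin> edge_interior D e" "z \<notin> edge_interior D f"
      using that edge_interior_img[of "{f}" e] edge_interior_img[of "{e}" f] ef by auto
    then have "z = vpt D (tail G e) \<or> z = vpt D (head G e)"
      "z = vpt D (tail G f) \<or> z = vpt D (head G f)" using that ef by (auto simp: edge_image)
    then obtain v w where "z = vpt D v" "v \<in> {tail G e, head G e}" "z = vpt D w" "w \<in> {tail G f, head G f}"
      by blast
    moreover then have "v = w" using vpt_inj[of v w] ef by auto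
    ultimately show ?thesis using that by auto
  qed
  then have "img D S \<inter> img D T \<subseteq> vpt D ` ((tail G ` S \<union> head G ` S) \<inter> (tail G ` T \<union> head G ` T))"
    by (auto simp: img_def)
  moreover have "vpt D v \<in> img D S \<inter> img D T"
    if "v \<in> (tail G ` S \<union> head G ` S) \<inter> (tail G ` T \<union> head G ` T)" for v
  proof -
    have "v \<in> verts G" using that assms by auto
    then show ?thesis using that vpt_in_img assms by auto
  qed
  ultimately show ?thesis by blast
qed

lemma awalk_arcs: "awalk u p v \<Longrightarrow> set p \<subseteq> arcs G"
  by (simp add: awalk_def)

lemma walk_curve_aux:
  assumes "awalk u p v" "p \<noteq> []"
  shows "path (walk_curve D p) \<and> pathstart (walk_curve D p) = vpt D u \<and>
    pathfinish (walk_curve D p) = vpt D v \<and> path_image (walk_curve D p) = img D (set p) \<and>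
    (\<forall>z. z \<notin> img D (set p) \<longrightarrow> winding_number (walk_curve D p) z = wind D p z)"
  using assms
proof (induction p arbitrary: u rule: induct_list012)
  case (2 e)
  then have "e \<in> arcs G" "tail G e = u" "head G e = v" by (auto simp: awalk_Cons_iff awalk_Nil_iff)
  then show ?case using crv[of e] by auto
next
  case (3 e f es)
  then have e: "e \<in> arcs G" "tail G e = u" "awalk (head G e) (f # es) v"
    by (auto simp: awalk_Cons_iff)
  note IH = 3(2)[OF e(3)]
  show ?case using IH crv[OF e(1)] e
    by (auto simp: path_image_join winding_number_join simp del: wind_Cons)
       (simp add: wind_Cons)
qed simp

lemma walk_curve:
  assumes "awalk u p v" "p \<noteq> []"
  shows "path (walk_curve D p)" "pathstart (walk_curve D p) = vpt D u"
    "pathfinish (walk_curve D p) = vpt D v" "path_image (walk_curve D p) = img D (set p)"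
    "z \<notin> img D (set p) \<Longrightarrow> winding_number (walk_curve D p) z = wind D p z"
  using walk_curve_aux[OF assms] by auto

lemma apath_arc:
  assumes "apath u p v" "p \<noteq> []"
  shows "Path_Connected.arc (walk_curve D p)"
  using assms
proof (induction p arbitrary: u rule: induct_list012)
  case (2 e)
  then have e: "e \<in> arcs G" "tail G e \<noteq> head G e"
    by (auto simp: apath_Cons_iff apath_Nil_iff)
  then show ?case using crv[of e] vpt_inj[of "tail G e" "head G e"]
    by (auto simp: arc_simple_path)
next
  case (3 e f es)
  then have e: "e \<in> arcs G" "tail G e = u" "apath (head G e) (f # es) v"
    and u: "u \<notin> set (awalk_verts (head G e) (f # es))"
    by (auto simp: apath_Cons_iff)
  have w: "awalk (head G e) (f # es) v" using e(3) by (simp add: apath_def)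
  have ends: "tail G ` set (f # es) \<union> head G ` set (f # es) \<subseteq> set (awalk_verts (head G e) (f # es))"
    using set_awalk_verts[OF w] by auto
  have "e \<notin> set (f # es)" using ends u e by blast
  then have "img D {e} \<inter> img D (set (f # es)) =
     vpt D ` ({tail G e, head G e} \<inter> (tail G ` set (f # es) \<union> head G ` set (f # es)))"
    using awalk_arcs[OF w] e(1) by (subst img_Int) auto
  also have "\<dots> \<subseteq> {vpt D (head G e)}" using ends u e by auto
  finally have "path_image (crv D e) \<inter> path_image (walk_curve D (f # es)) \<subseteq> {vpt D (head G e)}"
    using walk_curve(4)[OF w] by simp
  moreover have "tail G e \<noteq> head G e" using u e hd_in_awalk_verts(2)[OF e(3)] by metis
  then have "Path_Connected.arc (crv D e)" using crv[OF e(1)] vpt_inj[of "tail G e" "head G e"] e(1)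
    by (auto simp: arc_simple_path)
  ultimately show ?case using 3(2)[OF e(3)] walk_curve(2)[OF w] crv[OF e(1)]
    by (auto intro!: arc_join)
qed simp

text \<open>The boundary of a disc, cut into two directed sides; every interior face will turn out to have this shape.\<close>

definition bigon :: "'v \<Rightarrow> 'e list \<Rightarrow> 'e list \<Rightarrow> 'v \<Rightarrow> bool" where
  "bigon x p q y \<longleftrightarrow> apath x p y \<and> apath x q y \<and> x \<noteq> y \<and> set p \<inter> set q = {} \<and>
     set (awalk_verts x p) \<inter> set (awalk_verts x q) = {x, y}"

text \<open>The directions of the arcs are left out, so that bigons and directed cycles are both covered.\<close>

definition ring :: "'e set \<Rightarrow> bool" where
  "ring C \<longleftrightarrow> C \<subseteq> arcs G \<and>
     (\<exists>c. simple_path c \<and> pathfinish c = pathstart c \<and> path_image c = img D C)"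

lemma bigonD:
  assumes "bigon x p q y"
  shows "p \<noteq> []" "q \<noteq> []" "awalk x p y" "awalk x q y" "apath x p y" "apath x q y" "x \<noteq> y"
    "set p \<inter> set q = {}" "set (awalk_verts x p) \<inter> set (awalk_verts x q) = {x, y}"
  using assms by (auto simp: bigon_def apath_def awalk_Nil_iff)

lemma bigon_sym: "bigon x p q y \<Longrightarrow> bigon x q p y"
  by (auto simp: bigon_def)

lemma walk_pair:
  assumes "awalk x p y" "awalk x q y" "p \<noteq> []" "q \<noteq> []"
  defines "c \<equiv> walk_curve D p +++ reversepath (walk_curve D q)"
  shows "path c" "pathfinish c = pathstart c" "path_image c = img D (set p \<union> set q)"
    "z \<notin> img D (set p \<union> set q) \<Longrightarrow> winding_number c z = wind D p z - wind D q z"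
  using walk_curve[OF assms(1,3)] walk_curve[OF assms(2,4)]
  by (auto simp: c_def path_image_join winding_number_join winding_number_reversepath)

lemma bigon_simple:
  assumes "bigon x p q y"
  shows "simple_path (walk_curve D p +++ reversepath (walk_curve D q))"
proof -
  note b = bigonD[OF assms]
  have ends: "tail G ` set p \<union> head G ` set p = set (awalk_verts x p)"
     "tail G ` set q \<union> head G ` set q = set (awalk_verts x q)"
    using b by (auto simp: set_awalk_verts_not_Nil)
  have "img D (set p) \<inter> img D (set q) \<subseteq> {vpt D x, vpt D y}"
    using b by (subst img_Int) (auto simp: ends)
  then show ?thesis
    using walk_curve[OF b(3,1)] walk_curve[OF b(4,2)] apath_arc[OF b(5,1)] apath_arc[OF b(6,2)]
    by (intro simple_path_join_loop) (auto simp: arc_reversepath)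
qed

lemma bigon_ring:
  assumes "bigon x p q y"
  shows "ring (set p \<union> set q)"
  using bigonD[OF assms] bigon_simple[OF assms] walk_pair[of x p y q]
  unfolding ring_def by (metis Un_least awalkE)

lemma closing_arc_notin:
  assumes "apath (head G e) p (tail G e)" shows "e \<notin> set p"
proof
  assume "e \<in> set p"
  then obtain p1 p2 where p: "p = p1 @ e # p2" by (auto simp: in_set_conv_decomp)
  then have "apath (head G e) (p1 @ e # p2) (tail G e)" using assms by simp
  then have "apath (head G e) p1 (tail G e)" "apath (head G e) p2 (tail G e)"
    "set (awalk_verts (head G e) p1) \<inter> set (awalk_verts (head G e) p2) = {}"
    by (auto simp: apath_append_iff apath_Cons_iff)
  then show False using hd_in_awalk_verts(2) by blast
qed

lemma cycle_ring:
  assumes e: "e \<in> arcs G" and p: "apath (head G e) p (tail G e)"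
  shows "ring (set (e # p))"
proof (cases "p = []")
  case True
  then show ?thesis using e p crv[OF e] by (auto simp: ring_def apath_Nil_iff intro!: exI[of _ "crv D e"])
next
  case False
  have w: "awalk (head G e) p (tail G e)" using p by (simp add: apath_def)
  have ne: "tail G e \<noteq> head G e" using p False apath_nonempty_ends[OF p] by auto
  have "e \<notin> set p" by (rule closing_arc_notin[OF p])
  then have "img D {e} \<inter> img D (set p) =
      vpt D ` ({tail G e, head G e} \<inter> (tail G ` set p \<union> head G ` set p))"
    using e awalk_arcs[OF w] by (subst img_Int) auto
  then have *: "img D {e} \<inter> img D (set p) \<subseteq> {vpt D (head G e), vpt D (tail G e)}" by auto
  have "Path_Connected.arc (crv D e)"
    using crv[OF e] vpt_inj[of "tail G e" "head G e"] e ne by (auto simp: arc_simple_path)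
  then have "simple_path (crv D e +++ walk_curve D p)"
    using * walk_curve[OF w False] crv[OF e] apath_arc[OF p False]
    by (intro simple_path_join_loop) auto
  then show ?thesis
    using walk_curve[OF w False] crv[OF e] e awalk_arcs[OF w] unfolding ring_def
    by (intro conjI exI[of _ "crv D e +++ walk_curve D p"]) (auto simp: path_image_join)
qed

lemma ring_jordan:
  assumes "ring C"
  defines "J \<equiv> img D C"
  shows "open (inside J)" "connected (inside J)" "inside J \<noteq> {}" "bounded (inside J)"
    "open (outside J)" "connected (outside J)" "\<not> bounded (outside J)"
    "inside J \<inter> outside J = {}" "inside J \<union> outside J = - J"
    "frontier (inside J) = J" "frontier (outside J) = J"
    "closure (inside J) = inside J \<union> J" "closure (outside J) = outside J \<union> J"
    "C \<subseteq> arcs G"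
proof -
  obtain c where c: "simple_path c" "pathfinish c = pathstart c" "path_image c = J" and C: "C \<subseteq> arcs G"
    using assms by (auto simp: ring_def)
  have f: "frontier (inside J) = J" "frontier (outside J) = J"
    using Jordan_inside_outside[OF c(1,2)] by (simp_all add: c(3))
  show "open (inside J)" "connected (inside J)" "inside J \<noteq> {}" "bounded (inside J)"
    "open (outside J)" "connected (outside J)" "\<not> bounded (outside J)"
    "inside J \<inter> outside J = {}" "inside J \<union> outside J = - J" "C \<subseteq> arcs G"
    using Jordan_inside_outside[OF c(1,2)] C by (simp_all add: c(3))
  show "frontier (inside J) = J" "frontier (outside J) = J" by (fact f)+
  show "closure (inside J) = inside J \<union> J" "closure (outside J) = outside J \<union> J"
    using f by (metis closure_Un_frontier)+
qed

lemma connected_in_ring: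
  assumes "ring C" "connected S" "S \<inter> img D C = {}" "S \<inter> inside (img D C) \<noteq> {}"
  shows "S \<subseteq> inside (img D C)"
proof -
  note J = ring_jordan[OF assms(1)]
  have "S \<subseteq> inside (img D C) \<union> outside (img D C)" using assms(3) J(9) by auto
  then have "outside (img D C) \<inter> S = {}"
    using connectedD[OF assms(2) J(1) J(5)] J(8) assms(4) by blast
  then show ?thesis using \<open>S \<subseteq> _\<close> by blast
qed

text \<open>
  The open arc is connected and misses the Jordan curve of \<open>C\<close>, so it lies on one side of it.
\<close>

lemma inside_step:
  assumes "ring C" "e \<in> arcs G" "e \<notin> C"
    "edge_interior D e \<inter> inside (img D C) \<noteq> {} \<or>
     vpt D (tail G e) \<in> inside (img D C) \<or> vpt D (head G e) \<in> inside (img D C)"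
  shows "edge_interior D e \<subseteq> inside (img D C)"
    "vpt D (tail G e) \<in> inside (img D C) \<or> tail G e \<in> tail G ` C \<union> head G ` C"
    "vpt D (head G e) \<in> inside (img D C) \<or> head G e \<in> tail G ` C \<union> head G ` C"
proof -
  note J = ring_jordan[OF assms(1)]
  have "edge_interior D e \<inter> inside (img D C) \<noteq> {}"
  proof (rule ccontr)
    assume "\<not> edge_interior D e \<inter> inside (img D C) \<noteq> {}"
    then have "closure (edge_interior D e) \<inter> inside (img D C) = {}"
      using open_Int_closure_eq_empty[OF J(1), of "edge_interior D e"] by blast
    then show False
      using assms(4) edge_image_closure[OF assms(2)] edge_image[OF assms(2)] by blast
  qed
  then show i: "edge_interior D e \<subseteq> inside (img D C)"
    using connected_in_ring[OF assms(1) edge_interior_connected[OF assms(2)]]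
      edge_interior_img[OF J(14) assms(2,3)] by blast
  have "path_image (crv D e) \<subseteq> inside (img D C) \<union> img D C"
    using edge_image_closure[OF assms(2)] closure_mono[OF i] J(12) by auto
  then have "vpt D (tail G e) \<in> inside (img D C) \<union> img D C"
    "vpt D (head G e) \<in> inside (img D C) \<union> img D C"
    using edge_image[OF assms(2)] by auto
  then show "vpt D (tail G e) \<in> inside (img D C) \<or> tail G e \<in> tail G ` C \<union> head G ` C"
    "vpt D (head G e) \<in> inside (img D C) \<or> head G e \<in> tail G ` C \<union> head G ` C"
    using vpt_in_img[OF J(14)] assms(2) by auto
qed

text \<open>
  By planarity an arc outside \<open>C\<close> does not meet the Jordan curve of \<open>C\<close> except in vertices, so a walk
  changes sides at a vertex of \<open>C\<close> only. The part of the walk inside the curve is kept track of, because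
  it is needed for rerouting cycles.
\<close>

lemma walk_out_of_ring:
  assumes "ring C" "awalk v p w" "vpt D v \<in> inside (img D C)" "vpt D w \<notin> inside (img D C)"
  shows "\<exists>u p1 p2. p = p1 @ p2 \<and> awalk v p1 u \<and> awalk u p2 w \<and> u \<in> tail G ` C \<union> head G ` C \<and>
    (\<forall>f\<in>set p1. edge_interior D f \<subseteq> inside (img D C))"
  using assms(2,3)
proof (induction p arbitrary: v)
  case Nil
  then show ?case using assms(4) by (auto simp: awalk_Nil_iff)
next
  case (Cons e p)
  then have e: "e \<in> arcs G" "tail G e = v" "awalk (head G e) p w" by (auto simp: awalk_Cons_iff)
  note J = ring_jordan[OF assms(1)]
  show ?case
  proof (cases "e \<in> C")
    case True
    then show ?thesis using e J(14) Cons(2)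
      by (intro exI[of _ v] exI[of _ "[]"] exI[of _ "e # p"]) (auto simp: awalk_Nil_iff)
  next
    case False
    note st = inside_step[OF assms(1) e(1) False]
    show ?thesis
    proof (cases "head G e \<in> tail G ` C \<union> head G ` C")
      case True
      then show ?thesis using e Cons(2,3) st(1)
        by (intro exI[of _ "head G e"] exI[of _ "[e]"] exI[of _ p])
           (auto simp: awalk_Cons_iff awalk_Nil_iff)
    next
      case False
      then have "vpt D (head G e) \<in> inside (img D C)" using st(3) Cons(3) e by blast
      then obtain u p1 p2 where *: "p = p1 @ p2" "awalk (head G e) p1 u" "awalk u p2 w"
        "u \<in> tail G ` C \<union> head G ` C" "\<forall>f\<in>set p1. edge_interior D f \<subseteq> inside (img D C)"
        using Cons.IH[OF e(3)] by blast
      then show ?thesis using e st(1) Cons(3)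
        by (intro exI[of _ u] exI[of _ "e # p1"] exI[of _ p2]) (auto simp: awalk_Cons_iff)
    qed
  qed
qed

lemma walk_into_ring:
  assumes "ring C" "awalk v p w" "vpt D v \<notin> inside (img D C)" "vpt D w \<in> inside (img D C)"
  shows "\<exists>u p1 p2. p = p1 @ p2 \<and> awalk v p1 u \<and> awalk u p2 w \<and> u \<in> tail G ` C \<union> head G ` C \<and>
    (\<forall>f\<in>set p2. edge_interior D f \<subseteq> inside (img D C))"
  using assms(2,4)
proof (induction p arbitrary: w rule: rev_induct)
  case Nil
  then show ?case using assms(3) by (auto simp: awalk_Nil_iff)
next
  case (snoc e p)
  then have e: "e \<in> arcs G" "head G e = w" "awalk v p (tail G e)"
    by (auto simp: awalk_Cons_iff awalk_Nil_iff)
  note J = ring_jordan[OF assms(1)]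
  show ?case
  proof (cases "e \<in> C")
    case True
    then show ?thesis using e J(14) snoc(2)
      by (intro exI[of _ w] exI[of _ "p @ [e]"] exI[of _ "[]"]) (auto simp: awalk_Nil_iff)
  next
    case False
    note st = inside_step[OF assms(1) e(1) False]
    show ?thesis
    proof (cases "tail G e \<in> tail G ` C \<union> head G ` C")
      case True
      then show ?thesis using e snoc(2,3) st(1)
        by (intro exI[of _ "tail G e"] exI[of _ p] exI[of _ "[e]"])
           (auto simp: awalk_Cons_iff awalk_Nil_iff)
    next
      case False
      then have "vpt D (tail G e) \<in> inside (img D C)" using st(2) snoc(3) e by blast
      then obtain u p1 p2 where *: "p = p1 @ p2" "awalk v p1 u" "awalk u p2 (tail G e)"
        "u \<in> tail G ` C \<union> head G ` C" "\<forall>f\<in>set p2. edge_interior D f \<subseteq> inside (img D C)"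
        using snoc.IH[OF e(3)] by blast
      then show ?thesis using e st(1) snoc(3)
        by (intro exI[of _ u] exI[of _ "p1"] exI[of _ "p2 @ [e]"])
           (auto simp: awalk_Cons_iff awalk_Nil_iff intro: awalk_appendI)
    qed
  qed
qed

text \<open>
  The outside of the larger curve is connected, unbounded and disjoint from the smaller curve, so it
  cannot meet the inside of the latter.
\<close>

lemma inside_ring_mono:
  assumes "ring C" "ring C'" "img D C' \<subseteq> inside (img D C) \<union> img D C"
  shows "inside (img D C') \<subseteq> inside (img D C)"
proof -
  note J = ring_jordan[OF assms(1)] and J' = ring_jordan[OF assms(2)]
  have "\<not> outside (img D C) \<subseteq> inside (img D C')"
    using J(7) J'(4) bounded_subset by blast
  then have "outside (img D C) \<inter> inside (img D C') = {}"
    using connected_in_ring[OF assms(2) J(6)] assms(3) J(8,9) by blast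
  then have "closure (outside (img D C)) \<inter> inside (img D C') = {}"
    using open_Int_closure_eq_empty[OF J'(1), of "outside (img D C)"] by blast
  then show ?thesis using J(9,13) by blast
qed

end

section \<open>Globular graphs are acyclic\<close>

text \<open>
  A larger connected set would meet the frontier of \<open>S\<close>, hence \<open>K\<close>.
\<close>

lemma component_of_complement:
  fixes S K :: "'a::real_normed_vector set"
  assumes "connected S" "S \<noteq> {}" "S \<inter> K = {}" "frontier S \<subseteq> K"
  shows "S \<in> components (- K)"
proof -
  have "S \<subseteq> T \<Longrightarrow> T \<subseteq> - K \<Longrightarrow> connected T \<Longrightarrow> T = S" for T
    using connected_Int_frontier[of T S] assms by blast
  then show ?thesis
    using assms by (auto simp: in_components_maximal)
qed

context plane_digraph
begin

lemma cycle_verts: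
  assumes "apath (head G e) p (tail G e)"
  shows "tail G ` set (e # p) \<union> head G ` set (e # p) = set (awalk_verts (head G e) p)"
proof -
  have w: "awalk (head G e) p (tail G e)" using assms by (simp add: apath_def)
  have "tail G e \<in> set (awalk_verts (head G e) p)" "head G e \<in> set (awalk_verts (head G e) p)"
    using w hd_in_awalk_verts(1)[OF w] last_in_set[OF awalk_verts_non_Nil, of "head G e" p]
    by (auto simp del: awalk_verts_non_Nil)
  then show ?thesis using set_awalk_verts[OF w] by auto
qed

text \<open>
  The arc \<open>g\<close> left out by \<open>q\<close> is what a cycle loses when its remaining part is replaced by a detour through
  its inside.
\<close>

lemma cycle_walk:
  assumes p: "apath (head G e) p (tail G e)" and e: "e \<in> arcs G"
    and j: "j \<in> set (awalk_verts (head G e) p)" "k \<in> set (awalk_verts (head G e) p)"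
  shows "\<exists>q g. awalk k q j \<and> set q \<subseteq> set (e # p) \<and> g \<in> set (e # p) \<and> g \<notin> set q"
proof -
  note en = closing_arc_notin[OF p]
  have w: "awalk (head G e) p (tail G e)" using p by (simp add: apath_def)
  have dp: "distinct p" using p distinct_verts_imp_distinct by (auto simp: apath_def)
  obtain a b where ab: "p = a @ b" "awalk (head G e) a k" "awalk k b (tail G e)"
    using awalk_decomp[OF w j(2)] by blast
  have "j \<in> set (awalk_verts (head G e) a) \<or> j \<in> set (awalk_verts k b)"
    using j(1) set_awalk_verts_append[OF ab(2,3)] ab(1) by auto
  then show ?thesis
  proof
    assume "j \<in> set (awalk_verts k b)"
    then obtain b1 b2 where "b = b1 @ b2" "awalk k b1 j" using awalk_decomp[OF ab(3)] by blast
    then show ?thesis using en ab by (intro exI[of _ b1] exI[of _ e]) auto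
  next
    assume "j \<in> set (awalk_verts (head G e) a)"
    then obtain a1 a2 where a: "a = a1 @ a2" "awalk (head G e) a1 j" "awalk j a2 k"
      using awalk_decomp[OF ab(2)] by blast
    show ?thesis
    proof (cases "a2 = []")
      case True
      then show ?thesis using a(3) by (intro exI[of _ "[]"] exI[of _ e]) (auto simp: awalk_Nil_iff)
    next
      case False
      have "awalk k (b @ e # a1) j" using ab a e by (auto simp: awalk_Cons_iff)
      moreover have "hd a2 \<in> set a2" using False by simp
      then have "hd a2 \<in> set p" "hd a2 \<notin> set (b @ e # a1)" using dp en ab a by auto
      ultimately show ?thesis using ab a by (intro exI[of _ "b @ e # a1"] exI[of _ "hd a2"]) auto
    qed
  qed
qed

lemma cycle_inj:
  assumes "apath (head G e) p (tail G e)"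
  shows "inj_on (tail G) (set (e # p))" "inj_on (head G) (set (e # p))"
proof -
  have w: "awalk (head G e) p (tail G e)" "cas (head G e) p (tail G e)"
    using assms by (auto simp: apath_def)
  have d: "distinct (awalk_verts (head G e) p)" using assms by (simp add: apath_def)
  have l: "p \<noteq> [] \<Longrightarrow> head G (last p) = tail G e" using w(1) by (auto simp: awalk_verts_conv)
  have h: "p \<noteq> [] \<Longrightarrow> tail G (hd p) = head G e" using w(2) by (cases p) auto
  have "distinct (map (tail G) (e # p))"
    using d l by (cases "p = []") (auto simp: awalk_verts_conv)
  moreover have "distinct (map (head G) (e # p))"
    using d h by (cases "p = []") (auto simp: awalk_verts_conv'[OF w(2)])
  ultimately show "inj_on (tail G) (set (e # p))" "inj_on (head G) (set (e # p))"
    by (auto simp: distinct_map)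
qed

text \<open>
  On a directed cycle each vertex has one outgoing arc, so that a walk is determined by its first
  vertex and its length.
\<close>

lemma deterministic_walks:
  assumes "inj_on (tail G) C" "awalk x p y" "awalk x q z" "set p \<subseteq> C" "set q \<subseteq> C"
  shows "\<exists>r. p = q @ r \<or> q = p @ r"
  using assms(2-)
proof (induction p arbitrary: x q)
  case (Cons e p)
  show ?case
  proof (cases q)
    case (Cons f q')
    then have "e = f" using assms(1) Cons.prems by (auto simp: awalk_Cons_iff inj_on_def)
    then have "\<exists>r. p = q' @ r \<or> q' = p @ r"
      using Cons.prems Cons by (intro Cons.IH[of "head G e"]) (auto simp: awalk_Cons_iff)
    then show ?thesis using Cons \<open>e = f\<close> by auto
  qed simp
qed auto

end

locale globular_plane_digraph = plane_digraph +
  assumes st: "st_graph D G"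
    and globular_faces: "\<And>\<phi>. \<phi> \<in> interior_faces D G \<Longrightarrow> globular_face D G \<phi>"
begin

lemma is_source_src: "is_source G (src G)" and is_target_tgt: "is_target G (tgt G)"
  using st theI'[of "is_source G"] theI'[of "is_target G"] by (auto simp: st_graph_def src_def tgt_def)

lemma compact_support: "compact (support D G)"
proof -
  have "support D G = vpt D ` verts G \<union> img D (arcs G)" by (simp add: support_def img_def)
  then show ?thesis using compact_img[of "arcs G"] by (simp add: compact_Un finite_imp_compact)
qed

lemma img_support: "C \<subseteq> arcs G \<Longrightarrow> img D C \<subseteq> support D G"
  by (auto simp: img_def support_def)

text \<open>
  Source and target lie on the frontier of the exterior face, which is outside of every cycle.
\<close>

lemma ends_not_inside:
  assumes "ring C"
  shows "vpt D (src G) \<notin> inside (img D C)" "vpt D (tgt G) \<notin> inside (img D C)"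
proof -
  note J = ring_jordan[OF assms]
  have "exterior D G \<subseteq> outside (img D C)"
    using outside_mono[OF img_support[OF J(14)]] by (simp add: exterior_def)
  then have "frontier (exterior D G) \<subseteq> outside (img D C) \<union> img D C"
    using closure_mono J(13) by (metis Diff_subset frontier_def order_trans)
  then show "vpt D (src G) \<notin> inside (img D C)" "vpt D (tgt G) \<notin> inside (img D C)"
    using st J(8,9) unfolding st_graph_def by blast+
qed

lemma cw_boundaryD:
  assumes "cw_boundary D G \<phi> p q"
  obtains x y where "p \<noteq> []" "q \<noteq> []" "trail x p y" "trail x q y"
    "frontier \<phi> = img D (set p \<union> set q)" 
    "\<And>z z'. z \<in> \<phi> \<Longrightarrow> z \<notin> img D (set p \<union> set q) \<Longrightarrow> z' \<notin> closure \<phi> \<Longrightarrow>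
      wind D p z - wind D q z = wind D p z' - wind D q z' - 1"
proof -
  obtain x y where xy: "p \<noteq> []" "q \<noteq> []" "trail x p y" "trail x q y"
    using assms by (auto simp: cw_boundary_def)
  then have w: "awalk x p y" "awalk x q y" by (auto simp: trail_def)
  note c = walk_pair[OF w xy(1,2)]
  have f: "frontier \<phi> = img D (set p \<union> set q)" using assms c(3) by (simp add: cw_boundary_def Let_def)
  moreover have "wind D p z - wind D q z = wind D p z' - wind D q z' - 1"
    if "z \<in> \<phi>" "z \<notin> img D (set p \<union> set q)" "z' \<notin> closure \<phi>" for z z'
  proof -
    have "z' \<notin> img D (set p \<union> set q)" using that(3) f by (auto simp: frontier_def)
    then show ?thesis using that assms c(4)[of z] c(4)[of z'] by (auto simp: cw_boundary_def Let_def)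
  qed
  ultimately show thesis using that xy by blast
qed

text \<open>
  Extend an arc \<open>f\<close> inside the cycle backwards on a walk from the source and forwards on a walk to the
  target. Both walks come from or lead to the outside, hence meet the cycle. Together with the part \<open>q\<close> of
  the cycle they yield a directed cycle that lies in the closed disc and misses the arc \<open>g\<close>, thus
  encloses fewer arcs.
\<close>

lemma minimal_cycle_empty:
  assumes C: "e \<in> arcs G" "apath (head G e) p (tail G e)"
  defines "region \<equiv> \<lambda>C. {f \<in> arcs G. path_image (crv D f) \<subseteq> inside (img D C) \<union> img D C}"
  assumes minimal: "\<And>e' p'. e' \<in> arcs G \<Longrightarrow> apath (head G e') p' (tail G e') \<Longrightarrow>
       card (region (set (e # p))) \<le> card (region (set (e' # p')))"
    and f: "f \<in> arcs G"
  shows "edge_interior D f \<inter> inside (img D (set (e # p))) = {}"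
proof (rule ccontr)
  assume ne: "\<not> ?thesis"
  define C where "C = set (e # p)"
  have rC: "ring C" using cycle_ring[OF C] by (simp add: C_def)
  note J = ring_jordan[OF rC]
  have inC: "edge_interior D g \<inter> inside (img D C) = {}" if "g \<in> C" for g
  proof -
    have "edge_interior D g \<subseteq> img D C" using that J(14) edge_image[of g] by (auto simp: img_def)
    then show ?thesis using J(9) by blast
  qed
  have fC: "f \<notin> C" using ne inC[of f] unfolding C_def by blast
  have clo: "path_image (crv D g) \<subseteq> inside (img D C) \<union> img D C"
    if "g \<in> arcs G" "edge_interior D g \<subseteq> inside (img D C)" for g
    using edge_image_closure[OF that(1)] closure_mono[OF that(2)] J(12) by auto
  have V: "tail G ` C \<union> head G ` C = set (awalk_verts (head G e) p)"
    using cycle_verts[OF C(2)] by (simp add: C_def)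
  have ne': "edge_interior D f \<inter> inside (img D C) \<noteq> {}" using ne by (simp add: C_def)
  note st = inside_step[OF rC f fC disjI1[OF ne']]
  obtain j r1 where j: "j \<in> tail G ` C \<union> head G ` C" "awalk j r1 (tail G f)"
    "\<forall>g\<in>set r1. edge_interior D g \<subseteq> inside (img D C)"
  proof (cases "tail G f \<in> tail G ` C \<union> head G ` C")
    case True
    then show ?thesis using f by (intro that[of "tail G f" "[]"]) (auto simp: awalk_Nil_iff)
  next
    case False
    then have "vpt D (tail G f) \<in> inside (img D C)" using st(2) by blast
    moreover obtain w where "awalk (src G) w (tail G f)" 
      using is_source_src tail_in_verts[OF f] unfolding is_source_def by blast
    ultimately show ?thesis
      using walk_into_ring[OF rC _ ends_not_inside(1)[OF rC]] that by blast
  qed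
  obtain k r2 where k: "k \<in> tail G ` C \<union> head G ` C" "awalk (head G f) r2 k"
    "\<forall>g\<in>set r2. edge_interior D g \<subseteq> inside (img D C)"
  proof (cases "head G f \<in> tail G ` C \<union> head G ` C")
    case True
    then show ?thesis using f by (intro that[of "head G f" "[]"]) (auto simp: awalk_Nil_iff)
  next
    case False
    then have "vpt D (head G f) \<in> inside (img D C)" using st(3) by blast
    moreover obtain w where "awalk (head G f) w (tgt G)" 
      using is_target_tgt head_in_verts[OF f] unfolding is_target_def by blast
    ultimately show ?thesis
      using walk_out_of_ring[OF rC _ _ ends_not_inside(2)[OF rC]] that by blast
  qed
  obtain q g where q: "awalk k q j" "set q \<subseteq> C" "g \<in> C" "g \<notin> set q"
    using cycle_walk[OF C(2,1), of j k] j(1) k(1) V unfolding C_def by blast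
  have "awalk (head G f) (r2 @ q @ r1) (tail G f)" using j k q by auto
  then obtain p' where p': "apath (head G f) p' (tail G f)" "set p' \<subseteq> set (r2 @ q @ r1)"
    using apath_awalk_to_apath awalk_to_apath_subset by blast
  define C' where "C' = set (f # p')"
  have rC': "ring C'" using cycle_ring[OF f p'(1)] by (simp add: C'_def)
  note J' = ring_jordan[OF rC']
  have C': "g' \<in> C \<and> g' \<noteq> g \<or> edge_interior D g' \<subseteq> inside (img D C)" if "g' \<in> C'" for g'
  proof -
    have "g' = f \<or> g' \<in> set q \<or> g' \<in> set r1 \<or> g' \<in> set r2" using that p'(2) by (auto simp: C'_def)
    then show ?thesis using q j(3) k(3) st(1) by auto
  qed
  have "img D C' \<subseteq> inside (img D C) \<union> img D C"
    using C' clo J'(14) by (fastforce simp: img_def)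
  note sub = inside_ring_mono[OF rC rC' this] this
  have "region C' \<subseteq> region C" using sub by (auto simp: region_def)
  moreover have "g \<in> region C" using q(3) J(14) by (auto simp: region_def img_def)
  moreover have "g \<notin> region C'"
  proof -
    have gC': "g \<notin> C'" using C'[of g] inC[OF q(3)] edge_interior_ne[of g] by blast
    have "edge_interior D g \<inter> img D C' = {}" using edge_interior_img[OF J'(14) _ gC'] q(3) J(14) by blast
    moreover have "edge_interior D g \<inter> inside (img D C') = {}" using sub(1) inC[OF q(3)] by blast
    moreover have "edge_interior D g \<subseteq> path_image (crv D g)"
      using edge_image[of g] q(3) J(14) by auto
    ultimately show ?thesis using edge_interior_ne[of g] by (auto simp: region_def)
  qed
  moreover have "finite (region C)" by (auto simp: region_def)
  ultimately have "card (region C') < card (region C)" by (intro psubset_card_mono) auto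
  then show False using minimal[OF f p'(1)] by (simp add: C_def C'_def)
qed

text \<open>
  A directed cycle that encloses as few arcs as possible encloses none, and no vertex either, since a
  walk from the source would lead there. So its inside is an interior face, bounded by \<open>p \<cdot> q\<^sup>o\<^sup>p\<close>. As \<open>p\<close>
  and \<open>q\<close> have the same end points and run along the cycle, they are equal; but then the winding number
  of \<open>p \<cdot> q\<^sup>o\<^sup>p\<close> is zero everywhere, whereas it should differ by one between the two sides.
\<close>

theorem acyclic:
  assumes "awalk v w v" shows "w = []"
proof (rule ccontr)
  assume "w \<noteq> []"
  define region where "region = (\<lambda>C. {f \<in> arcs G. path_image (crv D f) \<subseteq> inside (img D C) \<union> img D C})"
  define P where "P = (\<lambda>(e, p). e \<in> arcs G \<and> apath (head G e) p (tail G e))"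
  obtain e0 w' where w: "w = e0 # w'" using \<open>w \<noteq> []\<close> by (cases w) auto
  then have "awalk (head G e0) w' (tail G e0)" "e0 \<in> arcs G" using assms by (auto simp: awalk_Cons_iff)
  then have "P (e0, awalk_to_apath w')" using apath_awalk_to_apath by (auto simp: P_def)
  then obtain c where c: "P c"
    "\<And>c'. P c' \<Longrightarrow> card (region (set (fst c # snd c))) \<le> card (region (set (fst c' # snd c')))"
    using ex_has_least_nat[of P _ "\<lambda>c. card (region (set (fst c # snd c)))"] by metis
  obtain e p where ep': "c = (e, p)" by (cases c)
  have ep: "P (e, p)"
    "\<And>e' p'. P (e', p') \<Longrightarrow> card (region (set (e # p))) \<le> card (region (set (e' # p')))"
    using c[unfolded ep'] by force+
  then have C: "e \<in> arcs G" "apath (head G e) p (tail G e)" by (auto simp: P_def)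
  define C where "C = set (e # p)"
  have rC: "ring C" using cycle_ring[OF C] by (simp add: C_def)
  note J = ring_jordan[OF rC]
  have emp: "edge_interior D f \<inter> inside (img D C) = {}" if "f \<in> arcs G" for f
  proof -
    have "card (region (set (e # p))) \<le> card (region (set (e' # p')))"
      if "e' \<in> arcs G" "apath (head G e') p' (tail G e')" for e' p'
      using ep(2)[of e' p'] that by (simp add: P_def)
    then show ?thesis
      using minimal_cycle_empty[OF C _ that] unfolding C_def region_def by simp
  qed
  have vemp: "vpt D v \<notin> inside (img D C)" if v: "v \<in> verts G" for v
  proof
    assume i: "vpt D v \<in> inside (img D C)"
    obtain w where w: "awalk (src G) w v" using is_source_src v by (auto simp: is_source_def)
    obtain u w1 w2 where u: "awalk u w2 v" "u \<in> tail G ` C \<union> head G ` C"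
      "\<forall>f\<in>set w2. edge_interior D f \<subseteq> inside (img D C)"
      using walk_into_ring[OF rC w ends_not_inside(1)[OF rC] i] by blast
    show False
    proof (cases w2)
      case Nil
      then have "vpt D v \<in> img D C" using u J(14) v vpt_in_img[of C v] by (auto simp: awalk_Nil_iff)
      then show ?thesis using i J(9) by blast
    next
      case (Cons f w3)
      then show ?thesis using u emp[of f] edge_interior_ne[of f] by (auto simp: awalk_Cons_iff)
    qed
  qed
  have "support D G \<inter> inside (img D C) = {}"
    using emp vemp edge_image by (fastforce simp: support_def)
  then have "inside (img D C) \<in> faces D G"
    using J img_support[OF J(14)] unfolding faces_def by (intro component_of_complement) auto
  moreover have "inside (img D C) \<noteq> exterior D G"
    using J(4) unbounded_outside[OF compact_imp_bounded[OF compact_support]] by (auto simp: exterior_def)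
  ultimately have "inside (img D C) \<in> interior_faces D G" by (simp add: interior_faces_def)
  then obtain p1 p2 where cw: "cw_boundary D G (inside (img D C)) p1 p2"
    using globular_faces unfolding globular_face_def by blast
  obtain x y where xy: "p1 \<noteq> []" "p2 \<noteq> []" "trail x p1 y" "trail x p2 y"
    "frontier (inside (img D C)) = img D (set p1 \<union> set p2)" 
    "\<And>z z'. z \<in> inside (img D C) \<Longrightarrow> z \<notin> img D (set p1 \<union> set p2) \<Longrightarrow> z' \<notin> closure (inside (img D C)) \<Longrightarrow>
      wind D p1 z - wind D p2 z = wind D p1 z' - wind D p2 z' - 1"
    using cw_boundaryD[OF cw] by metis
  have w12: "awalk x p1 y" "awalk x p2 y" "distinct p1" "distinct p2" using xy by (auto simp: trail_def)
  have "img D C = img D (set p1 \<union> set p2)" using xy(5) J(10) by simp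
  then have CC: "C = set p1 \<union> set p2" using img_eq_iff[of C "set p1 \<union> set p2"] J(14) w12 awalk_arcs by simp
  note inj = cycle_inj[OF C(2), folded C_def]
  \<comment> \<open>a trail on the cycle that comes back to its end vertex would enter it twice by the same arc\<close>
  have eq: "r = []" if "awalk x (a @ r) y" "awalk x a y" "distinct (a @ r)" "set (a @ r) \<subseteq> C" "a \<noteq> []" for a r
  proof (rule ccontr)
    assume r: "r \<noteq> []"
    have "awalk y r y" using that(1,2) by auto
    then have "head G (last r) = y" "head G (last a) = y" using that(2,5) r
      by (auto dest!: awlast_of_awalk simp: awalk_verts_conv)
    moreover have l: "last r \<in> set r" "last a \<in> set a" using that(5) r by auto
    then have "last r \<in> C" "last a \<in> C" using that(4) by auto
    ultimately have "last r = last a" using inj_onD[OF inj(2)] by metis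
    then show False using that(3) l by auto
  qed
  have "p1 = p2"
  proof -
    obtain r where "p1 = p2 @ r \<or> p2 = p1 @ r"
      using deterministic_walks[OF inj(1) w12(1,2)] CC by auto
    then show ?thesis
    proof
      assume "p1 = p2 @ r"
      then show ?thesis using eq[of p2 r] w12 CC xy(2) by (metis Un_upper1 append_Nil2)
    next
      assume "p2 = p1 @ r"
      then show ?thesis using eq[of p1 r] w12 CC xy(1) by (metis Un_upper2 append_Nil2)
    qed
  qed
  moreover obtain z z' where "z \<in> inside (img D C)" "z' \<in> outside (img D C)" using J(3,7) by fastforce
  moreover have "z \<notin> img D C" "z' \<notin> closure (inside (img D C))" using calculation(2,3) J(8,9,12) by blast+
  ultimately show False using xy(6)[of z z'] CC by auto
qed

text \<open>
  The rank of a vertex counts the vertices that precede it.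
\<close>

lemma rank_exists: "\<exists>rk :: 'a \<Rightarrow> nat. \<forall>e\<in>arcs G. rk (tail G e) < rk (head G e)"
proof (intro exI ballI)
  fix e assume e: "e \<in> arcs G"
  let ?R = "\<lambda>v. {u \<in> verts G. \<exists>p. p \<noteq> [] \<and> awalk u p v}"
  have "p @ [e] \<noteq> [] \<and> awalk u (p @ [e]) (head G e)" if "awalk u p (tail G e)" for u p
    using awalk_appendI[OF that arc_implies_awalk[OF e]] by blast
  then have "?R (tail G e) \<subseteq> ?R (head G e)" by (intro Collect_mono) metis
  moreover have "tail G e \<in> ?R (head G e)" using tail_in_verts[OF e] arc_implies_awalk[OF e] by simp blast
  moreover have "tail G e \<notin> ?R (tail G e)" using acyclic[of "tail G e"] by simp blast
  ultimately show "card (?R (tail G e)) < card (?R (head G e))"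
    by (intro psubset_card_mono) auto
qed

lemma bounded_interior_face:
  assumes "\<phi> \<in> interior_faces D G" shows "bounded \<phi>"
proof (rule ccontr)
  assume nb: "\<not> bounded \<phi>"
  have c: "\<phi> \<in> components (- support D G)" using assms by (auto simp: interior_faces_def faces_def)
  then obtain z where z: "z \<in> - support D G" "\<phi> = connected_component_set (- support D G) z"
    by (auto simp: components_def)
  have "connected (outside (support D G))"
    using compact_support by (intro connected_outside) (auto simp: compact_imp_bounded)
  moreover have "\<phi> \<subseteq> outside (support D G)"
  proof
    fix x assume "x \<in> \<phi>"
    then have "connected_component_set (- support D G) x = \<phi>"
      using connected_component_eq[of x "- support D G" z] z(2) by simp
    then show "x \<in> outside (support D G)" using nb by (simp add: outside)
  qed
  moreover have "outside (support D G) \<subseteq> - support D G" using outside_no_overlap by blast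
  moreover have "\<forall>T. T \<noteq> {} \<and> \<phi> \<subseteq> T \<and> T \<subseteq> - support D G \<and> connected T \<longrightarrow> T = \<phi>" "\<phi> \<noteq> {}"
    using c in_components_nonempty[OF c] by (simp_all add: in_components_maximal)
  ultimately have "outside (support D G) = \<phi>" by blast
  then show False using assms by (auto simp: interior_faces_def exterior_def)
qed

end

section \<open>Walks and bigons in ranked plane graphs\<close>

text \<open>
  A rank turns acyclicity into arithmetic: statements on the order of vertices along walks become
  inequalities.
\<close>

locale ranked_plane_digraph = plane_digraph D G
  for D :: "('v, 'e) drawing" and G :: "('v, 'e) pre_digraph" +
  fixes rk :: "'v \<Rightarrow> nat"
  assumes rk: "e \<in> arcs G \<Longrightarrow> rk (tail G e) < rk (head G e)"
begin

lemma rk_walk: "awalk x p y \<Longrightarrow> rk x + length p \<le> rk y"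
proof (induction p arbitrary: x)
  case (Cons e p)
  then have "rk (head G e) + length p \<le> rk y" "e \<in> arcs G" "tail G e = x" by (auto simp: awalk_Cons_iff)
  then show ?case using rk[of e] by auto
qed (auto simp: awalk_Nil_iff)

lemma closed_walk_Nil: "awalk x p x \<Longrightarrow> p = []"
  using rk_walk[of x p x] by simp

lemma rk_eq_walk: "awalk x p y \<Longrightarrow> rk y \<le> rk x \<Longrightarrow> x = y \<and> p = []"
  using rk_walk[of x p y] by (cases p) (auto simp: awalk_Nil_iff)

lemma walk_apath: "awalk x p y \<Longrightarrow> apath x p y"
  using awalk_not_distinct_decomp[of x p y] closed_walk_Nil unfolding apath_def by (metis length_0_conv less_numeral_extra(3))

lemma walk_tail_rank:
  assumes "awalk x p y" "e \<in> set p"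
  shows "rk x \<le> rk (tail G e)" "rk (head G e) \<le> rk y" "rk (tail G e) < rk y" "rk x < rk (head G e)"
proof -
  obtain p1 p2 where "p = p1 @ e # p2" using assms(2) by (auto simp: in_set_conv_decomp)
  then have w: "awalk x p1 (tail G e)" "awalk (head G e) p2 y" "e \<in> arcs G"
    using assms(1) by (auto simp: awalk_Cons_iff)
  show "rk x \<le> rk (tail G e)" "rk (head G e) \<le> rk y" "rk (tail G e) < rk y" "rk x < rk (head G e)"
    using rk_walk[OF w(1)] rk_walk[OF w(2)] rk[OF w(3)] by simp_all
qed

lemma walk_tail_inj:
  assumes "awalk x p y" "e \<in> set p" "f \<in> set p" "tail G e = tail G f"
  shows "e = f"
proof -
  obtain p1 p2 where p: "p = p1 @ e # p2" using assms(2) by (auto simp: in_set_conv_decomp)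
  then have w: "awalk x p1 (tail G e)" "awalk (head G e) p2 y" "e \<in> arcs G"
    using assms(1) by (auto simp: awalk_Cons_iff)
  then have "f \<notin> set p1" "f \<notin> set p2"
    using walk_tail_rank[OF w(1), of f] walk_tail_rank[OF w(2), of f] assms(4) rk[of e] by auto
  then show ?thesis using assms(3) p by auto
qed

lemma last_in_awalk_verts: "awalk x p y \<Longrightarrow> y \<in> set (awalk_verts x p)"
  using last_in_set[OF awalk_verts_non_Nil, of x p] by auto

lemma tail_hd: "awalk x p y \<Longrightarrow> p \<noteq> [] \<Longrightarrow> tail G (hd p) = x"
  by (cases p) (auto simp: awalk_Cons_iff)

lemma head_last: "awalk x p y \<Longrightarrow> p \<noteq> [] \<Longrightarrow> head G (last p) = y"
  by (auto dest!: awlast_of_awalk simp: awalk_verts_conv)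

text \<open>A walk in \<open>S\<close> that starts with the first arc of \<open>d\<close> has no choice but to follow \<open>d\<close>.\<close>

definition forced :: "'e set \<Rightarrow> 'e list \<Rightarrow> bool" where
  "forced S d \<longleftrightarrow> (\<forall>d1 a b d2. d = d1 @ a # b # d2 \<longrightarrow> (\<forall>f\<in>S. tail G f = head G a \<longrightarrow> f = b))"

lemma forced_mono: "forced T d \<Longrightarrow> S \<subseteq> T \<Longrightarrow> forced S d"
  unfolding forced_def by blast

lemma forced_walk_aux:
  assumes "forced S (a # d)" "awalk (head G a) d w" "awalk (head G a) p v" "set p \<subseteq> S"
  shows "\<exists>r. p = d @ r \<or> d = p @ r"
  using assms
proof (induction d arbitrary: a p)
  case (Cons b d)
  show ?case
  proof (cases p)
    case (Cons f p')
    have "tail G f = head G a" "f \<in> S" using Cons Cons.prems by (auto simp: awalk_Cons_iff)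
    then have "f = b" using Cons.prems(1) unfolding forced_def by (metis append_Nil)
    moreover have "forced S (b # d)"
      using Cons.prems(1) unfolding forced_def by (metis append_Cons)
    then have "\<exists>r. p' = d @ r \<or> d = p' @ r"
      using Cons Cons.prems \<open>f = b\<close> by (intro Cons.IH[of b]) (auto simp: awalk_Cons_iff)
    ultimately show ?thesis using Cons by auto
  qed simp
qed auto

lemma forced_walk:
  assumes "forced S d" "awalk u d w" "awalk u p v" "set p \<subseteq> S" "p \<noteq> []" "d \<noteq> []" "hd p = hd d"
  shows "\<exists>r. p = d @ r \<or> d = p @ r"
proof -
  obtain a d' p' where *: "d = a # d'" "p = a # p'" using assms(5-7) by (metis list.collapse)
  then have "\<exists>r. p' = d' @ r \<or> d' = p' @ r"
    using assms by (intro forced_walk_aux[of S a]) (auto simp: awalk_Cons_iff)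
  then show ?thesis using * by auto
qed

lemma inner_vertex:
  assumes "awalk x p y" "p = d1 @ a # b # d2"
  shows "head G a \<in> set (awalk_verts x p)" "head G a = tail G b" "rk x < rk (head G a)" "rk (head G a) < rk y"
    "a \<in> set p" "b \<in> set p"
proof -
  show ab: "a \<in> set p" "b \<in> set p" using assms(2) by auto
  then show "head G a \<in> set (awalk_verts x p)" using set_awalk_verts[OF assms(1)] by auto
  show "head G a = tail G b" using assms by (auto simp: awalk_Cons_iff)
  then show "rk x < rk (head G a)" "rk (head G a) < rk y"
    using walk_tail_rank[OF assms(1) ab(1)] walk_tail_rank[OF assms(1) ab(2)] by auto
qed

lemma bigon_forced:
  assumes "bigon x p q y" shows "forced (set p \<union> set q) p"
  unfolding forced_def
proof (intro allI impI ballI)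
  fix d1 a b d2 f
  assume p: "p = d1 @ a # b # d2" and f: "f \<in> set p \<union> set q" "tail G f = head G a"
  note b = bigonD[OF assms] and i = inner_vertex[OF bigonD(3)[OF assms] p]
  have "f \<notin> set q"
  proof
    assume "f \<in> set q"
    then have "tail G f \<in> set (awalk_verts x q)" using set_awalk_verts[OF b(4)] by auto
    then have "head G a \<in> set (awalk_verts x q)" using f(2) by simp
    then show False using i b(9) by auto
  qed
  then show "f = b" using walk_tail_inj[OF b(3)] f i by auto
qed

lemma bigon_src:
  assumes "bigon x p q y" "e \<in> set p \<union> set q" "tail G e = x"
  shows "e = hd p \<or> e = hd q"
proof -
  note b = bigonD[OF assms(1)]
  have "hd p \<in> set p" "hd q \<in> set q" using b by auto
  then show ?thesis
    using assms walk_tail_inj[OF b(3), of e "hd p"] walk_tail_inj[OF b(4), of e "hd q"]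
      tail_hd[OF b(3,1)] tail_hd[OF b(4,2)] by auto
qed

lemma bigon_vert_walk:
  assumes "bigon x p q y" "v \<in> tail G ` (set p \<union> set q) \<union> head G ` (set p \<union> set q)"
  shows "\<exists>w. awalk x w v" "\<exists>w. awalk v w y"
proof -
  note b = bigonD[OF assms(1)]
  have "v \<in> set (awalk_verts x p) \<or> v \<in> set (awalk_verts x q)"
    using assms(2) set_awalk_verts_not_Nil[OF b(3,1)] set_awalk_verts_not_Nil[OF b(4,2)] by auto
  then show "\<exists>w. awalk x w v" "\<exists>w. awalk v w y"
    using awalk_decomp[OF b(3), of v] awalk_decomp[OF b(4), of v] by metis+
qed

lemma bigon_walk:
  assumes "bigon x p q y" "awalk x w y" "set w \<subseteq> set p \<union> set q"
  shows "w = p \<or> w = q"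
proof -
  note b = bigonD[OF assms(1)]
  have w: "w \<noteq> []" using assms(2) b(7) by (auto simp: awalk_Nil_iff)
  have *: "w = d" if d: "forced (set p \<union> set q) d" "awalk x d y" "d \<noteq> []" "hd w = hd d" for d
  proof -
    obtain r where "w = d @ r \<or> d = w @ r"
      using forced_walk[OF d(1,2) assms(2,3) w d(3,4)] by blast
    then show ?thesis using assms(2) d(2) closed_walk_Nil[of y r] by auto
  qed
  have "hd w \<in> set w" using w by simp
  then have "hd w \<in> set p \<union> set q" using assms(3) by blast
  then have "hd w = hd p \<or> hd w = hd q"
    using bigon_src[OF assms(1)] tail_hd[OF assms(2) w] by simp
  moreover have "forced (set p \<union> set q) q"
    using bigon_forced[OF bigon_sym[OF assms(1)]] by (simp add: Un_commute)
  ultimately show ?thesis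
    using *[OF bigon_forced[OF assms(1)] b(3,1)] *[OF _ b(4,2)] by blast
qed

lemma bigon_unique:
  assumes "bigon x p q y" "bigon x' p' q' y'" "set p \<union> set q = set p' \<union> set q'"
  shows "x' = x \<and> y' = y \<and> (p' = p \<and> q' = q \<or> p' = q \<and> q' = p)"
proof -
  note b = bigonD[OF assms(1)] and b' = bigonD[OF assms(2)]
  have ends: "x \<in> tail G ` (set p \<union> set q)" "y \<in> head G ` (set p \<union> set q)" if "bigon x p q y" for x p q y
  proof -
    note b = bigonD[OF that]
    have "hd p \<in> set p" "last p \<in> set p" "tail G (hd p) = x" "head G (last p) = y"
      using b tail_hd[OF b(3,1)] head_last[OF b(3,1)] by auto
    then show "x \<in> tail G ` (set p \<union> set q)" "y \<in> head G ` (set p \<union> set q)" by blast+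
  qed
  obtain w1 where w1: "awalk x w1 x'"
    using bigon_vert_walk(1)[OF assms(1), of x'] ends(1)[OF assms(2)] assms(3) by auto
  obtain w2 where w2: "awalk x' w2 x"
    using bigon_vert_walk(1)[OF assms(2), of x] ends(1)[OF assms(1)] assms(3) by auto
  obtain w3 where w3: "awalk y' w3 y"
    using bigon_vert_walk(2)[OF assms(1), of y'] ends(2)[OF assms(2)] assms(3) by auto
  obtain w4 where w4: "awalk y w4 y'"
    using bigon_vert_walk(2)[OF assms(2), of y] ends(2)[OF assms(1)] assms(3) by auto
  have "x = x'" using rk_eq_walk[OF w1] rk_walk[OF w2] by simp
  moreover have "y = y'" using rk_eq_walk[OF w4] rk_walk[OF w3] by simp
  ultimately have xy: "x' = x" "y' = y" by simp_all
  have "p' = p \<or> p' = q" "q' = p \<or> q' = q"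
    using bigon_walk[OF assms(1)] b' xy assms(3) by auto
  moreover have "p' \<noteq> q'" using b'(1,8) by auto
  ultimately show ?thesis using xy by auto
qed

text \<open>
  Cut both walks at a common inner vertex: the difference of the winding numbers is additive, so one of
  the two halves still has a nonzero difference. Walks without a common inner vertex form a bigon.
\<close>

lemma bigon_decomposition:
  assumes "awalk x p y" "awalk x q y" "wind D p z \<noteq> wind D q z"
  shows "\<exists>p1 p2 p3 q1 q2 q3 u v. p = p1 @ p2 @ p3 \<and> q = q1 @ q2 @ q3 \<and> awalk x p1 u \<and> awalk x q1 u \<and>
    bigon u p2 q2 v \<and> awalk v p3 y \<and> awalk v q3 y \<and> wind D p2 z \<noteq> wind D q2 z"
  using assms
proof (induction "length p + length q" arbitrary: x y p q rule: less_induct)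
  case less
  have xy: "x \<noteq> y"
  proof
    assume "x = y"
    then have "p = []" "q = []"
      using closed_walk_Nil[of x p] closed_walk_Nil[of x q] less.prems by simp_all
    then show False using less.prems(3) by simp
  qed
  then have ne: "p \<noteq> []" "q \<noteq> []" using less.prems by (auto simp: awalk_Nil_iff)
  show ?case
  proof (cases "set (awalk_verts x p) \<inter> set (awalk_verts x q) \<subseteq> {x, y}")
    case True
    have "x \<in> set (awalk_verts x p) \<inter> set (awalk_verts x q)"
      using less.prems hd_in_awalk_verts by blast
    moreover have "y \<in> set (awalk_verts x p) \<inter> set (awalk_verts x q)"
      using less.prems last_in_awalk_verts by blast
    moreover have "set p \<inter> set q = {}"
    proof (rule ccontr)
      assume "\<not> ?thesis"
      then obtain e where e: "e \<in> set p" "e \<in> set q" by blast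
      have "{tail G e, head G e} \<subseteq> set (awalk_verts x p) \<inter> set (awalk_verts x q)"
        using e by (simp add: set_awalk_verts[OF less.prems(1)] set_awalk_verts[OF less.prems(2)])
      then have "tail G e \<in> {x, y}" "head G e \<in> {x, y}" using True by (meson insert_subset subsetD)+
      moreover have "tail G e \<noteq> y" "head G e \<noteq> x"
        using walk_tail_rank(3,4)[OF less.prems(1) e(1)] by fastforce+
      ultimately have te: "tail G e = x" "head G e = y" by simp_all
      have "r = [e]" if r: "awalk x r y" "e \<in> set r" for r
      proof -
        obtain r1 r2 where r12: "r = r1 @ e # r2" using r(2) by (auto simp: in_set_conv_decomp)
        then have "awalk x r1 (tail G e)" "awalk (head G e) r2 y" using r(1) by (auto simp: awalk_Cons_iff)
        then have "awalk x r1 x" "awalk y r2 y" by (simp_all only: te)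
        then show ?thesis using closed_walk_Nil[of x r1] closed_walk_Nil[of y r2] r12 by simp
      qed
      from this[OF less.prems(1) e(1)] this[OF less.prems(2) e(2)]
      show False using less.prems(3) by simp
    qed
    ultimately have big: "bigon x p q y" using True xy walk_apath less.prems by (auto simp: bigon_def)
    moreover have "awalk x [] x" "awalk y [] y"
      using less.prems(1) by (auto simp: awalk_Nil_iff)
    moreover have "p = [] @ p @ []" "q = [] @ q @ []" by simp_all
    show ?thesis
      by (rule exI[of _ "[]"], rule exI[of _ p], rule exI[of _ "[]"], rule exI[of _ "[]"], rule exI[of _ q], rule exI[of _ "[]"], rule exI[of _ x], rule exI[of _ y], intro conjI) fact+
  next
    case False
    then obtain w where w: "w \<in> set (awalk_verts x p)" "w \<in> set (awalk_verts x q)" "w \<noteq> x" "w \<noteq> y" by blast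
    obtain pa pb where p: "p = pa @ pb" "awalk x pa w" "awalk w pb y"
      using awalk_decomp[OF less.prems(1) w(1)] by blast
    obtain qa qb where q: "q = qa @ qb" "awalk x qa w" "awalk w qb y"
      using awalk_decomp[OF less.prems(2) w(2)] by blast
    have ne: "pa \<noteq> []" "pb \<noteq> []" using p(2,3) w by (auto simp: awalk_Nil_iff)
    have len: "length pa + length qa < length p + length q" "length pb + length qb < length p + length q"
      using ne by (simp_all add: p(1) q(1))
    have "wind D pa z \<noteq> wind D qa z \<or> wind D pb z \<noteq> wind D qb z"
      using less.prems(3) by (auto simp: p(1) q(1))
    then show ?thesis
    proof
      assume w: "wind D pa z \<noteq> wind D qa z"
      then obtain p1 p2 p3 q1 q2 q3 u v where *: "pa = p1 @ p2 @ p3" "qa = q1 @ q2 @ q3" "awalk x p1 u" "awalk x q1 u"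
        "bigon u p2 q2 v" "awalk v p3 w" "awalk v q3 w" "wind D p2 z \<noteq> wind D q2 z"
        using less.hyps[OF len(1) p(2) q(2) w] by (elim exE conjE) (rule that)
      have "awalk v (p3 @ pb) y" "awalk v (q3 @ qb) y"
        by (rule awalk_appendI[OF *(6) p(3)], rule awalk_appendI[OF *(7) q(3)])
      moreover have "p = p1 @ p2 @ p3 @ pb" "q = q1 @ q2 @ q3 @ qb"
        by (simp_all only: p(1) q(1) *(1,2) append_assoc)
      show ?thesis
        by (rule exI[of _ p1], rule exI[of _ p2], rule exI[of _ "p3 @ pb"], rule exI[of _ q1], rule exI[of _ q2], rule exI[of _ "q3 @ qb"], rule exI[of _ u], rule exI[of _ v], intro conjI) fact+
    next
      assume w: "wind D pb z \<noteq> wind D qb z"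
      then obtain p1 p2 p3 q1 q2 q3 u v where *: "pb = p1 @ p2 @ p3" "qb = q1 @ q2 @ q3" "awalk w p1 u" "awalk w q1 u"
        "bigon u p2 q2 v" "awalk v p3 y" "awalk v q3 y" "wind D p2 z \<noteq> wind D q2 z"
        using less.hyps[OF len(2) p(3) q(3) w] by (elim exE conjE) (rule that)
      have "awalk x (pa @ p1) u" "awalk x (qa @ q1) u"
        by (rule awalk_appendI[OF p(2) *(3)], rule awalk_appendI[OF q(2) *(4)])
      moreover have "p = (pa @ p1) @ p2 @ p3" "q = (qa @ q1) @ q2 @ q3"
        by (simp_all only: p(1) q(1) *(1,2) append_assoc)
      show ?thesis
        by (rule exI[of _ "pa @ p1"], rule exI[of _ p2], rule exI[of _ p3], rule exI[of _ "qa @ q1"], rule exI[of _ q2], rule exI[of _ q3], rule exI[of _ u], rule exI[of _ v], intro conjI) fact+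
    qed
  qed
qed

end

section \<open>Interior faces are bigons\<close>

locale ranked_globular_digraph =
  globular_plane_digraph D G + ranked_plane_digraph D G rk
  for D :: "('v, 'e) drawing" and G :: "('v, 'e) pre_digraph" and rk :: "'v \<Rightarrow> nat"
begin

lemma interior_face:
  assumes "\<phi> \<in> interior_faces D G"
  shows "\<phi> \<noteq> {}" "connected \<phi>" "\<phi> \<inter> support D G = {}" "bounded \<phi>"
    "C \<subseteq> arcs G \<Longrightarrow> \<phi> \<inter> img D C = {}" "\<phi> \<noteq> exterior D G" "\<phi> \<in> components (- support D G)"
proof -
  show c: "\<phi> \<in> components (- support D G)" using assms by (simp add: interior_faces_def faces_def)
  show "\<phi> \<noteq> {}" "connected \<phi>" using c in_components_nonempty in_components_connected by blast+
  show s: "\<phi> \<inter> support D G = {}" using in_components_subset[OF c] by blast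
  show "C \<subseteq> arcs G \<Longrightarrow> \<phi> \<inter> img D C = {}" using s img_support[of C] by blast
  show "bounded \<phi>" by (rule bounded_interior_face[OF assms])
  show "\<phi> \<noteq> exterior D G" using assms by (simp add: interior_faces_def)
qed

lemma interior_faces_disjoint:
  assumes "\<phi> \<in> interior_faces D G" "\<psi> \<in> interior_faces D G" "\<phi> \<noteq> \<psi>"
  shows "\<phi> \<inter> \<psi> = {}"
  using components_nonoverlap[OF interior_face(7)[OF assms(1)] interior_face(7)[OF assms(2)]] assms(3)
  by simp

lemma bigon_wind_outside:
  assumes "bigon x p q y" "z \<in> outside (img D (set p \<union> set q))"
  shows "wind D p z = wind D q z"
proof -
  note b = bigonD[OF assms(1)]
  note c = walk_pair[OF b(3,4,1,2)]
  have "z \<notin> img D (set p \<union> set q)" using assms(2) outside_no_overlap by blast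
  then have "winding_number (walk_curve D p +++ reversepath (walk_curve D q)) z = wind D p z - wind D q z"
    by (rule c(4))
  moreover have "winding_number (walk_curve D p +++ reversepath (walk_curve D q)) z = 0"
    using winding_number_zero_in_outside[OF c(1,2)] assms(2) c(3) by simp
  ultimately show ?thesis by simp
qed

text \<open>
  The boundary walks of a bounded face wind around it, so they contain a bigon \<open>B\<close> around the face.
  The remaining parts of the walks would have to lie inside \<open>B\<close>; but from there every walk to the
  target, and to there every walk from the source, crosses \<open>B\<close>, which closes a directed cycle.
\<close>

theorem interior_face_bigon:
  assumes \<phi>: "\<phi> \<in> interior_faces D G" and cw: "cw_boundary D G \<phi> p q"
  obtains x y where "bigon x p q y" "\<phi> = inside (img D (set p \<union> set q))"
    "frontier \<phi> = img D (set p \<union> set q)" "\<And>z. z \<in> \<phi> \<Longrightarrow> wind D p z - wind D q z = - 1"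
proof -
  note F = interior_face[OF \<phi>]
  obtain x y where ne: "p \<noteq> []" "q \<noteq> []" and tr: "trail x p y" "trail x q y"
    and fr: "frontier \<phi> = img D (set p \<union> set q)" 
    and wn: "\<And>z z'. z \<in> \<phi> \<Longrightarrow> z \<notin> img D (set p \<union> set q) \<Longrightarrow> z' \<notin> closure \<phi> \<Longrightarrow>
      wind D p z - wind D q z = wind D p z' - wind D q z' - 1"
    using cw_boundaryD[OF cw] by metis
  have w: "awalk x p y" "awalk x q y" using tr by (auto simp: trail_def)
  have pq: "set p \<union> set q \<subseteq> arcs G" using w awalk_arcs by simp
  note c = walk_pair[OF w ne]
  obtain B where B: "\<And>z. B \<le> norm z \<Longrightarrow> winding_number (walk_curve D p +++ reversepath (walk_curve D q)) z = 0"
    using winding_number_zero_at_infinity[OF c(1,2)] by blast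
  obtain B' where B': "\<And>z. z \<in> closure \<phi> \<Longrightarrow> norm z < B'"
    using F(4) bounded_closure bounded_pos_less by metis
  \<comment> \<open>a point outside the closure of \<open>\<phi>\<close> and so far away that the boundary curve does not wind around it\<close>
  define z' where "z' = complex_of_real (max \<bar>B\<bar> \<bar>B'\<bar>)"
  have z': "B \<le> norm z'" "z' \<notin> closure \<phi>" using B'[of z'] by (auto simp: z'_def)
  moreover have "z' \<notin> img D (set p \<union> set q)" using z'(2) fr by (auto simp: frontier_def)
  ultimately have z'0: "wind D p z' - wind D q z' = 0" using B c(4) by metis
  have wn1: "wind D p z - wind D q z = - 1" if "z \<in> \<phi>" for z
    using wn[OF that _ z'(2)] F(5)[OF pq] that z'0 by auto
  obtain z where z: "z \<in> \<phi>" using F(1) by blast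
  then have "wind D p z \<noteq> wind D q z" using wn1[OF z] by auto
  from bigon_decomposition[OF w this]
  obtain p1 p2 p3 q1 q2 q3 u v where d: "p = p1 @ p2 @ p3" "q = q1 @ q2 @ q3" "awalk x p1 u" "awalk x q1 u"
    "bigon u p2 q2 v" "awalk v p3 y" "awalk v q3 y" "wind D p2 z \<noteq> wind D q2 z"
    by (elim exE conjE) (rule that)
  define C where "C = set p2 \<union> set q2"
  have rC: "ring C" using bigon_ring[OF d(5)] by (simp add: C_def)
  note J = ring_jordan[OF rC]
  have "z \<in> inside (img D C)"
    using bigon_wind_outside[OF d(5), of z] d(8) F(5)[OF J(14)] z J(9) unfolding C_def by blast
  then have sub: "\<phi> \<subseteq> inside (img D C)"
    using connected_in_ring[OF rC F(2) F(5)[OF J(14)]] z by blast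
  then have clo: "img D (set p \<union> set q) \<subseteq> inside (img D C) \<union> img D C"
    using closure_mono[OF sub] J(12) fr by (auto simp: frontier_def)
  note V = bigon_vert_walk[OF d(5), folded C_def]
  have xu: "x = u"
  proof (rule ccontr)
    assume "x \<noteq> u"
    then have lt: "rk x < rk u" using rk_eq_walk[OF d(3)] not_less by blast
    have xG: "x \<in> verts G" using w(1) by (simp add: awalk_def)
    have "x \<notin> tail G ` C \<union> head G ` C"
    proof
      assume "x \<in> tail G ` C \<union> head G ` C"
      then obtain r where "awalk u r x" using V(1) by blast
      from rk_walk[OF this] show False using lt by simp
    qed
    then have "vpt D x \<notin> img D C" using vpt_in_img[OF J(14) xG] by blast
    moreover have "vpt D x \<in> img D (set p \<union> set q)"
      using vpt_in_img[OF pq xG] tail_hd[OF w(1) ne(1)] hd_in_set[OF ne(1)] by blast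
    ultimately have i: "vpt D x \<in> inside (img D C)" using clo by blast
    obtain r where "awalk (src G) r x" using is_source_src xG unfolding is_source_def by blast
    from walk_into_ring[OF rC this ends_not_inside(1)[OF rC] i]
    obtain t r2 where t: "awalk t r2 x" "t \<in> tail G ` C \<union> head G ` C" by blast
    obtain r3 where "awalk u r3 t" using V(1)[OF t(2)] by blast
    then show False using rk_walk[OF t(1)] rk_walk[of u r3 t] lt by simp
  qed
  have yv: "y = v"
  proof (rule ccontr)
    assume "y \<noteq> v"
    then have lt: "rk v < rk y" using rk_eq_walk[OF d(6)] not_less by blast
    have yG: "y \<in> verts G" using w(1) awalk_last_in_verts by blast
    have "y \<notin> tail G ` C \<union> head G ` C"
    proof
      assume "y \<in> tail G ` C \<union> head G ` C"
      then obtain r where "awalk y r v" using V(2) by blast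
      from rk_walk[OF this] show False using lt by simp
    qed
    then have "vpt D y \<notin> img D C" using vpt_in_img[OF J(14) yG] by blast
    moreover have "vpt D y \<in> img D (set p \<union> set q)"
      using vpt_in_img[OF pq yG] head_last[OF w(1) ne(1)] last_in_set[OF ne(1)] by blast
    ultimately have i: "vpt D y \<in> inside (img D C)" using clo by blast
    obtain r where "awalk y r (tgt G)" using is_target_tgt yG unfolding is_target_def by blast
    from walk_out_of_ring[OF rC this i ends_not_inside(2)[OF rC]]
    obtain t r2 where t: "awalk y r2 t" "t \<in> tail G ` C \<union> head G ` C" by blast
    obtain r3 where "awalk t r3 v" using V(2)[OF t(2)] by blast
    then show False using rk_walk[OF t(1)] rk_walk[of t r3 v] lt by simp
  qed
  have "p1 = []" "q1 = []" "p3 = []" "q3 = []"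
    by (rule closed_walk_Nil, use d(3,4,6,7) xu yv in blast)+
  then have p2: "p2 = p" "q2 = q" by (simp_all add: d(1,2))
  then have big: "bigon x p q y" using d(5) by (simp only: xu yv)
  have CC: "C = set p \<union> set q" using p2 by (simp add: C_def)
  have "inside (img D C) \<inter> frontier \<phi> = {}" using fr J(9) CC by auto
  then have "inside (img D C) \<subseteq> \<phi>" using connected_Int_frontier[OF J(2), of \<phi>] sub F(1) by blast
  then show thesis using that[OF big] sub CC fr wn1 by blast
qed

text \<open>
  The arcs determine a bigon up to exchanging its sides, and the sign of the winding number tells the
  sides apart. So the definite description in \<open>face_dom\<close> and \<open>face_cod\<close> is legitimate.
\<close>

lemma cw_boundary_unique:
  assumes "\<phi> \<in> interior_faces D G" "cw_boundary D G \<phi> p q" "cw_boundary D G \<phi> p' q'"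
  shows "p' = p \<and> q' = q"
proof -
  obtain x y where b: "bigon x p q y" "frontier \<phi> = img D (set p \<union> set q)"
    "\<And>z. z \<in> \<phi> \<Longrightarrow> wind D p z - wind D q z = - 1"
    using interior_face_bigon[OF assms(1,2)] by metis
  obtain x' y' where b': "bigon x' p' q' y'" "frontier \<phi> = img D (set p' \<union> set q')"
    "\<And>z. z \<in> \<phi> \<Longrightarrow> wind D p' z - wind D q' z = - 1"
    using interior_face_bigon[OF assms(1,3)] by metis
  have "set p \<union> set q \<subseteq> arcs G" "set p' \<union> set q' \<subseteq> arcs G"
    using bigonD(3,4)[OF b(1)] bigonD(3,4)[OF b'(1)] awalk_arcs by auto
  then have "set p \<union> set q = set p' \<union> set q'" using img_eq_iff b(2) b'(2) by metis
  then have "p' = p \<and> q' = q \<or> p' = q \<and> q' = p" using bigon_unique[OF b(1) b'(1)] by blast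
  moreover have "\<not> (p' = q \<and> q' = p)"
  proof
    assume "p' = q \<and> q' = p"
    moreover obtain z where "z \<in> \<phi>" using interior_face(1)[OF assms(1)] by blast
    ultimately have "wind D p z - wind D q z = - 1" "wind D q z - wind D p z = - 1"
      using b(3)[of z] b'(3)[of z] by simp_all
    then have "(wind D p z - wind D q z) + (wind D q z - wind D p z) = - 2" by (simp only:) simp
    then show False by simp
  qed
  ultimately show ?thesis by blast
qed

abbreviation fdom where "fdom \<equiv> face_dom D G"
abbreviation fcod where "fcod \<equiv> face_cod D G"

lemma face_boundary:
  assumes "\<phi> \<in> interior_faces D G"
  shows "cw_boundary D G \<phi> (fdom \<phi>) (fcod \<phi>)"
proof -
  obtain p q where pq: "cw_boundary D G \<phi> p q"
    using globular_faces[OF assms] unfolding globular_face_def by blast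
  have "(THE (p, q). cw_boundary D G \<phi> p q) = (p, q)"
  proof (rule the_equality)
    show "case (p, q) of (p, q) \<Rightarrow> cw_boundary D G \<phi> p q" using pq by simp
  next
    fix r assume "case r of (p, q) \<Rightarrow> cw_boundary D G \<phi> p q"
    then have "cw_boundary D G \<phi> (fst r) (snd r)" by (simp add: case_prod_beta)
    from cw_boundary_unique[OF assms pq this] show "r = (p, q)" by (simp add: prod_eq_iff)
  qed
  then show ?thesis using pq interior_face(6)[OF assms] by (simp add: face_dom_def face_cod_def)
qed

lemma face_bigon:
  assumes "\<phi> \<in> interior_faces D G"
  shows "bigon (face_src D G \<phi>) (fdom \<phi>) (fcod \<phi>) (face_tgt D G \<phi>)"
    "\<phi> = inside (img D (set (fdom \<phi>) \<union> set (fcod \<phi>)))"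
    "frontier \<phi> = img D (set (fdom \<phi>) \<union> set (fcod \<phi>))"
    "z \<in> \<phi> \<Longrightarrow> wind D (fdom \<phi>) z - wind D (fcod \<phi>) z = - 1"
    "z \<notin> \<phi> \<Longrightarrow> z \<notin> support D G \<Longrightarrow> wind D (fdom \<phi>) z = wind D (fcod \<phi>) z"
proof -
  obtain x y where b: "bigon x (fdom \<phi>) (fcod \<phi>) y"
    "\<phi> = inside (img D (set (fdom \<phi>) \<union> set (fcod \<phi>)))"
    "frontier \<phi> = img D (set (fdom \<phi>) \<union> set (fcod \<phi>))"
    "\<And>z. z \<in> \<phi> \<Longrightarrow> wind D (fdom \<phi>) z - wind D (fcod \<phi>) z = - 1"
    using interior_face_bigon[OF assms face_boundary[OF assms]] by metis
  note d = bigonD[OF b(1)]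
  have "face_src D G \<phi> = x" "face_tgt D G \<phi> = y"
    using tail_hd[OF d(3,1)] head_last[OF d(3,1)] by (simp_all add: face_src_def face_tgt_def)
  then show "bigon (face_src D G \<phi>) (fdom \<phi>) (fcod \<phi>) (face_tgt D G \<phi>)"
    "\<phi> = inside (img D (set (fdom \<phi>) \<union> set (fcod \<phi>)))"
    "frontier \<phi> = img D (set (fdom \<phi>) \<union> set (fcod \<phi>))"
    "z \<in> \<phi> \<Longrightarrow> wind D (fdom \<phi>) z - wind D (fcod \<phi>) z = - 1" using b by simp_all
  note J = ring_jordan[OF bigon_ring[OF b(1)]]
  assume "z \<notin> \<phi>" "z \<notin> support D G"
  then have "z \<in> outside (img D (set (fdom \<phi>) \<union> set (fcod \<phi>)))"
    using J(9) img_support[OF J(14)] b(2) by blast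
  then show "wind D (fdom \<phi>) z = wind D (fcod \<phi>) z" by (rule bigon_wind_outside[OF b(1)])
qed

lemma face_determined_by_arcs:
  assumes "\<phi> \<in> interior_faces D G" "\<psi> \<in> interior_faces D G"
    "set (fdom \<phi>) \<union> set (fcod \<phi>) = set (fdom \<psi>) \<union> set (fcod \<psi>)"
  shows "\<phi> = \<psi>"
  using face_bigon(2)[OF assms(1)] face_bigon(2)[OF assms(2)] assms(3) by simp

end

section \<open>Chains of arcs and faces\<close>

text \<open>
  The pieces of a chain: a single arc or an interior face, which will be given as a region of the plane.
\<close>

datatype ('e, 'f) atom = Ed 'e | Fc 'f

text \<open>
  The vertex \<open>x\<close> is mentioned for the sake of the trivial graph, which has no arcs to recover it from.
\<close>

definition gr :: "('v, 'e) pre_digraph \<Rightarrow> 'v \<Rightarrow> 'e set \<Rightarrow> ('v, 'e) pre_digraph" where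
  "gr G x S = \<lparr>verts = insert x (tail G ` S \<union> head G ` S), arcs = S, tail = tail G, head = head G\<rparr>"

lemma gr_simps [simp]:
  "verts (gr G x S) = insert x (tail G ` S \<union> head G ` S)" "arcs (gr G x S) = S"
  "tail (gr G x S) = tail G" "head (gr G x S) = head G"
  by (simp_all add: gr_def)

context ranked_globular_digraph
begin

fun adom :: "('e, complex set) atom \<Rightarrow> 'e list" where
  "adom (Ed e) = [e]"
| "adom (Fc \<phi>) = fdom \<phi>"

fun acod :: "('e, complex set) atom \<Rightarrow> 'e list" where
  "acod (Ed e) = [e]"
| "acod (Fc \<phi>) = fcod \<phi>"

fun atom_in :: "('e, complex set) atom \<Rightarrow> bool" where
  "atom_in (Ed e) \<longleftrightarrow> e \<in> arcs G"
| "atom_in (Fc \<phi>) \<longleftrightarrow> \<phi> \<in> interior_faces D G"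

definition asrc where "asrc a = tail G (hd (adom a))"
definition atgt where "atgt a = head G (last (adom a))"
definition aarcs where "aarcs a = set (adom a) \<union> set (acod a)"

text \<open>
  The end vertices are part of the notion because an empty list of pieces does not determine them.
\<close>

fun word :: "'v \<Rightarrow> ('e, complex set) atom list \<Rightarrow> 'v \<Rightarrow> bool" where
  "word x [] y \<longleftrightarrow> x = y \<and> x \<in> verts G"
| "word x (a # w) y \<longleftrightarrow> atom_in a \<and> asrc a = x \<and> word (atgt a) w y"

definition wdom where "wdom w = concat (map adom w)"
definition wcod where "wcod w = concat (map acod w)"
definition warcs where "warcs w = (\<Union>a\<in>set w. aarcs a)"
definition wfaces where "wfaces w = {\<phi>. Fc \<phi> \<in> set w}"

lemma w_simps [simp]:
  "wdom [] = []" "wdom (a # w) = adom a @ wdom w" "wdom (v @ w) = wdom v @ wdom w"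
  "wcod [] = []" "wcod (a # w) = acod a @ wcod w" "wcod (v @ w) = wcod v @ wcod w"
  "warcs [] = {}" "warcs (a # w) = aarcs a \<union> warcs w" "warcs (v @ w) = warcs v \<union> warcs w"
  "wfaces [] = {}" "wfaces (Fc \<phi> # w) = insert \<phi> (wfaces w)" "wfaces (Ed e # w) = wfaces w"
  "wfaces (v @ w) = wfaces v \<union> wfaces w"
  by (auto simp: wdom_def wcod_def warcs_def wfaces_def)

lemma asrc_simps [simp]: "asrc (Ed e) = tail G e" "atgt (Ed e) = head G e"
  "asrc (Fc \<phi>) = face_src D G \<phi>" "atgt (Fc \<phi>) = face_tgt D G \<phi>"
  "aarcs (Ed e) = {e}" "aarcs (Fc \<phi>) = set (fdom \<phi>) \<union> set (fcod \<phi>)"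
  by (simp_all add: asrc_def atgt_def aarcs_def face_src_def face_tgt_def)

lemma atom_walks:
  assumes "atom_in a"
  shows "awalk (asrc a) (adom a) (atgt a)" "awalk (asrc a) (acod a) (atgt a)"
    "adom a \<noteq> []" "acod a \<noteq> []" "aarcs a \<subseteq> arcs G" "asrc a \<in> verts G" "atgt a \<in> verts G"
    "rk (asrc a) < rk (atgt a)" "aarcs a \<noteq> {}"
proof -
  show w: "awalk (asrc a) (adom a) (atgt a)" "awalk (asrc a) (acod a) (atgt a)"
    and ne: "adom a \<noteq> []" "acod a \<noteq> []"
    using assms by (cases a; auto simp: arc_implies_awalk bigonD[OF face_bigon(1)])+
  then show "aarcs a \<subseteq> arcs G" "asrc a \<in> verts G" "atgt a \<in> verts G" "aarcs a \<noteq> {}"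
    by (auto simp: aarcs_def awalk_def intro: awalk_last_in_verts[OF w(1)])
  show "rk (asrc a) < rk (atgt a)" using rk_walk[OF w(1)] ne by (cases "adom a") auto
qed

lemma atom_tail_rank:
  assumes "atom_in a" "e \<in> aarcs a"
  shows "rk (asrc a) \<le> rk (tail G e)" "rk (head G e) \<le> rk (atgt a)" "rk (tail G e) < rk (atgt a)"
    "rk (asrc a) < rk (head G e)"
  using walk_tail_rank[OF atom_walks(1)[OF assms(1)], of e]
    walk_tail_rank[OF atom_walks(2)[OF assms(1)], of e] assms(2) by (auto simp: aarcs_def)

lemma word_walks:
  "word x w y \<Longrightarrow> awalk x (wdom w) y" "word x w y \<Longrightarrow> awalk x (wcod w) y"
proof (induction w arbitrary: x)
  case (Cons a w)
  { case 1 with Cons.IH(1)[of "atgt a"] atom_walks(1)[of a] show ?case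
      by (auto simp del: awalk_append_iff intro: awalk_appendI)
  next
    case 2 with Cons.IH(2)[of "atgt a"] atom_walks(2)[of a] show ?case
      by (auto simp del: awalk_append_iff intro: awalk_appendI) }
qed (auto simp: awalk_Nil_iff)

lemma word_ends: assumes "word x w y" shows "x \<in> verts G" "y \<in> verts G" "rk x \<le> rk y"
  using word_walks(1)[OF assms] awalk_last_in_verts rk_walk[of x "wdom w" y] by (auto simp: awalk_def)

lemma word_arcs: "word x w y \<Longrightarrow> warcs w \<subseteq> arcs G"
  by (induction w arbitrary: x) (use atom_walks(5) in auto)

lemma word_faces: "word x w y \<Longrightarrow> wfaces w \<subseteq> interior_faces D G"
proof (induction w arbitrary: x)
  case (Cons a w) then show ?case by (cases a) auto
qed simp

lemma word_append: "word x v y \<Longrightarrow> word y w z \<Longrightarrow> word x (v @ w) z"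
  by (induction v arbitrary: x) auto

lemma word_of_walk: "awalk x p y \<Longrightarrow> word x (map Ed p) y"
  by (induction p arbitrary: x) (auto simp: awalk_Cons_iff awalk_Nil_iff)

lemma w_map_Ed [simp]: "wdom (map Ed p) = p" "wcod (map Ed p) = p" "warcs (map Ed p) = set p"
  "wfaces (map Ed p) = {}"
  by (induction p) (auto simp: wfaces_def)

lemma word_tail_rank:
  assumes "word x w y" "e \<in> warcs w"
  shows "rk x \<le> rk (tail G e)" "rk (head G e) \<le> rk y" "rk (tail G e) < rk y"
proof -
  have "rk x \<le> rk (tail G e) \<and> rk (head G e) \<le> rk y \<and> rk (tail G e) < rk y"
    using assms
  proof (induction w arbitrary: x)
    case (Cons a w)
    then have a: "atom_in a" "asrc a = x" and w: "word (atgt a) w y" by auto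
    note r = word_ends(3)[OF w] atom_walks(8)[OF a(1)]
    show ?case
    proof (cases "e \<in> aarcs a")
      case True
      then show ?thesis using atom_tail_rank[OF a(1) True] r a by simp
    next
      case False
      then have "e \<in> warcs w" using Cons.prems(2) by simp
      then show ?thesis using Cons.IH[OF w] r a by simp
    qed
  qed simp
  then show "rk x \<le> rk (tail G e)" "rk (head G e) \<le> rk y" "rk (tail G e) < rk y" by simp_all
qed

lemma word_face_rank:
  assumes "word x w y" "\<phi> \<in> wfaces w"
  shows "rk x \<le> rk (face_src D G \<phi>)" "rk (face_tgt D G \<phi>) \<le> rk y"
proof -
  have "rk x \<le> rk (face_src D G \<phi>) \<and> rk (face_tgt D G \<phi>) \<le> rk y"
    using assms
  proof (induction w arbitrary: x)
    case (Cons a w)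
    then have a: "atom_in a" "asrc a = x" and w: "word (atgt a) w y" by auto
    note r = word_ends(3)[OF w] atom_walks(8)[OF a(1)]
    show ?case
    proof (cases "a = Fc \<phi>")
      case True
      then show ?thesis using r a by auto
    next
      case False
      then have "\<phi> \<in> wfaces w" using Cons.prems(2) by (auto simp: wfaces_def)
      then show ?thesis using Cons.IH[OF w] r a by simp
    qed
  qed simp
  then show "rk x \<le> rk (face_src D G \<phi>)" "rk (face_tgt D G \<phi>) \<le> rk y" by simp_all
qed

lemma atom_vert_walks:
  assumes "atom_in a" "v \<in> tail G ` aarcs a \<union> head G ` aarcs a"
  shows "\<exists>p. awalk (asrc a) p v \<and> set p \<subseteq> aarcs a" "\<exists>p. awalk v p (atgt a) \<and> set p \<subseteq> aarcs a"
proof -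
  note w = atom_walks[OF assms(1)]
  have "v \<in> set (awalk_verts (asrc a) (adom a)) \<or> v \<in> set (awalk_verts (asrc a) (acod a))"
    using assms(2) unfolding set_awalk_verts_not_Nil[OF w(1,3)] set_awalk_verts_not_Nil[OF w(2,4)]
    by (auto simp: aarcs_def)
  then obtain d where d: "awalk (asrc a) d (atgt a)" "set d \<subseteq> aarcs a" "v \<in> set (awalk_verts (asrc a) d)"
    using w(1,2) by (metis Un_upper1 Un_upper2 aarcs_def)
  obtain q r where qr: "d = q @ r" "awalk (asrc a) q v" "awalk v r (atgt a)"
    using awalk_decomp[OF d(1,3)] by metis
  have "set q \<subseteq> aarcs a" "set r \<subseteq> aarcs a" using d(2) by (simp_all add: qr(1))
  then show "\<exists>p. awalk (asrc a) p v \<and> set p \<subseteq> aarcs a" "\<exists>p. awalk v p (atgt a) \<and> set p \<subseteq> aarcs a"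
    using qr(2,3) by blast+
qed

lemma word_vert_walks:
  assumes "word x w y" "v \<in> insert x (tail G ` warcs w \<union> head G ` warcs w)"
  shows "(\<exists>p. awalk x p v \<and> set p \<subseteq> warcs w) \<and> (\<exists>p. awalk v p y \<and> set p \<subseteq> warcs w)"
  using assms
proof (induction w arbitrary: x v)
  case Nil
  then show ?case by (auto simp: awalk_Nil_iff)
next
  case (Cons a w)
  then have a: "atom_in a" "asrc a = x" and w: "word (atgt a) w y" by auto
  have c1: "\<exists>p. awalk x p u \<and> set p \<subseteq> warcs (a # w)"
    if u: "awalk (atgt a) r u" "set r \<subseteq> warcs w" for r u
    using awalk_appendI[OF atom_walks(1)[OF a(1)] u(1)] a u(2)
    by (intro exI[of _ "adom a @ r"]) (auto simp: aarcs_def simp del: awalk_append_iff)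
  have c2: "\<exists>p. awalk u p y \<and> set p \<subseteq> warcs (a # w)"
    if u: "awalk u r (atgt a)" "set r \<subseteq> aarcs a" for r u
  proof -
    obtain r' where "awalk (atgt a) r' y" "set r' \<subseteq> warcs w" using Cons.IH[OF w, of "atgt a"] by blast
    then show ?thesis using awalk_appendI[OF u(1)] u(2)
      by (intro exI[of _ "r @ r'"]) (auto simp del: awalk_append_iff)
  qed
  consider "v = x" | "v \<in> tail G ` aarcs a \<union> head G ` aarcs a" | "v \<in> tail G ` warcs w \<union> head G ` warcs w"
    using Cons.prems(2) by auto
  then show ?case
  proof cases
    case 1
    then show ?thesis
      using c2[of x "adom a"] atom_walks(1,6)[OF a(1)] a(2)
      by (auto simp: aarcs_def awalk_Nil_iff intro!: exI[of _ "[]"])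
  next
    case 2
    obtain p q where pq: "awalk x p v" "set p \<subseteq> aarcs a" "awalk v q (atgt a)" "set q \<subseteq> aarcs a"
      using atom_vert_walks[OF a(1) 2] a(2) by blast
    then have "set p \<subseteq> warcs (a # w)" by auto
    then show ?thesis using c2[OF pq(3,4)] pq(1) by blast
  next
    case 3
    obtain p q where pq: "awalk (atgt a) p v" "set p \<subseteq> warcs w" "awalk v q y" "set q \<subseteq> warcs w"
      using Cons.IH[OF w, of v] 3 by blast
    then have "set q \<subseteq> warcs (a # w)" by auto
    then show ?thesis using c1[OF pq(1,2)] pq(3) by blast
  qed
qed

text \<open>
  The local shape of a chain: where a vertex has several outgoing arcs, these are the first arcs of
  the two sides of a face in \<open>\<Psi>\<close>, and inside the sides there is no way out. This property is
  inherited by subgraphs.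
\<close>

definition thin :: "complex set set \<Rightarrow> 'e set \<Rightarrow> bool" where
  "thin \<Psi> S \<longleftrightarrow> (\<forall>e\<in>S. \<forall>f\<in>S. tail G e = tail G f \<longrightarrow> e \<noteq> f \<longrightarrow>
     (\<exists>\<phi>\<in>\<Psi>. {e, f} = {hd (fdom \<phi>), hd (fcod \<phi>)} \<and> (\<forall>g\<in>S. tail G g = tail G e \<longrightarrow> g \<in> {e, f}) \<and>
        forced S (fdom \<phi>) \<and> forced S (fcod \<phi>)))"

lemma thin_mono: "thin \<Psi> T \<Longrightarrow> S \<subseteq> T \<Longrightarrow> thin \<Psi> S"
  unfolding thin_def by (meson forced_mono subsetD)

lemma forced_Un:
  assumes "forced A d" "awalk x d y" "\<And>f. f \<in> B \<Longrightarrow> rk (tail G f) \<le> rk x \<or> rk y \<le> rk (tail G f)"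
  shows "forced (A \<union> B) d"
  unfolding forced_def
proof (intro allI impI ballI)
  fix d1 a b d2 f
  assume d: "d = d1 @ a # b # d2" and f: "f \<in> A \<union> B" "tail G f = head G a"
  then have "f \<notin> B" using inner_vertex(3,4)[OF assms(2) d] assms(3)[of f] by auto
  then show "f = b" using assms(1) d f unfolding forced_def by blast
qed

lemma atom_forced:
  assumes "atom_in a" shows "forced (aarcs a) (adom a)" "forced (aarcs a) (acod a)"
proof -
  have "forced (aarcs a) (adom a) \<and> forced (aarcs a) (acod a)"
  proof (cases a)
    case (Ed e)
    then show ?thesis by (auto simp: forced_def Cons_eq_append_conv)
  next
    case (Fc \<phi>)
    then have b: "bigon (face_src D G \<phi>) (fdom \<phi>) (fcod \<phi>) (face_tgt D G \<phi>)"
      using assms by (simp add: face_bigon)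
    show ?thesis using bigon_forced[OF b] bigon_forced[OF bigon_sym[OF b]] Fc by (simp add: Un_commute)
  qed
  then show "forced (aarcs a) (adom a)" "forced (aarcs a) (acod a)" by simp_all
qed

lemma atom_out:
  assumes "atom_in a" "e \<in> aarcs a" "tail G e = asrc a"
  shows "e = hd (adom a) \<or> e = hd (acod a)"
  using assms by (cases a) (auto dest: bigon_src[OF face_bigon(1)])

lemma atom_branch:
  assumes "atom_in a" "e \<in> aarcs a" "f \<in> aarcs a" "tail G e = tail G f" "e \<noteq> f"
  obtains \<phi> where "a = Fc \<phi>" "{e, f} = {hd (fdom \<phi>), hd (fcod \<phi>)}" "tail G e = asrc a"
proof (cases a)
  case (Ed g)
  then show thesis using assms by simp
next
  case (Fc \<phi>)
  then have b: "bigon (face_src D G \<phi>) (fdom \<phi>) (fcod \<phi>) (face_tgt D G \<phi>)"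
    using assms by (simp add: face_bigon)
  note d = bigonD[OF b]
  have "\<not> (e \<in> set (fdom \<phi>) \<and> f \<in> set (fdom \<phi>))" "\<not> (e \<in> set (fcod \<phi>) \<and> f \<in> set (fcod \<phi>))"
    using walk_tail_inj[OF d(3), of e f] walk_tail_inj[OF d(4), of e f] assms(4,5) by auto
  moreover have ef: "e \<in> set (fdom \<phi>) \<union> set (fcod \<phi>)" "f \<in> set (fdom \<phi>) \<union> set (fcod \<phi>)"
    using assms(2,3) Fc by auto
  ultimately have "tail G e \<in> set (awalk_verts (face_src D G \<phi>) (fdom \<phi>)) \<inter> set (awalk_verts (face_src D G \<phi>) (fcod \<phi>))"
    using assms(4) by (auto simp: set_awalk_verts_not_Nil[OF d(3,1)] set_awalk_verts_not_Nil[OF d(4,2)])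
      (metis image_eqI)+
  moreover have "tail G e \<noteq> face_tgt D G \<phi>" using atom_tail_rank(3)[OF assms(1,2)] Fc by auto
  ultimately have te: "tail G e = asrc a" using d(9) Fc by auto
  have "e = hd (fdom \<phi>) \<or> e = hd (fcod \<phi>)" "f = hd (fdom \<phi>) \<or> f = hd (fcod \<phi>)"
    using atom_out[OF assms(1,2) te] atom_out[OF assms(1,3)] te assms(4) Fc by auto
  then have "{e, f} = {hd (fdom \<phi>), hd (fcod \<phi>)}" using assms(5) by auto
  then show thesis using that Fc te by blast
qed

text \<open>
  Arcs of the first piece start at vertices of smaller rank than arcs of the later pieces, so branchings
  happen within one piece.
\<close>

lemma word_thin: "word x w y \<Longrightarrow> thin (wfaces w) (warcs w)"
proof (induction w arbitrary: x)
  case Nil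
  then show ?case by (simp add: thin_def)
next
  case (Cons a w)
  then have a: "atom_in a" "asrc a = x" and w: "word (atgt a) w y" by auto
  have rA: "rk (tail G e) < rk (atgt a)" if "e \<in> aarcs a" for e by (rule atom_tail_rank(3)[OF a(1) that])
  have rW: "rk (atgt a) \<le> rk (tail G e)" if "e \<in> warcs w" for e by (rule word_tail_rank(1)[OF w that])
  show ?case
    unfolding thin_def
  proof (intro ballI impI)
    fix e f assume ef: "e \<in> warcs (a # w)" "f \<in> warcs (a # w)" "tail G e = tail G f" "e \<noteq> f"
    show "\<exists>\<phi>\<in>wfaces (a # w). {e, f} = {hd (fdom \<phi>), hd (fcod \<phi>)} \<and>
      (\<forall>g\<in>warcs (a # w). tail G g = tail G e \<longrightarrow> g \<in> {e, f}) \<and>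
      forced (warcs (a # w)) (fdom \<phi>) \<and> forced (warcs (a # w)) (fcod \<phi>)"
    proof (cases "e \<in> aarcs a")
      case True
      then have "f \<notin> warcs w" using rA[OF True] rW[of f] ef(3) by auto
      then have f: "f \<in> aarcs a" using ef(2) by simp
      obtain \<phi> where \<phi>: "a = Fc \<phi>" "{e, f} = {hd (fdom \<phi>), hd (fcod \<phi>)}" "tail G e = asrc a"
        by (rule atom_branch[OF a(1) True f ef(3,4)])
      have "g \<in> {e, f}" if g: "g \<in> warcs (a # w)" "tail G g = tail G e" for g
      proof -
        have "g \<notin> warcs w" using rA[OF True] rW[of g] g(2) by auto
        then have "g \<in> aarcs a" using g(1) by simp
        then show ?thesis using atom_out[OF a(1), of g] g(2) \<phi> by auto
      qed
      moreover have "forced (warcs (a # w)) (fdom \<phi>)" "forced (warcs (a # w)) (fcod \<phi>)"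
        using forced_Un[OF atom_forced(1)[OF a(1)] atom_walks(1)[OF a(1)], of "warcs w"]
          forced_Un[OF atom_forced(2)[OF a(1)] atom_walks(2)[OF a(1)], of "warcs w"] rW \<phi>(1) by auto
      ultimately show ?thesis using \<phi> by (intro bexI[of _ \<phi>]) auto
    next
      case False
      then have e: "e \<in> warcs w" using ef(1) by simp
      then have "f \<notin> aarcs a" using rA[of f] rW[OF e] ef(3) by auto
      then have f: "f \<in> warcs w" using ef(2) by simp
      obtain \<phi> where \<phi>: "\<phi> \<in> wfaces w" "{e, f} = {hd (fdom \<phi>), hd (fcod \<phi>)}"
        "\<forall>g\<in>warcs w. tail G g = tail G e \<longrightarrow> g \<in> {e, f}" "forced (warcs w) (fdom \<phi>)" "forced (warcs w) (fcod \<phi>)"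
        using Cons.IH[OF w] e f ef(3,4) unfolding thin_def by blast
      have i: "\<phi> \<in> interior_faces D G" using word_faces[OF w] \<phi>(1) by blast
      note d = bigonD[OF face_bigon(1)[OF i]]
      have "\<forall>g\<in>warcs (a # w). tail G g = tail G e \<longrightarrow> g \<in> {e, f}"
        using \<phi>(3) rA rW[OF e] by fastforce
      moreover have "rk (tail G g) \<le> rk (face_src D G \<phi>)" if "g \<in> aarcs a" for g
        using rA[OF that] word_face_rank(1)[OF w \<phi>(1)] by simp
      then have "forced (warcs (a # w)) (fdom \<phi>)" "forced (warcs (a # w)) (fcod \<phi>)"
        using forced_Un[OF \<phi>(4) d(3), of "aarcs a"] forced_Un[OF \<phi>(5) d(4), of "aarcs a"]
        by (auto simp: Un_commute)
      moreover have "\<phi> \<in> wfaces (a # w)" using \<phi>(1) by (auto simp: wfaces_def)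
      ultimately show ?thesis using \<phi>(2) by blast
    qed
  qed
qed

section \<open>Recognising chains by their arcs\<close>

lemma awalk_suffix:
  assumes "awalk x (d @ r) v" "awalk x d t" shows "awalk t r v"
proof -
  have "awlast x d = t" using assms(2) awlast_if_cas[of x d t] by (simp add: awalk_def)
  then show ?thesis using assms(1) awalk_append_iff[of x d r v] by simp
qed

text \<open>
  Where \<open>p\<close> leaves \<open>x\<close> it enters one side of \<open>a\<close>, and this side is forced. The hypothesis on \<open>v\<close> excludes
  that \<open>p\<close> ends at an inner vertex of the side.
\<close>

lemma peel_atom:
  assumes a: "atom_in a" "asrc a = x" and S: "aarcs a \<subseteq> S"
    and out: "\<forall>g\<in>S. tail G g = x \<longrightarrow> g = hd (adom a) \<or> g = hd (acod a)"
    and forced: "forced S (adom a)" "forced S (acod a)"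
    and p: "awalk x p v" "set p \<subseteq> S"
    and v: "rk (atgt a) \<le> rk v \<or> (\<exists>f\<in>S - aarcs a. tail G f = v)"
  shows "\<exists>d p'. p = d @ p' \<and> (d = adom a \<or> d = acod a) \<and> awalk (atgt a) p' v \<and> set p' \<subseteq> S - aarcs a"
proof -
  note w = atom_walks[OF a(1)]
  have hdA: "hd (adom a) \<in> aarcs a" "hd (acod a) \<in> aarcs a" using w(3,4) by (simp_all add: aarcs_def)
  have ne: "p \<noteq> []"
  proof
    assume "p = []"
    then have "v = x" using p(1) by (simp add: awalk_Nil_iff)
    then show False using v w(8) a(2) out hdA by auto
  qed
  have "hd p \<in> S" "tail G (hd p) = x" using ne p tail_hd[OF p(1) ne] hd_in_set[OF ne] by auto
  then obtain d where d: "d = adom a \<or> d = acod a" "hd p = hd d" using out by metis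
  then have dw: "awalk x d (atgt a)" "d \<noteq> []" "forced S d" "set d \<subseteq> aarcs a"
    using w(1-4) a(2) forced by (auto simp: aarcs_def)
  obtain r where r: "p = d @ r \<or> d = p @ r"
    using forced_walk[OF dw(3,1) p ne dw(2) d(2)] by blast
  have "\<exists>r. p = d @ r"
  proof (rule ccontr)
    assume n: "\<not> ?thesis"
    then have dr: "d = p @ r" "r \<noteq> []" using r by auto
    obtain b r' where r': "r = b # r'" using dr(2) by (cases r) auto
    obtain p1 a' where p1: "p = p1 @ [a']" using ne by (metis rev_exhaust)
    have dd: "d = p1 @ a' # b # r'" using dr(1) r' p1 by simp
    have va: "v = head G a'" using head_last[OF p(1) ne] p1 by simp
    then have "rk v < rk (atgt a)" using inner_vertex(4)[OF dw(1) dd] by simp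
    then obtain f where f: "f \<in> S" "f \<notin> aarcs a" "tail G f = v" using v by auto
    then have "f = b" using dw(3) dd va unfolding forced_def by blast
    moreover have "b \<in> set d" by (simp add: dd)
    ultimately show False using f(2) dw(4) by auto
  qed
  then obtain r where pr: "p = d @ r" by blast
  have rw: "awalk (atgt a) r v" using awalk_suffix[of x d r v] p(1) dw(1) pr by simp
  have "e \<notin> aarcs a" if "e \<in> set r" for e
    using walk_tail_rank(1)[OF rw that] atom_tail_rank(3)[OF a(1), of e] by auto
  then have "set r \<subseteq> S - aarcs a" using p(2) pr by auto
  then show ?thesis using pr d(1) rw by blast
qed

text \<open>
  From the first arc of \<open>d\<close> a walk in \<open>S\<close> leads to \<open>y\<close>. It follows \<open>d\<close>, so either it contains \<open>d\<close> or it
  stops at a vertex of \<open>d\<close>, which is then \<open>y\<close>.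
\<close>

lemma forced_side:
  assumes "S \<subseteq> arcs G" and conn: "\<forall>e\<in>S. \<exists>q. awalk (head G e) q y \<and> set q \<subseteq> S"
    and d: "awalk x d t" "d \<noteq> []" "forced S d" "hd d \<in> S"
  shows "set d \<subseteq> S \<and> rk t \<le> rk y \<or>
    y \<in> set (awalk_verts x d) \<and> y \<noteq> x \<and> (rk t \<le> rk y \<longrightarrow> set d \<subseteq> S)"
proof -
  have th: "tail G (hd d) = x" by (rule tail_hd[OF d(1,2)])
  obtain q where q: "awalk (head G (hd d)) q y" "set q \<subseteq> S" using conn d(4) by blast
  then have q': "awalk x (hd d # q) y" "set (hd d # q) \<subseteq> S" using d(4) th assms(1) by (auto simp: awalk_Cons_iff)
  obtain r where "hd d # q = d @ r \<or> d = (hd d # q) @ r"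
    using forced_walk[OF d(3,1) q' _ d(2)] by auto
  then show ?thesis
  proof
    assume *: "hd d # q = d @ r"
    then have "awalk x (d @ r) y" using q'(1) by simp
    then have rw: "awalk (t) r y" using d(1) by (rule awalk_suffix)
    have "rk (t) \<le> rk y" using rk_walk[OF rw] by simp
    moreover have "set (d @ r) \<subseteq> S" using q'(2) * by simp
    ultimately show ?thesis by simp
  next
    assume *: "d = (hd d # q) @ r"
    have "awalk x ((hd d # q) @ r) (t)" using d(1) * by simp
    then have r: "awalk y r (t)" using q'(1) by (rule awalk_suffix)
    have "set (awalk_verts x ((hd d # q) @ r)) = set (awalk_verts x (hd d # q)) \<union> set (awalk_verts y r)"
      using q'(1) r by (rule set_awalk_verts_append)
    then have "y \<in> set (awalk_verts x ((hd d # q) @ r))"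
    using last_in_awalk_verts[OF q'(1)] by (simp only: Un_iff simp_thms)
  then have "y \<in> set (awalk_verts x d)" by (simp only: *[symmetric])
    moreover have "y \<noteq> x" using rk_walk[OF q'(1)] by auto
    moreover have "set d \<subseteq> S" if "rk (t) \<le> rk y"
    proof -
      have "r = []" using rk_eq_walk[OF r that] by simp
      then have "set d = set (hd d # q)" using * by (metis append_Nil2)
      then show ?thesis using q'(2) by (simp only:)
    qed
    ultimately show ?thesis by blast
  qed
qed

text \<open>
  If \<open>x\<close> has two outgoing arcs in \<open>S\<close>, they start the two sides of a face of \<open>\<Psi>\<close>. If a side were not
  contained in \<open>S\<close>, by \<open>forced_side\<close> the vertex \<open>y\<close> would be an inner vertex of it; as the other side
  leads to \<open>y\<close> or passes through it, too, this is impossible.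
\<close>

lemma first_atom:
  assumes thin: "thin \<Psi> S" and \<Psi>: "\<Psi> \<subseteq> interior_faces D G" and SG: "S \<subseteq> arcs G"
    and e: "e \<in> S" "tail G e = x"
    and conn: "\<forall>e\<in>S. \<exists>q. awalk (head G e) q y \<and> set q \<subseteq> S"
  shows "\<exists>a. atom_in a \<and> asrc a = x \<and> aarcs a \<subseteq> S \<and> wfaces [a] \<subseteq> \<Psi> \<and>
      (\<forall>g\<in>S. tail G g = x \<longrightarrow> g = hd (adom a) \<or> g = hd (acod a)) \<and>
      forced S (adom a) \<and> forced S (acod a) \<and> rk (atgt a) \<le> rk y"
proof (cases "\<forall>g\<in>S. tail G g = x \<longrightarrow> g = e")
  case True
  obtain q where q: "awalk (head G e) q y" using conn e(1) by blast
  have "rk (head G e) \<le> rk y" using rk_walk[OF q] by simp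
  have "atom_in (Ed e)" using e(1) SG by auto
  moreover have "\<forall>g\<in>S. tail G g = x \<longrightarrow> g = hd (adom (Ed e)) \<or> g = hd (acod (Ed e))"
    using True by simp
  moreover have "forced S (adom (Ed e))" "forced S (acod (Ed e))"
    by (simp_all add: forced_def Cons_eq_append_conv)
  moreover have "aarcs (Ed e) \<subseteq> S" "asrc (Ed e) = x" "wfaces [Ed e] \<subseteq> \<Psi>" "rk (atgt (Ed e)) \<le> rk y"
    using e \<open>rk (head G e) \<le> rk y\<close> by simp_all
  ultimately show ?thesis by blast
next
  case False
  then obtain f where f: "f \<in> S" "tail G f = tail G e" "f \<noteq> e" using e by auto
  obtain \<phi> where \<phi>: "\<phi> \<in> \<Psi>" "{e, f} = {hd (fdom \<phi>), hd (fcod \<phi>)}"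
    "\<forall>g\<in>S. tail G g = tail G e \<longrightarrow> g \<in> {e, f}" "forced S (fdom \<phi>)" "forced S (fcod \<phi>)"
    using thin[unfolded thin_def, rule_format, OF e(1) f(1) f(2)[symmetric] f(3)[symmetric]] by blast
  have i: "\<phi> \<in> interior_faces D G" using \<phi>(1) \<Psi> by blast
  note b = bigonD[OF face_bigon(1)[OF i]]
  have hds: "hd (fdom \<phi>) \<in> S" "hd (fcod \<phi>) \<in> S" "tail G (hd (fdom \<phi>)) = x" "tail G (hd (fcod \<phi>)) = x"
    using \<phi>(2) e f by (auto simp: doubleton_eq_iff)
  have src: "face_src D G \<phi> = x" using tail_hd[OF b(3,1)] hds(3) by simp
  have d1: "awalk x (fdom \<phi>) (face_tgt D G \<phi>)" and d2: "awalk x (fcod \<phi>) (face_tgt D G \<phi>)"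
    using b(3,4) src by simp_all
  have s1: "set (fdom \<phi>) \<subseteq> S \<and> rk (face_tgt D G \<phi>) \<le> rk y \<or>
      y \<in> set (awalk_verts x (fdom \<phi>)) \<and> y \<noteq> x \<and> (rk (face_tgt D G \<phi>) \<le> rk y \<longrightarrow> set (fdom \<phi>) \<subseteq> S)"
    using forced_side[OF SG conn d1 b(1) \<phi>(4) hds(1)] .
  have s2: "set (fcod \<phi>) \<subseteq> S \<and> rk (face_tgt D G \<phi>) \<le> rk y \<or>
      y \<in> set (awalk_verts x (fcod \<phi>)) \<and> y \<noteq> x \<and> (rk (face_tgt D G \<phi>) \<le> rk y \<longrightarrow> set (fcod \<phi>) \<subseteq> S)"
    using forced_side[OF SG conn d2 b(2) \<phi>(5) hds(2)] .
  have "y \<in> set (awalk_verts x (fdom \<phi>)) \<Longrightarrow> y \<in> set (awalk_verts x (fcod \<phi>)) \<Longrightarrow> y \<noteq> x \<Longrightarrow> y = face_tgt D G \<phi>"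
    using b(9) src by blast
  then have r: "rk (face_tgt D G \<phi>) \<le> rk y" using s1 s2 by auto
  then have "set (fdom \<phi>) \<union> set (fcod \<phi>) \<subseteq> S" using s1 s2 by auto
  moreover have "g = hd (fdom \<phi>) \<or> g = hd (fcod \<phi>)" if "g \<in> S" "tail G g = x" for g
  proof -
    have "g \<in> {e, f}" using \<phi>(3) that e(2) by simp
    then show ?thesis unfolding \<phi>(2) by simp
  qed
  ultimately show ?thesis using r i src \<phi>(1,4,5) by (intro exI[of _ "Fc \<phi>"]) simp
qed

text \<open>
  A thin arc set, all of whose arcs lie on walks from \<open>x\<close> to \<open>y\<close>, is a chain: peel off the face or
  the single arc that starts at \<open>x\<close>.
\<close>

lemma word_of_thin:
  assumes "thin \<Psi> S" "\<Psi> \<subseteq> interior_faces D G" "S \<subseteq> arcs G" "awalk x p y" "set p \<subseteq> S"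
    and "\<And>e. e \<in> S \<Longrightarrow> (\<exists>p. awalk x p (tail G e) \<and> set p \<subseteq> S) \<and> (\<exists>p. awalk (head G e) p y \<and> set p \<subseteq> S)"
  shows "\<exists>w. word x w y \<and> warcs w = S \<and> wfaces w \<subseteq> \<Psi>"
  using assms(1,3-)
proof (induction "card S" arbitrary: S x p rule: less_induct)
  case less
  note thin = less.prems(1) and SG = less.prems(2) and p = less.prems(3,4) and conn = less.prems(5)
  have finS: "finite S" using finite_subset[OF SG] by simp
  show ?case
  proof (cases "S = {}")
    case True
    then have "p = []" using p(2) by simp
    then show ?thesis using p(1) True by (intro exI[of _ "[]"]) (auto simp: awalk_Nil_iff)
  next
    case False
    then obtain e0 p0 where e0: "e0 \<in> S" "awalk x p0 (tail G e0)" "set p0 \<subseteq> S" using conn by blast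
    obtain e where e: "e \<in> S" "tail G e = x"
    proof (cases p0)
      case Nil
      then show ?thesis using e0 that by (auto simp: awalk_Nil_iff)
    next
      case (Cons g p1)
      then show ?thesis using e0 that[of g] by (auto simp: awalk_Cons_iff)
    qed
    have conn': "\<forall>e\<in>S. \<exists>q. awalk (head G e) q y \<and> set q \<subseteq> S" using conn by blast
    obtain a where a: "atom_in a" "asrc a = x" "aarcs a \<subseteq> S" "wfaces [a] \<subseteq> \<Psi>"
      "\<forall>g\<in>S. tail G g = x \<longrightarrow> g = hd (adom a) \<or> g = hd (acod a)"
      "forced S (adom a)" "forced S (acod a)" "rk (atgt a) \<le> rk y"
      using first_atom[OF thin assms(2) SG e conn'] by blast
    note peel = peel_atom[OF a(1,2,3,5,6,7)]
    define S' where "S' = S - aarcs a"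
    have "card S' < card S" using finS a(3) atom_walks(9)[OF a(1)] unfolding S'_def
      by (intro psubset_card_mono) auto
    moreover have "thin \<Psi> S'" using thin_mono[OF thin] by (auto simp: S'_def)
    moreover have "S' \<subseteq> arcs G" using SG by (auto simp: S'_def)
    moreover obtain d p' where "awalk (atgt a) p' y" "set p' \<subseteq> S'"
      using peel[OF p disjI1[OF a(8)]] unfolding S'_def by blast
    moreover have "(\<exists>p. awalk (atgt a) p (tail G f) \<and> set p \<subseteq> S') \<and> (\<exists>p. awalk (head G f) p y \<and> set p \<subseteq> S')"
      if f: "f \<in> S'" for f
    proof -
      have fS: "f \<in> S" "f \<in> S - aarcs a" using f by (auto simp: S'_def)
      obtain q where q: "awalk x q (tail G f)" "set q \<subseteq> S" using conn[OF fS(1)] by blast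
      obtain q' where q': "awalk (atgt a) q' (tail G f)" "set q' \<subseteq> S'"
        using peel[OF q disjI2[OF bexI[OF refl fS(2)]]] unfolding S'_def by blast
      obtain t where t: "awalk (head G f) t y" "set t \<subseteq> S" using conn[OF fS(1)] by blast
      have "g \<notin> aarcs a" if "g \<in> set t" for g
        using walk_tail_rank(1)[OF t(1) that] rk_walk[OF q'(1)] rk[of f] SG fS(1)
          atom_tail_rank(3)[OF a(1), of g] by fastforce
      then have "set t \<subseteq> S'" using t(2) by (auto simp: S'_def)
      then show ?thesis using q' t(1) by blast
    qed
    ultimately obtain w where w: "word (atgt a) w y" "warcs w = S'" "wfaces w \<subseteq> \<Psi>"
      using less.hyps[of S' "atgt a" p'] by blast
    have "wfaces (a # w) \<subseteq> \<Psi>" using a(4) w(3) by (auto simp: wfaces_def)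
    moreover have "warcs (a # w) = S" using w(2) a(3) by (auto simp: S'_def)
    moreover have "word x (a # w) y" using w(1) a(1,2) by simp
    ultimately show ?thesis by blast
  qed
qed

lemma word_peel:
  assumes "word x (a # w) y" "awalk x p y" "set p \<subseteq> warcs (a # w)"
  shows "\<exists>d p'. p = d @ p' \<and> (d = adom a \<or> d = acod a) \<and> awalk (atgt a) p' y \<and> set p' \<subseteq> warcs w"
proof -
  have a: "atom_in a" "asrc a = x" and w: "word (atgt a) w y" using assms(1) by auto
  have rW: "rk (atgt a) \<le> rk (tail G e)" if "e \<in> warcs w" for e by (rule word_tail_rank(1)[OF w that])
  have out: "\<forall>g\<in>warcs (a # w). tail G g = x \<longrightarrow> g = hd (adom a) \<or> g = hd (acod a)"
  proof (intro ballI impI)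
    fix g assume that: "g \<in> warcs (a # w)" "tail G g = x"
    have "g \<notin> warcs w" using rW[of g] atom_walks(8)[OF a(1)] that(2) a(2) by auto
    then have "g \<in> aarcs a" using that(1) by simp
    then show "g = hd (adom a) \<or> g = hd (acod a)" using atom_out[OF a(1)] that(2) a(2) by simp
  qed
  have forced: "forced (warcs (a # w)) (adom a)" "forced (warcs (a # w)) (acod a)"
    using forced_Un[OF atom_forced(1)[OF a(1)] atom_walks(1)[OF a(1)], of "warcs w"]
      forced_Un[OF atom_forced(2)[OF a(1)] atom_walks(2)[OF a(1)], of "warcs w"] rW by auto
  have sub: "aarcs a \<subseteq> warcs (a # w)" by simp
  have "\<exists>d p'. p = d @ p' \<and> (d = adom a \<or> d = acod a) \<and> awalk (atgt a) p' y \<and> set p' \<subseteq> warcs (a # w) - aarcs a"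
    by (rule peel_atom[OF a sub out forced assms(2,3) disjI1[OF word_ends(3)[OF w]]])
  then obtain d p' where "p = d @ p'" "d = adom a \<or> d = acod a" "awalk (atgt a) p' y"
    "set p' \<subseteq> warcs (a # w) - aarcs a" by (elim exE conjE) (rule that)
  moreover from this(4) have "set p' \<subseteq> warcs w" by auto
  ultimately show ?thesis by blast
qed

lemma atom_wind:
  assumes "atom_in a" "z \<notin> support D G" "z \<notin> \<Union> (wfaces [a])" "d = adom a \<or> d = acod a" "d' = adom a \<or> d' = acod a"
  shows "wind D d z = wind D d' z"
proof (cases a)
  case (Ed e)
  then show ?thesis using assms by auto
next
  case (Fc \<phi>)
  then have "wind D (fdom \<phi>) z = wind D (fcod \<phi>) z" using assms(1-3) by (intro face_bigon(5)) auto
  then show ?thesis using assms(4,5) Fc by auto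
qed

text \<open>
  A walk through a chain chooses one side of each piece. Off the faces of the chain both choices have
  the same winding number.
\<close>

lemma word_wind:
  assumes "word x w y" "awalk x p y" "awalk x q y" "set p \<subseteq> warcs w" "set q \<subseteq> warcs w"
    "z \<notin> support D G" "z \<notin> \<Union> (wfaces w)"
  shows "wind D p z = wind D q z"
  using assms(1-5,7)
proof (induction w arbitrary: x p q)
  case Nil
  then show ?case by simp
next
  case (Cons a w)
  then have a: "atom_in a" "asrc a = x" and w: "word (atgt a) w y" by auto
  obtain d p' where p: "p = d @ p'" "d = adom a \<or> d = acod a" "awalk (atgt a) p' y" "set p' \<subseteq> warcs w"
    using word_peel[OF Cons.prems(1,2,4)] by (elim exE conjE) (rule that)
  obtain d' q' where q: "q = d' @ q'" "d' = adom a \<or> d' = acod a" "awalk (atgt a) q' y" "set q' \<subseteq> warcs w"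
    using word_peel[OF Cons.prems(1,3,5)] by (elim exE conjE) (rule that)
  have z: "z \<notin> \<Union> (wfaces [a])" "z \<notin> \<Union> (wfaces w)" using Cons.prems(6) by (auto simp: wfaces_def)
  show ?case
    using atom_wind[OF a(1) assms(6) z(1) p(2) q(2)] Cons.IH[OF w p(3) q(3) p(4) q(4) z(2)]
    by (simp add: p(1) q(1))
qed

text \<open>
  Two walks that cover a chain are its two sides: at each face they use different sides, and the
  winding numbers tell which walk uses which.
\<close>

lemma word_sides:
  assumes "word x w y" "awalk x p y" "awalk x q y" "set p \<union> set q = warcs w"
    "\<And>\<phi> z. \<phi> \<in> wfaces w \<Longrightarrow> z \<in> \<phi> \<Longrightarrow> wind D p z - wind D q z = - 1"
  shows "p = wdom w \<and> q = wcod w"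
  using assms
proof (induction w arbitrary: x p q)
  case Nil
  then show ?case by simp
next
  case (Cons a w)
  then have a: "atom_in a" "asrc a = x" and w: "word (atgt a) w y" by auto
  have sub: "set p \<subseteq> warcs (a # w)" "set q \<subseteq> warcs (a # w)" using Cons.prems(4) by auto
  obtain d p' where p: "p = d @ p'" "d = adom a \<or> d = acod a" "awalk (atgt a) p' y" "set p' \<subseteq> warcs w"
    using word_peel[OF Cons.prems(1,2) sub(1)] by (elim exE conjE) (rule that)
  obtain d' q' where q: "q = d' @ q'" "d' = adom a \<or> d' = acod a" "awalk (atgt a) q' y" "set q' \<subseteq> warcs w"
    using word_peel[OF Cons.prems(1,3) sub(2)] by (elim exE conjE) (rule that)
  have disj: "aarcs a \<inter> warcs w = {}"
    using atom_tail_rank(3)[OF a(1)] word_tail_rank(1)[OF w] by fastforce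
  have dd: "set d \<subseteq> aarcs a" "set d' \<subseteq> aarcs a" using p(2) q(2) by (auto simp: aarcs_def)
  have un: "(set d \<union> set d') \<union> (set p' \<union> set q') = aarcs a \<union> warcs w"
    using Cons.prems(4) by (auto simp: p(1) q(1))
  have cover: "set d \<union> set d' = aarcs a" "set p' \<union> set q' = warcs w"
    using un disj dd p(4) q(4) by blast+
  have "wind D p' z - wind D q' z = - 1" if \<phi>: "\<phi> \<in> wfaces w" "z \<in> \<phi>" for \<phi> z
  proof -
    have i: "\<phi> \<in> interior_faces D G" using word_faces[OF w] \<phi>(1) by blast
    have z: "z \<notin> support D G" using interior_face(3)[OF i] \<phi>(2) by blast
    have "z \<notin> \<psi>" if \<psi>: "\<psi> \<in> wfaces [a]" for \<psi>
    proof -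
      have a': "a = Fc \<psi>" using \<psi> by (simp add: wfaces_def)
      then have "rk (face_src D G \<psi>) < rk (face_src D G \<phi>)"
        using atom_walks(8)[OF a(1)] word_face_rank(1)[OF w \<phi>(1)] by simp
      then have "\<psi> \<noteq> \<phi>" by auto
      then show ?thesis using interior_faces_disjoint[of \<psi> \<phi>] a(1) a' i \<phi>(2) by auto
    qed
    then have "z \<notin> \<Union> (wfaces [a])" by blast
    from atom_wind[OF a(1) z this p(2) q(2)] Cons.prems(5)[OF _ \<phi>(2)] \<phi>(1)
    show ?thesis by (simp add: p(1) q(1) wfaces_def)
  qed
  then have IH: "p' = wdom w \<and> q' = wcod w"
    using Cons.IH[OF w p(3) q(3) cover(2)] by blast
  have "d = adom a \<and> d' = acod a"
  proof (cases a)
    case (Ed e)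
    then show ?thesis using p(2) q(2) by simp
  next
    case (Fc \<phi>)
    then have i: "\<phi> \<in> interior_faces D G" using a(1) by simp
    note b = bigonD[OF face_bigon(1)[OF i]]
    have "d \<noteq> d'"
    proof
      assume "d = d'"
      then have c: "set d = set (fdom \<phi>) \<union> set (fcod \<phi>)" using cover(1) Fc by simp
      have "d = fdom \<phi> \<or> d = fcod \<phi>" using p(2) Fc by simp
      moreover have h: "hd (fdom \<phi>) \<in> set (fdom \<phi>)" "hd (fcod \<phi>) \<in> set (fcod \<phi>)" using b(1,2) by simp_all
      then have "hd (fdom \<phi>) \<in> set d" "hd (fcod \<phi>) \<in> set d" unfolding c by simp_all
      ultimately have "hd (fcod \<phi>) \<in> set (fdom \<phi>) \<or> hd (fdom \<phi>) \<in> set (fcod \<phi>)" by (elim disjE) simp_all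
      then show False using b(8) h disjoint_iff by metis
    qed
    moreover have "\<not> (d = fcod \<phi> \<and> d' = fdom \<phi>)"
    proof
      assume s: "d = fcod \<phi> \<and> d' = fdom \<phi>"
      obtain z where z: "z \<in> \<phi>" using interior_face(1)[OF i] by blast
      have zs: "z \<notin> support D G" using interior_face(3)[OF i] z by blast
      have "z \<notin> \<psi>" if \<psi>: "\<psi> \<in> wfaces w" for \<psi>
      proof -
        have "rk (face_src D G \<phi>) < rk (face_src D G \<psi>)"
          using atom_walks(8)[OF a(1)] word_face_rank(1)[OF w \<psi>] Fc by simp
        then have "\<psi> \<noteq> \<phi>" by auto
        moreover have "\<psi> \<in> interior_faces D G" using word_faces[OF w] \<psi> by blast
        ultimately show ?thesis using interior_faces_disjoint[of \<psi> \<phi>] i z by auto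
      qed
      then have "z \<notin> \<Union> (wfaces w)" by blast
      from word_wind[OF w p(3) q(3) p(4) q(4) zs this]
      have e0: "wind D p' z = wind D q' z" .
      have "wind D p z - wind D q z = - 1" using Cons.prems(5)[OF _ z] Fc by simp
      then have e1: "wind D (fcod \<phi>) z - wind D (fdom \<phi>) z = - 1" using e0 s by (simp add: p(1) q(1))
      have "(wind D (fcod \<phi>) z - wind D (fdom \<phi>) z) + (wind D (fdom \<phi>) z - wind D (fcod \<phi>) z) = - 2"
        unfolding e1 face_bigon(4)[OF i z] by simp
      then show False by simp
    qed
    ultimately show ?thesis using p(2) q(2) Fc by auto
  qed
  then show ?case using IH by (simp add: p(1) q(1))
qed

lemma gr_subgraph:
  assumes "S \<subseteq> arcs G" "x \<in> verts G" shows "subgraph (gr G x S) G"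
  using assms wf_digraph_axioms
  by (auto simp: subgraph_def compatible_def wf_digraph_def)

lemma gr_awalk:
  "pre_digraph.awalk (gr G x S) u p v \<longleftrightarrow>
    u \<in> insert x (tail G ` S \<union> head G ` S) \<and> set p \<subseteq> S \<and> cas u p v"
proof -
  have "pre_digraph.cas (gr G x S) = cas" by (rule compatible_cas) (simp add: compatible_def)
  then show ?thesis by (simp add: pre_digraph.awalk_def)
qed

lemma word_gr:
  assumes "word x w y"
  shows "subgraph (gr G x (warcs w)) G" "is_source (gr G x (warcs w)) s \<longleftrightarrow> s = x"
    "is_target (gr G x (warcs w)) t \<longleftrightarrow> t = y"
    "src (gr G x (warcs w)) = x" "tgt (gr G x (warcs w)) = y" "y \<in> verts (gr G x (warcs w))"
proof -
  let ?H = "gr G x (warcs w)"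
  note SG = word_arcs[OF assms]
  have xy: "x \<in> verts G" "y \<in> verts G" using word_ends[OF assms] by blast+
  show "subgraph ?H G" using SG xy(1) by (rule gr_subgraph)
  have V: "verts ?H \<subseteq> verts G" using SG xy(1) by auto
  have wk: "(\<exists>p. pre_digraph.awalk ?H x p v) \<and> (\<exists>p. pre_digraph.awalk ?H v p y)" if "v \<in> verts ?H" for v
  proof -
    have v: "v \<in> insert x (tail G ` warcs w \<union> head G ` warcs w)" using that by simp
    obtain p q where pq: "awalk x p v" "set p \<subseteq> warcs w" "awalk v q y" "set q \<subseteq> warcs w"
      using word_vert_walks[OF assms v] by blast
    then have "pre_digraph.awalk ?H x p v" "pre_digraph.awalk ?H v q y"
      using that unfolding gr_awalk by (simp_all add: awalk_def)
    then show ?thesis by blast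
  qed
  have vr: "rk x \<le> rk v \<and> rk v \<le> rk y" if v: "v \<in> verts ?H" for v
  proof -
    obtain p q where "awalk x p v" "awalk v q y"
      using word_vert_walks[OF assms, of v] v unfolding gr_simps by blast
    then show ?thesis using rk_walk[of x p v] rk_walk[of v q y] by simp
  qed
  have eqs: "u = v" if "pre_digraph.awalk ?H u p v" "rk v \<le> rk u" "u \<in> verts ?H" for u p v
  proof -
    have "set p \<subseteq> warcs w" "cas u p v" using that(1) unfolding gr_awalk by simp_all
    moreover have "u \<in> verts G" using that(3) V by blast
    ultimately have "awalk u p v" using SG by (simp add: awalk_def)
    then show ?thesis using rk_eq_walk[of u p v] that(2) by simp
  qed
  obtain p where p: "awalk x p y" "set p \<subseteq> warcs w" using word_vert_walks[OF assms, of x] by blast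
  show yH: "y \<in> verts ?H"
  proof (cases "p = []")
    case True
    then show ?thesis using p by (simp add: awalk_Nil_iff)
  next
    case False
    then have "last p \<in> warcs w" using p(2) last_in_set by blast
    then have "head G (last p) \<in> verts ?H" by auto
    then show ?thesis using head_last[OF p(1) False] by simp
  qed
  have xH: "x \<in> verts ?H" by simp
  show S: "is_source ?H s \<longleftrightarrow> s = x" for s
  proof
    assume "is_source ?H s"
    then obtain p where "pre_digraph.awalk ?H s p x" "s \<in> verts ?H" unfolding is_source_def using xH by blast
    then show "s = x" using eqs[of s p x] vr[of s] by simp
  next
    assume "s = x"
    then show "is_source ?H s" unfolding is_source_def using wk xH by blast
  qed
  show T: "is_target ?H t \<longleftrightarrow> t = y" for t
  proof
    assume "is_target ?H t"
    then obtain p where "pre_digraph.awalk ?H y p t" "t \<in> verts ?H" unfolding is_target_def using yH by blast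
    then show "t = y" using eqs[of y p t] vr[of t] yH by simp
  next
    assume "t = y"
    then show "is_target ?H t" unfolding is_target_def using wk yH by blast
  qed
  show "src ?H = x" "tgt ?H = y" unfolding src_def tgt_def S T by simp_all
qed

end

section \<open>The topology of chains\<close>

text \<open>
  The inverse of a parametrization would embed an open set of the plane into the line.
\<close>

lemma interior_arc_empty:
  fixes g :: "real \<Rightarrow> complex"
  assumes "Path_Connected.arc g" shows "interior (path_image g) = {}"
proof (rule ccontr)
  assume ne: "interior (path_image g) \<noteq> {}"
  have g: "continuous_on {0..1} g" "inj_on g {0..1}" using assms by (simp_all add: arc_def path_def)
  define h where "h = inv_into {0..1} g"
  have "continuous_on (g ` {0..1}) h"
    by (rule continuous_on_inv[OF g(1)]) (use g(2) in \<open>auto simp: h_def\<close>)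
  then have "continuous_on (interior (path_image g)) h"
    using interior_subset continuous_on_subset by (metis path_image_def)
  moreover have "inj_on h (path_image g)"
    unfolding h_def path_image_def by (rule inj_on_inv_into) simp
  then have "inj_on h (interior (path_image g))" using interior_subset inj_on_subset by metis
  ultimately have "DIM(complex) \<le> DIM(real)" using ne by (intro invariance_of_dimension) auto
  then show False by simp
qed

lemma components_cases:
  assumes "C \<in> components S" "A \<in> components S" "z \<in> C" "z \<in> A" shows "C = A"
proof (rule ccontr)
  assume "C \<noteq> A"
  then have "C \<inter> A = {}" using components_nonoverlap[OF assms(1,2)] by simp
  then show False using assms(3,4) by auto
qed

context plane_digraph
begin

lemma plane_subgraph:
  assumes "subgraph H G" shows "plane_graph D H"
proof -
  have H: "verts H \<subseteq> verts G" "arcs H \<subseteq> arcs G" "tail H = tail G" "head H = head G"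
    using assms by (auto simp: subgraph_def compatible_def)
  have "fin_digraph H" using assms by (rule fin_digraph_subgraph)
  moreover have "inj_on (vpt D) (verts H)" using plane H(1) by (auto simp: plane_graph_def intro: inj_on_subset)
  moreover have "edge_interior D e \<inter> vpt D ` verts H = {}" if "e \<in> arcs H" for e
  proof -
    have "edge_interior D e \<inter> vpt D ` verts G = {}" using crv(5) H(2) that by auto
    then show ?thesis using H(1) by auto
  qed
  moreover have "edge_interior D e \<inter> edge_interior D f = {}" if "e \<in> arcs H" "f \<in> arcs H" "e \<noteq> f" for e f
    using edge_interior_disjoint[of e f] H(2) that by auto
  moreover have "simple_path (crv D e)" "pathstart (crv D e) = vpt D (tail H e)" "pathfinish (crv D e) = vpt D (head H e)"
    if "e \<in> arcs H" for e
    using crv(1,3,4)[of e] H that by auto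
  ultimately show ?thesis unfolding plane_graph_def by simp
qed

end

context ranked_globular_digraph
begin

text \<open>These are the closed disc of a face and the curve of an arc.\<close>

definition piece where "piece a = img D (aarcs a) \<union> \<Union> (wfaces [a])"

text \<open>
  The vertex \<open>x\<close> is mentioned for the sake of the empty chain.
\<close>

definition region where "region x w = insert (vpt D x) (img D (warcs w) \<union> \<Union> (wfaces w))"

lemma face_open: "\<phi> \<in> interior_faces D G \<Longrightarrow> open \<phi>"
  using face_bigon(2) ring_jordan(1)[OF bigon_ring[OF face_bigon(1)]] by metis

lemma atom_ends_in_img:
  assumes "atom_in a" shows "vpt D (asrc a) \<in> img D (aarcs a)" "vpt D (atgt a) \<in> img D (aarcs a)"
    "vpt D (asrc a) \<noteq> vpt D (atgt a)"
proof -
  note w = atom_walks[OF assms]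
  have "hd (adom a) \<in> aarcs a" "last (adom a) \<in> aarcs a" using w(3) by (simp_all add: aarcs_def)
  then have "asrc a \<in> tail G ` aarcs a" "atgt a \<in> head G ` aarcs a" by (simp_all add: asrc_def atgt_def)
  then show "vpt D (asrc a) \<in> img D (aarcs a)" "vpt D (atgt a) \<in> img D (aarcs a)"
    using vpt_in_img[OF w(5,6)] vpt_in_img[OF w(5,7)] by simp_all
  show "vpt D (asrc a) \<noteq> vpt D (atgt a)" using vpt_inj[OF w(6,7)] w(8) by auto
qed

lemma atom_piece:
  assumes "atom_in a"
  shows "compact (piece a)" "connected (- piece a)" "img D (aarcs a) \<subseteq> closure (- piece a)"
    "connected (img D (aarcs a))"
proof -
  have "compact (piece a) \<and> connected (- piece a) \<and> img D (aarcs a) \<subseteq> closure (- piece a) \<and> connected (img D (aarcs a))"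
  proof (cases a)
    case (Ed e)
    then have e: "e \<in> arcs G" using assms by simp
    have p: "piece a = path_image (crv D e)" "img D (aarcs a) = path_image (crv D e)"
      using Ed by (simp_all add: piece_def)
    have "vpt D (tail G e) \<noteq> vpt D (head G e)" using vpt_inj[of "tail G e" "head G e"] e rk[OF e] by auto
    then have arc: "Path_Connected.arc (crv D e)" using crv[OF e] by (simp add: arc_simple_path)
    have "closure (- piece a) = UNIV" using interior_arc_empty[OF arc] p(1) by (simp add: closure_complement)
    moreover have "connected (- path_image (crv D e))" by (rule connected_arc_complement[OF arc]) simp
    ultimately show ?thesis using p crv(1,2)[OF e]
      by (simp add: compact_path_image connected_path_image)
  next
    case (Fc \<phi>)
    then have i: "\<phi> \<in> interior_faces D G" using assms by simp
    let ?J = "img D (set (fdom \<phi>) \<union> set (fcod \<phi>))"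
    have ring: "ring (set (fdom \<phi>) \<union> set (fcod \<phi>))" by (rule bigon_ring[OF face_bigon(1)[OF i]])
    note J = ring_jordan[OF ring]
    have \<phi>: "\<phi> = inside ?J" by (rule face_bigon(2)[OF i])
    have p: "piece a = ?J \<union> inside ?J" "img D (aarcs a) = ?J" using Fc \<phi> by (simp_all add: piece_def)
    have cl: "piece a = closure (inside ?J)" using J(12) p(1) by (simp add: Un_commute)
    have "compact (piece a)" unfolding cl using J(4) by (simp add: compact_closure)
    moreover have "- piece a = outside ?J" unfolding p(1) by (rule outside_inside[symmetric])
    moreover have "?J \<subseteq> closure (outside ?J)" using J(13) by auto
    moreover have "connected ?J"
    proof -
      obtain c where c: "simple_path c" "path_image c = ?J" using ring by (auto simp: ring_def)
      then show ?thesis using connected_simple_path_image[OF c(1)] by simp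
    qed
    ultimately show ?thesis using J(6) p(2) by simp
  qed
  then show "compact (piece a)" "connected (- piece a)" "img D (aarcs a) \<subseteq> closure (- piece a)"
    "connected (img D (aarcs a))" by simp_all
qed

lemma region_Cons:
  assumes "word x (a # w) y" shows "region x (a # w) = piece a \<union> region (atgt a) w"
proof -
  have a: "atom_in a" "asrc a = x" using assms by auto
  have "vpt D x \<in> img D (aarcs a)" "vpt D (atgt a) \<in> img D (aarcs a)" using atom_ends_in_img[OF a(1)] a(2) by auto
  moreover have "wfaces (a # w) = wfaces [a] \<union> wfaces w" by (auto simp: wfaces_def)
  ultimately show ?thesis unfolding region_def piece_def by auto
qed

lemma word_faces_support:
  assumes "word x w y" "z \<in> \<Union> (wfaces w)" shows "z \<notin> support D G"
proof -
  obtain \<phi> where "\<phi> \<in> wfaces w" "z \<in> \<phi>" using assms(2) by blast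
  then show ?thesis using interior_face(3)[of \<phi>] word_faces[OF assms(1)] by blast
qed

lemma img_in_support: "S \<subseteq> arcs G \<Longrightarrow> z \<in> img D S \<Longrightarrow> z \<in> support D G"
  using img_support by blast

text \<open>
  A common vertex can be reached from \<open>atgt a\<close> and reaches \<open>atgt a\<close>, so it is this vertex; distinct faces are
  disjoint from each other and from the support.
\<close>

lemma piece_Int_region:
  assumes "word x (a # w) y" shows "piece a \<inter> region (atgt a) w = {vpt D (atgt a)}"
proof -
  have a: "atom_in a" "asrc a = x" and w: "word (atgt a) w y" using assms by auto
  note A = atom_walks[OF a(1)] and W = word_arcs[OF w]
  have disj: "aarcs a \<inter> warcs w = {}"
    using atom_tail_rank(3)[OF a(1)] word_tail_rank(1)[OF w] by fastforce
  have common: "v = atgt a" if v: "v \<in> tail G ` aarcs a \<union> head G ` aarcs a" "v \<in> tail G ` warcs w \<union> head G ` warcs w" for v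
  proof -
    obtain p where p: "awalk v p (atgt a)" using atom_vert_walks(2)[OF a(1) v(1)] by blast
    have "v \<in> insert (atgt a) (tail G ` warcs w \<union> head G ` warcs w)" using v(2) by simp
    then obtain q where q: "awalk (atgt a) q v" using word_vert_walks[OF w] by metis
    show ?thesis using rk_eq_walk[OF q] rk_walk[OF p] by simp
  qed
  have img: "z = vpt D (atgt a)" if "z \<in> img D (aarcs a)" "z \<in> img D (warcs w)" for z
  proof -
    have "z \<in> img D (aarcs a) \<inter> img D (warcs w)" using that by simp
    then have "z \<in> vpt D ` ((tail G ` aarcs a \<union> head G ` aarcs a) \<inter> (tail G ` warcs w \<union> head G ` warcs w))"
      unfolding img_Int[OF A(5) W disj] .
    then obtain v where v: "z = vpt D v" "v \<in> tail G ` aarcs a \<union> head G ` aarcs a"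
      "v \<in> tail G ` warcs w \<union> head G ` warcs w" by (elim imageE IntE)
    show ?thesis unfolding v(1) using common[OF v(2,3)] by (rule arg_cong)
  qed
  have faces: False if z: "z \<in> \<phi>" "z \<in> \<psi>" "\<phi> \<in> wfaces [a]" "\<psi> \<in> wfaces w" for z \<phi> \<psi>
  proof -
    have a': "a = Fc \<phi>" using z(3) by (simp add: wfaces_def)
    have "rk (face_src D G \<phi>) < rk (face_src D G \<psi>)"
      using A(8) word_face_rank(1)[OF w z(4)] a' by simp
    then have "\<phi> \<noteq> \<psi>" by auto
    moreover have "\<phi> \<in> interior_faces D G" "\<psi> \<in> interior_faces D G"
      using a(1) a' word_faces[OF w] z(4) by auto
    ultimately show False using interior_faces_disjoint[of \<phi> \<psi>] z(1,2) by blast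
  qed
  have wa: "word x [a] (atgt a)" using a A(7) by simp
  have s1: "z \<notin> support D G" if "z \<in> \<Union> (wfaces [a])" for z by (rule word_faces_support[OF wa that])
  have s2: "z \<notin> support D G" if "z \<in> \<Union> (wfaces w)" for z by (rule word_faces_support[OF w that])
  note i1 = img_in_support[OF A(5)] and i2 = img_in_support[OF W]
  have t: "vpt D (atgt a) \<in> img D (aarcs a)" using atom_ends_in_img(2)[OF a(1)] .
  have "z = vpt D (atgt a)" if "z \<in> piece a" "z \<in> region (atgt a) w" for z
  proof -
    have "z \<in> img D (aarcs a) \<or> z \<in> \<Union> (wfaces [a])" using that(1) unfolding piece_def Un_iff .
    moreover have "z = vpt D (atgt a) \<or> z \<in> img D (warcs w) \<or> z \<in> \<Union> (wfaces w)"
      using that(2) unfolding region_def insert_iff Un_iff .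
    ultimately show ?thesis
    proof (elim disjE)
      assume "z \<in> img D (aarcs a)" "z \<in> img D (warcs w)" then show ?thesis by (rule img)
    next
      assume "z \<in> img D (aarcs a)" "z \<in> \<Union> (wfaces w)"
      from s2[OF this(2)] i1[OF this(1)] show ?thesis by (rule notE)
    next
      assume "z \<in> \<Union> (wfaces [a])" "z \<in> img D (warcs w)"
      from s1[OF this(1)] i2[OF this(2)] show ?thesis by (rule notE)
    next
      assume "z \<in> \<Union> (wfaces [a])" "z \<in> \<Union> (wfaces w)"
      then obtain \<phi> \<psi> where "z \<in> \<phi>" "z \<in> \<psi>" "\<phi> \<in> wfaces [a]" "\<psi> \<in> wfaces w" by (elim UnionE)
      from faces[OF this] show ?thesis by (rule FalseE)
    qed
  qed
  then have "piece a \<inter> region (atgt a) w \<subseteq> {vpt D (atgt a)}" by (metis IntE singletonI subsetI)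
  moreover have "vpt D (atgt a) \<in> piece a" "vpt D (atgt a) \<in> region (atgt a) w"
    using t by (simp_all add: piece_def region_def)
  ultimately show ?thesis by (metis IntI insert_subset empty_subsetI subset_antisym)
qed

text \<open>
  Add one piece at a time. The new piece meets the old region in a single point, so by Janiszewski's
  theorem the complement of the union is again connected. That all arcs are in the closure of this
  complement means that they are incident with the exterior face. At the common point of the two
  regions this follows from the nearby points of the new piece.
\<close>

lemma region_topology:
  assumes "word x w y"
  shows "compact (region x w)" "connected (- region x w)"
    "insert (vpt D x) (img D (warcs w)) \<subseteq> closure (- region x w)"
proof -
  have "compact (region x w) \<and> connected (- region x w) \<and>
    insert (vpt D x) (img D (warcs w)) \<subseteq> closure (- region x w)" using assms
  proof (induction w arbitrary: x)
    case Nil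
    have r: "region x [] = {vpt D x}" by (simp add: region_def)
    have "connected (- {vpt D x})" by (rule connected_punctured_universe) simp
    moreover have "closure (- {vpt D x}) = UNIV" by (simp add: closure_complement)
    ultimately show ?case unfolding r by simp
  next
    case (Cons a w)
    then have a: "atom_in a" "asrc a = x" and w: "word (atgt a) w y" by auto
    note P = atom_piece[OF a(1)]
    let ?R = "region (atgt a) w" and ?v = "vpt D (atgt a)"
    have R: "compact ?R" "connected (- ?R)" "insert ?v (img D (warcs w)) \<subseteq> closure (- ?R)"
      using Cons.IH[OF w] by simp_all
    note I = piece_Int_region[OF Cons.prems] and RC = region_Cons[OF Cons.prems]
    have "connected (- (piece a \<union> ?R))"
      by (rule Janiszewski_connected[OF P(1) compact_imp_closed[OF R(1)] _ P(2) R(2)]) (simp add: I)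
    moreover have "compact (piece a \<union> ?R)" using P(1) R(1) by (rule compact_Un)
    moreover have "insert (vpt D x) (img D (warcs (a # w))) \<subseteq> closure (- (piece a \<union> ?R))"
    proof -
      have compl: "- (piece a \<union> ?R) = - ?R \<inter> - piece a" "- (piece a \<union> ?R) = - piece a \<inter> - ?R" by auto
      have c1: "z \<in> closure (- (piece a \<union> ?R))" if "z \<in> img D (aarcs a)" "z \<noteq> ?v" for z
      proof -
        have "z \<in> piece a" using that(1) by (simp add: piece_def)
        then have "z \<notin> ?R" using I that(2) by auto
        then have "z \<in> - ?R \<inter> closure (- piece a)" using that(1) P(3) by auto
        then show ?thesis using open_Int_closure_subset[of "- ?R" "- piece a"] compact_imp_closed[OF R(1)]
          unfolding compl(1) by (auto simp: open_Compl)
      qed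
      have c2: "z \<in> closure (- (piece a \<union> ?R))" if "z \<in> img D (warcs w)" "z \<noteq> ?v" for z
      proof -
        have "z \<in> ?R" using that(1) by (simp add: region_def)
        then have "z \<notin> piece a" using I that(2) by auto
        then have "z \<in> - piece a \<inter> closure (- ?R)" using that(1) R(3) by auto
        then show ?thesis using open_Int_closure_subset[of "- piece a" "- ?R"] compact_imp_closed[OF P(1)]
          unfolding compl(2) by (auto simp: open_Compl)
      qed
      note E = atom_ends_in_img[OF a(1)]
      \<comment> \<open>the point \<open>?v\<close> lies on both pieces, but is a limit of points of the new piece only\<close>
      have "?v islimpt img D (aarcs a)"
        using E by (intro connected_imp_perfect[OF P(4)]) auto
      then have "?v \<in> closure (img D (aarcs a) - {?v})" by (simp add: islimpt_in_closure)
      moreover have "img D (aarcs a) - {?v} \<subseteq> closure (- (piece a \<union> ?R))" using c1 by auto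
      then have "closure (img D (aarcs a) - {?v}) \<subseteq> closure (- (piece a \<union> ?R))"
        by (rule closure_minimal) simp
      ultimately have "?v \<in> closure (- (piece a \<union> ?R))" by (rule rev_subsetD)
      then have "z \<in> closure (- (piece a \<union> ?R))" if "z \<in> img D (aarcs a) \<union> img D (warcs w)" for z
        using c1[of z] c2[of z] that by (cases "z = ?v") auto
      moreover have "vpt D x \<in> img D (aarcs a)" using E(1) a(2) by simp
      ultimately show ?thesis by auto
    qed
    ultimately show ?case unfolding RC by simp
  qed
  then show "compact (region x w)" "connected (- region x w)"
    "insert (vpt D x) (img D (warcs w)) \<subseteq> closure (- region x w)" by simp_all
qed

lemma word_graph_support:
  assumes "word x w y"
  shows "support D (gr G x (warcs w)) = insert (vpt D x) (img D (warcs w))"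
proof -
  note S = word_arcs[OF assms]
  have "vpt D v \<in> img D (warcs w)" if "v \<in> tail G ` warcs w \<union> head G ` warcs w" for v
  proof -
    have "v \<in> verts G" using that S by auto
    then show ?thesis using vpt_in_img[OF S] that by simp
  qed
  then show ?thesis unfolding support_def by (auto simp: img_def)
qed

lemma word_graph_faces:
  assumes "word x w y"
  defines "H \<equiv> gr G x (warcs w)"
  shows "exterior D H = - region x w" "faces D H = insert (- region x w) (wfaces w)"
    "frontier (exterior D H) = support D H"
proof -
  note T = region_topology[OF assms(1)]
  have sup: "support D H = insert (vpt D x) (img D (warcs w))"
    unfolding H_def by (rule word_graph_support[OF assms(1)])
  have reg: "region x w = support D H \<union> \<Union> (wfaces w)" unfolding sup region_def by auto
  have clR: "closed (region x w)" by (rule compact_imp_closed[OF T(1)])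
  have unb: "\<not> bounded (- region x w)"
    using T(1) by (meson compact_imp_bounded cobounded_imp_unbounded double_complement)
  have i: "\<phi> \<in> interior_faces D G" if "\<phi> \<in> wfaces w" for \<phi> using word_faces[OF assms(1)] that by auto
  have xG: "x \<in> verts G" using word_ends(1)[OF assms(1)] .
  have supG: "support D H \<subseteq> support D G"
    unfolding sup using img_support[OF word_arcs[OF assms(1)]] xG by (auto simp: support_def)
  have fr: "frontier (- region x w) = support D H"
  proof
    show "support D H \<subseteq> frontier (- region x w)"
    proof
      fix z assume z: "z \<in> support D H"
      have "interior (- region x w) = - region x w" using clR by (simp add: interior_open open_Compl)
      moreover have "z \<in> region x w" using z by (simp add: reg)
      moreover have "z \<in> closure (- region x w)" using z T(3) unfolding sup by (rule rev_subsetD)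
      ultimately show "z \<in> frontier (- region x w)" by (simp add: frontier_def)
    qed
    show "frontier (- region x w) \<subseteq> support D H"
    proof
      fix z assume z: "z \<in> frontier (- region x w)"
      then have "z \<in> region x w" "z \<in> closure (- region x w)"
        using clR by (auto simp: frontier_def interior_open open_Compl)
      moreover have "z \<notin> \<phi>" if \<phi>: "\<phi> \<in> wfaces w" for \<phi>
      proof -
        have "\<phi> \<inter> - region x w = {}" using \<phi> unfolding reg by auto
        then have "\<phi> \<inter> closure (- region x w) = {}"
          using open_Int_closure_eq_empty[OF face_open[OF i[OF \<phi>]]] by simp
        then show ?thesis using calculation(2) by auto
      qed
      ultimately show "z \<in> support D H" unfolding reg by auto
    qed
  qed
  have c0: "- region x w \<in> components (- support D H)"
  proof (rule component_of_complement[OF T(2)])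
    show "- region x w \<noteq> {}" using unb by auto
    show "- region x w \<inter> support D H = {}" unfolding reg by auto
    show "frontier (- region x w) \<subseteq> support D H" using fr by simp
  qed
  have c1: "\<phi> \<in> components (- support D H)" if \<phi>: "\<phi> \<in> wfaces w" for \<phi>
  proof (rule component_of_complement)
    show "connected \<phi>" "\<phi> \<noteq> {}" using interior_face(1,2)[OF i[OF \<phi>]] by simp_all
    show "\<phi> \<inter> support D H = {}" using interior_face(3)[OF i[OF \<phi>]] supG by auto
    have "set (fdom \<phi>) \<union> set (fcod \<phi>) \<subseteq> warcs w"
      using \<phi> by (force simp: wfaces_def warcs_def aarcs_def)
    then show "frontier \<phi> \<subseteq> support D H" using img_mono unfolding face_bigon(3)[OF i[OF \<phi>]] sup by auto
  qed
  have c2: "C = - region x w \<or> C \<in> wfaces w" if C: "C \<in> components (- support D H)" for C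
  proof -
    obtain z where z: "z \<in> C" using in_components_nonempty[OF C] by auto
    then have "z \<notin> support D H" using in_components_subset[OF C] by auto
    then have "z \<in> - region x w \<or> (\<exists>\<phi>\<in>wfaces w. z \<in> \<phi>)" unfolding reg by auto
    then show ?thesis
      using components_cases[OF C c0 z] components_cases[OF C c1 z] by metis
  qed
  show "faces D H = insert (- region x w) (wfaces w)"
    unfolding faces_def using c0 c1 c2 by auto
  have b: "bounded (support D H)" using T(1) unfolding reg
    by (meson Un_upper1 bounded_subset compact_imp_bounded)
  have "outside (support D H) \<in> components (- support D H)"
    unfolding outside_in_components
    using b connected_outside[OF b] unbounded_outside[OF b] by auto
  then have "outside (support D H) = - region x w"
    using c2[of "outside (support D H)"] unbounded_outside[OF b] interior_face(4)[OF i] by auto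
  then show ext: "exterior D H = - region x w" by (simp add: exterior_def)
  show "frontier (exterior D H) = support D H" unfolding ext by (rule fr)
qed

lemma word_wind_face:
  assumes "word x w y" "\<phi> \<in> wfaces w" "z \<in> \<phi>"
  shows "wind D (wdom w) z - wind D (wcod w) z = - 1"
  using assms(1,2)
proof (induction w arbitrary: x)
  case Nil
  then show ?case by simp
next
  case (Cons a w)
  then have a: "atom_in a" "asrc a = x" and w: "word (atgt a) w y" by auto
  have i: "\<phi> \<in> interior_faces D G" using word_faces[OF Cons.prems(1)] Cons.prems(2) by auto
  have zs: "z \<notin> support D G" using interior_face(3)[OF i] assms(3) by auto
  show ?case
  proof (cases "a = Fc \<phi>")
    case True
    have "z \<notin> \<psi>" if \<psi>: "\<psi> \<in> wfaces w" for \<psi>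
    proof -
      have "rk (face_src D G \<phi>) < rk (face_src D G \<psi>)"
        using atom_walks(8)[OF a(1)] word_face_rank(1)[OF w \<psi>] True by simp
      then have "\<psi> \<noteq> \<phi>" by auto
      moreover have "\<psi> \<in> interior_faces D G" using word_faces[OF w] \<psi> by auto
      ultimately show ?thesis using interior_faces_disjoint[of \<psi> \<phi>] i assms(3) by auto
    qed
    then have "z \<notin> \<Union> (wfaces w)" by auto
    then have "wind D (wdom w) z = wind D (wcod w) z"
      using word_wind[OF w word_walks(1)[OF w] word_walks(2)[OF w] _ _ zs]
      by (auto simp: wdom_def wcod_def warcs_def aarcs_def)
    then show ?thesis using face_bigon(4)[OF i assms(3)] True by simp
  next
    case False
    then have \<phi>: "\<phi> \<in> wfaces w" using Cons.prems(2) by (auto simp: wfaces_def)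
    have "z \<notin> \<psi>" if \<psi>: "\<psi> \<in> wfaces [a]" for \<psi>
    proof -
      have a': "a = Fc \<psi>" using \<psi> by (simp add: wfaces_def)
      then have "\<psi> \<noteq> \<phi>" using False by auto
      moreover have "\<psi> \<in> interior_faces D G" using a(1) a' by simp
      ultimately show ?thesis using interior_faces_disjoint[of \<psi> \<phi>] i assms(3) by auto
    qed
    then have "z \<notin> \<Union> (wfaces [a])" by auto
    then have "wind D (adom a) z = wind D (acod a) z" using atom_wind[OF a(1) zs] by simp
    then show ?thesis using Cons.IH[OF w \<phi>] by simp
  qed
qed

lemma word_trails:
  assumes "word x w y" "awalk u p v" "set p \<subseteq> warcs w" "p \<noteq> []"
  shows "pre_digraph.trail (gr G x (warcs w)) u p v"
proof -
  have "distinct p" using walk_apath[OF assms(2)] distinct_verts_imp_distinct[OF assms(2)] by (simp add: apath_def)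
  moreover have "u \<in> tail G ` warcs w"
    using tail_hd[OF assms(2,4)] hd_in_set[OF assms(4)] assms(3) by auto
  ultimately show ?thesis unfolding pre_digraph.trail_def gr_awalk using assms(2,3) by (simp add: awalk_def)
qed

lemma word_sides_arcs: "set (wdom w) \<union> set (wcod w) = warcs w"
  by (auto simp: wdom_def wcod_def warcs_def aarcs_def)

lemma wdom_ne: "word x w y \<Longrightarrow> w \<noteq> [] \<Longrightarrow> wdom w \<noteq> [] \<and> wcod w \<noteq> [] \<and> warcs w \<noteq> {}"
  by (cases w) (use atom_walks(3,4,9) in auto)

text \<open>
  Around the exterior face the orientation is reversed, so the codomain comes first. For the converse, a
  bounding pair of walks covers all arcs; hence it starts at \<open>x\<close> and ends at \<open>y\<close>, and \<open>word_sides\<close>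
  identifies the two walks.
\<close>

lemma word_graph_exterior:
  assumes w: "word x w y" and ne: "w \<noteq> []"
  defines "H \<equiv> gr G x (warcs w)"
  shows "cw_boundary D H (exterior D H) p q \<longleftrightarrow> p = wcod w \<and> q = wdom w"
proof -
  note F = word_graph_faces[OF w, folded H_def] and S = word_arcs[OF w]
  have ne': "wdom w \<noteq> []" "wcod w \<noteq> []" "warcs w \<noteq> {}" using wdom_ne[OF w ne] by simp_all
  obtain a w' where aw: "w = a # w'" using ne by (cases w) auto
  have a: "atom_in a" "asrc a = x" using w aw by auto
  have hx: "hd (adom a) \<in> warcs w" "tail G (hd (adom a)) = x"
    using atom_walks(3)[OF a(1)] a(2) aw by (simp_all add: aarcs_def asrc_def)
  have "vpt D x \<in> img D (warcs w)"
    using atom_ends_in_img(1)[OF a(1)] a(2) aw by simp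
  then have sup: "support D H = img D (warcs w)"
    using word_graph_support[OF w] unfolding H_def by auto
  have fr: "frontier (exterior D H) = img D (warcs w)" using F(3) sup by simp
  have unb: "\<exists>z. z \<in> - region x w"
  proof (rule ccontr)
    assume "\<not> ?thesis"
    then have "region x w = UNIV" by auto
    then show False using region_topology(1)[OF w] by (metis compact_imp_bounded not_bounded_UNIV)
  qed
  have inner: "\<exists>\<phi>\<in>wfaces w. z \<in> \<phi>" if "z \<notin> closure (exterior D H)" for z
  proof -
    have "z \<notin> - region x w" using that closure_subset F(1) by auto
    moreover have "z \<notin> img D (warcs w)" using that fr by (auto simp: frontier_def)
    moreover have "vpt D x \<in> img D (warcs w)" by fact
    ultimately show ?thesis unfolding region_def by auto
  qed
  have walk_facts: "path_image (walk_curve D p +++ reversepath (walk_curve D q)) = img D (set p \<union> set q)"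
    "set p \<union> set q = warcs w \<Longrightarrow> z \<in> exterior D H \<Longrightarrow> wind D p z - wind D q z = 0"
    "z \<notin> img D (set p \<union> set q) \<Longrightarrow>
      winding_number (walk_curve D p +++ reversepath (walk_curve D q)) z = wind D p z - wind D q z"
    if pq: "awalk u p v" "awalk u q v" "p \<noteq> []" "q \<noteq> []" for u v p q z
  proof -
    note c = walk_pair[OF pq]
    show "path_image (walk_curve D p +++ reversepath (walk_curve D q)) = img D (set p \<union> set q)" by (rule c(3))
    show "z \<notin> img D (set p \<union> set q) \<Longrightarrow>
      winding_number (walk_curve D p +++ reversepath (walk_curve D q)) z = wind D p z - wind D q z" by (rule c(4))
    assume un: "set p \<union> set q = warcs w" and z: "z \<in> exterior D H"
    have zo: "z \<in> outside (path_image (walk_curve D p +++ reversepath (walk_curve D q)))"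
      using z unfolding c(3) un exterior_def sup .
    have "z \<notin> img D (set p \<union> set q)"
    proof
      assume "z \<in> img D (set p \<union> set q)"
      with zo have "z \<in> outside (img D (set p \<union> set q)) \<inter> img D (set p \<union> set q)"
        unfolding c(3) by (rule IntI)
      then show False by (simp only: outside_no_overlap empty_iff)
    qed
    then show "wind D p z - wind D q z = 0"
      using winding_number_zero_in_outside[OF c(1,2) zo] c(4) by simp
  qed
  show ?thesis
  proof
    assume "p = wcod w \<and> q = wdom w"
    then have pq: "p = wcod w" "q = wdom w" by simp_all
    have wk: "awalk x (wcod w) y" "awalk x (wdom w) y" using word_walks[OF w] by simp_all
    have un: "set (wcod w) \<union> set (wdom w) = warcs w" using word_sides_arcs[of w] by (simp add: Un_commute)
    note K = walk_facts[OF wk ne'(2,1)]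
    have tr: "pre_digraph.trail H x (wcod w) y" "pre_digraph.trail H x (wdom w) y"
      unfolding H_def using word_trails[OF w wk(1) _ ne'(2)] word_trails[OF w wk(2) _ ne'(1)] un by auto
    have wn: "winding_number (walk_curve D (wcod w) +++ reversepath (walk_curve D (wdom w))) z =
      winding_number (walk_curve D (wcod w) +++ reversepath (walk_curve D (wdom w))) z' - 1"
      if z: "z \<in> exterior D H" "z' \<notin> closure (exterior D H)" for z z'
    proof -
      obtain \<phi> where \<phi>: "\<phi> \<in> wfaces w" "z' \<in> \<phi>" using inner[OF z(2)] by auto
      have "z \<notin> img D (warcs w)" using z(1) F(1) by (auto simp: region_def)
      then have "winding_number (walk_curve D (wcod w) +++ reversepath (walk_curve D (wdom w))) z = 0"
        using K(3)[of z] K(2)[OF un z(1)] un by simp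
      moreover have "z' \<notin> img D (warcs w)" using z(2) fr by (auto simp: frontier_def)
      then have "winding_number (walk_curve D (wcod w) +++ reversepath (walk_curve D (wdom w))) z' =
          - (wind D (wdom w) z' - wind D (wcod w) z')" using K(3)[of z'] un by simp
      then have "winding_number (walk_curve D (wcod w) +++ reversepath (walk_curve D (wdom w))) z' = 1"
        unfolding word_wind_face[OF w \<phi>] by simp
      ultimately show ?thesis by simp
    qed
    show "cw_boundary D H (exterior D H) p q"
      unfolding pq cw_boundary_def Let_def
    proof (intro conjI)
      show "wcod w \<noteq> []" "wdom w \<noteq> []" by (rule ne')+
      show "\<exists>x y. pre_digraph.trail H x (wcod w) y \<and> pre_digraph.trail H x (wdom w) y" using tr by metis
      show "path_image (walk_curve D (wcod w) +++ reversepath (walk_curve D (wdom w))) = frontier (exterior D H)"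
        unfolding K(1) fr un ..
      show "\<forall>z\<in>exterior D H. \<forall>z'. z' \<notin> closure (exterior D H) \<longrightarrow>
        winding_number (walk_curve D (wcod w) +++ reversepath (walk_curve D (wdom w))) z =
        winding_number (walk_curve D (wcod w) +++ reversepath (walk_curve D (wdom w))) z' - 1" using wn by simp
    qed
  next
    assume cw: "cw_boundary D H (exterior D H) p q"
    have c: "p \<noteq> []" "q \<noteq> []" "\<exists>u v. pre_digraph.trail H u p v \<and> pre_digraph.trail H u q v"
      "path_image (walk_curve D p +++ reversepath (walk_curve D q)) = frontier (exterior D H)"
      "\<forall>z\<in>exterior D H. \<forall>z'. z' \<notin> closure (exterior D H) \<longrightarrow>
        winding_number (walk_curve D p +++ reversepath (walk_curve D q)) z =
        winding_number (walk_curve D p +++ reversepath (walk_curve D q)) z' - 1"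
      using cw unfolding cw_boundary_def Let_def by simp_all
    obtain u v where tr: "pre_digraph.trail H u p v" "pre_digraph.trail H u q v" using c(3) by metis
    have uG: "u \<in> insert x (tail G ` warcs w \<union> head G ` warcs w)" and pw: "set p \<subseteq> warcs w" "set q \<subseteq> warcs w"
      and cas: "cas u p v" "cas u q v"
      using tr unfolding H_def pre_digraph.trail_def gr_awalk by simp_all
    have "u \<in> verts G" using uG S word_ends(1)[OF w] by auto
    then have wk: "awalk u p v" "awalk u q v" using cas pw S by (simp_all add: awalk_def)
    note K = walk_facts[OF wk c(1,2)]
    have "img D (set p \<union> set q) = img D (warcs w)" using c(4) unfolding K(1) fr .
    moreover have "set p \<union> set q \<subseteq> arcs G" using pw S by auto
    ultimately have un: "set p \<union> set q = warcs w" using img_eq_iff[OF _ S] by metis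
    obtain r where r: "awalk x r u" using word_vert_walks[OF w uG] by metis
    have "hd (adom a) \<in> set p \<union> set q" using hx(1) un by simp
    then have "rk u \<le> rk x"
      using walk_tail_rank(1)[OF wk(1), of "hd (adom a)"] walk_tail_rank(1)[OF wk(2), of "hd (adom a)"] hx(2) by auto
    then have ux: "x = u" using rk_eq_walk[OF r] by simp
    have vH: "v \<in> insert x (tail G ` warcs w \<union> head G ` warcs w)"
      using head_last[OF wk(1) c(1)] last_in_set[OF c(1)] pw(1) by auto
    obtain t where t: "awalk v t y" using word_vert_walks[OF w vH] by metis
    have "last (wdom w) \<in> set p \<union> set q" using un word_sides_arcs[of w] last_in_set[OF ne'(1)] by auto
    then have "rk y \<le> rk v"
      using walk_tail_rank(2)[OF wk(1), of "last (wdom w)"] walk_tail_rank(2)[OF wk(2), of "last (wdom w)"]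
        head_last[OF word_walks(1)[OF w] ne'(1)] by auto
    then have vy: "v = y" using rk_eq_walk[OF t] by simp
    obtain z0 where z0: "z0 \<in> exterior D H" using unb unfolding F(1) by metis
    have "wind D q z - wind D p z = - 1" if \<phi>: "\<phi> \<in> wfaces w" "z \<in> \<phi>" for \<phi> z
    proof -
      have zR: "z \<notin> img D (warcs w)" "z \<in> region x w" "\<phi> \<in> interior_faces D G"
        using word_faces_support[OF w, of z] \<phi> img_in_support[OF S, of z] word_faces[OF w] by (auto simp: region_def)
      have "\<phi> \<inter> - region x w = {}" using \<phi>(1) by (auto simp: region_def)
      then have "\<phi> \<inter> closure (- region x w) = {}"
        using open_Int_closure_eq_empty[OF face_open[OF zR(3)]] by simp
      then have "z \<notin> closure (exterior D H)" using \<phi>(2) F(1) by auto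
      then have "winding_number (walk_curve D p +++ reversepath (walk_curve D q)) z0 =
        winding_number (walk_curve D p +++ reversepath (walk_curve D q)) z - 1" using c(5) z0 by simp
      moreover have "winding_number (walk_curve D p +++ reversepath (walk_curve D q)) z = wind D p z - wind D q z"
        using K(3)[of z] zR(1) un by simp
      moreover have "z0 \<notin> img D (warcs w)" using z0 F(1) by (auto simp: region_def)
      then have "winding_number (walk_curve D p +++ reversepath (walk_curve D q)) z0 = 0"
        using K(3)[of z0] K(2)[OF un z0] un by simp
      ultimately show ?thesis by (simp add: algebra_simps)
    qed
    then have "q = wdom w \<and> p = wcod w"
      using word_sides[OF w, of q p] wk un ux vy by (simp add: Un_commute)
    then show "p = wcod w \<and> q = wdom w" by simp
  qed
qed

text \<open>
  The region of a chain has a connected complement, so the exterior is the only face of the chain that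
  is not a face of \<open>G\<close>, and all arcs are incident with it. For the inner faces the bounding bigons of \<open>G\<close>
  still serve.
\<close>

theorem word_glob:
  assumes w: "word x w y"
  defines "H \<equiv> gr G x (warcs w)"
  shows "glob D H" "globular D H" "graph_dom D H = wdom w" "graph_cod D H = wcod w"
proof -
  note F = word_graph_faces[OF w, folded H_def] and S = word_arcs[OF w] and g = word_gr[OF w, folded H_def]
  have sup: "support D H = insert (vpt D x) (img D (warcs w))"
    unfolding H_def by (rule word_graph_support[OF w])
  have arcsH: "arcs H = warcs w" by (simp add: H_def)
  have tn: "trivial_graph H \<longleftrightarrow> w = []"
    using wdom_ne[OF w] by (cases "w = []") (auto simp: H_def trivial_graph_def)
  show gl: "globular D H"
  proof (cases "w = []")
    case True
    then show ?thesis using tn by (simp add: globular_def)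
  next
    case False
    have V: "vpt D v \<in> support D H" if "v \<in> verts H" for v using that by (simp add: support_def)
    have "\<exists>!s. is_source H s" "\<exists>!t. is_target H t" by (simp_all add: g(2,3))
    moreover have "x \<in> verts H" by (simp add: H_def)
    ultimately have "st_graph D H"
      unfolding st_graph_def F(3) g(4,5) using plane_subgraph[OF g(1)] V[of x] V[of y] g(6) by simp
    moreover have "globular_face D H \<phi>" if \<phi>: "\<phi> \<in> faces D H" for \<phi>
    proof (cases "\<phi> = exterior D H")
      case True
      then show ?thesis unfolding globular_face_def H_def using word_graph_exterior[OF w False] by auto
    next
      case f: False
      then have \<phi>w: "\<phi> \<in> wfaces w" using \<phi> F(1,2) by auto
      then have i: "\<phi> \<in> interior_faces D G" using word_faces[OF w] by auto
      note b = bigonD[OF face_bigon(1)[OF i]]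
      have sub: "set (fdom \<phi>) \<union> set (fcod \<phi>) \<subseteq> warcs w"
        using \<phi>w by (force simp: wfaces_def warcs_def aarcs_def)
      have "pre_digraph.trail H (face_src D G \<phi>) (fdom \<phi>) (face_tgt D G \<phi>)"
        "pre_digraph.trail H (face_src D G \<phi>) (fcod \<phi>) (face_tgt D G \<phi>)"
        unfolding H_def using word_trails[OF w b(3) _ b(1)] word_trails[OF w b(4) _ b(2)] sub by auto
      then have "\<exists>x y. pre_digraph.trail H x (fdom \<phi>) y \<and> pre_digraph.trail H x (fcod \<phi>) y" by metis
      then have "cw_boundary D H \<phi> (fdom \<phi>) (fcod \<phi>)"
        using face_boundary[OF i] unfolding cw_boundary_def by simp
      then show ?thesis unfolding globular_face_def by metis
    qed
    ultimately show ?thesis by (simp add: globular_def)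
  qed
  show "glob D H"
    unfolding glob_def F(3) sup arcsH using gl by (auto simp: img_def)
  have "graph_dom D H = wdom w \<and> graph_cod D H = wcod w"
  proof (cases "w = []")
    case True
    then show ?thesis using tn by (simp add: graph_dom_def graph_cod_def)
  next
    case False
    have "(THE (p, q). cw_boundary D H (exterior D H) p q) = (wcod w, wdom w)"
    proof (rule the_equality)
      show "case (wcod w, wdom w) of (p, q) \<Rightarrow> cw_boundary D H (exterior D H) p q"
        using word_graph_exterior[OF w False, folded H_def] by simp
    next
      fix r assume "case r of (p, q) \<Rightarrow> cw_boundary D H (exterior D H) p q"
      then have "cw_boundary D H (exterior D H) (fst r) (snd r)" by (simp add: case_prod_beta)
      then show "r = (wcod w, wdom w)"
        using word_graph_exterior[OF w False, folded H_def] by (simp add: prod_eq_iff)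
    qed
    then show ?thesis using False tn by (simp add: graph_dom_def graph_cod_def face_dom_def face_cod_def)
  qed
  then show "graph_dom D H = wdom w" "graph_cod D H = wcod w" by simp_all
qed

end

section \<open>The minimal complete pasting diagram\<close>

text \<open>
  Let a list \<open>v\<close> be spelled out as the word \<open>concat (map g v)\<close>. If a prefix \<open>L\<close> of this word meets
  none of the syllables but single letters, it is spelled by these, and so is a prefix of \<open>v\<close> itself.
\<close>

lemma prefix_of_singletons:
  assumes "concat (map g v) = L @ R"
    "\<And>u. u \<in> set v \<Longrightarrow> (\<exists>e. u = i e \<and> g u = [e]) \<or> g u \<noteq> [] \<and> set (g u) \<inter> set L = {}"
  shows "\<exists>v'. v = map i L @ v' \<and> concat (map g v') = R"
  using assms
proof (induction L arbitrary: v)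
  case Nil
  then show ?case by simp
next
  case (Cons e L)
  show ?case
  proof (cases v)
    case Nil
    then show ?thesis using Cons.prems(1) by simp
  next
    case (Cons u v1)
    note v = this
    have u: "g u @ concat (map g v1) = e # L @ R" using Cons.prems(1) v by simp
    have "\<not> (g u \<noteq> [] \<and> set (g u) \<inter> set (e # L) = {})"
    proof
      assume n: "g u \<noteq> [] \<and> set (g u) \<inter> set (e # L) = {}"
      then have "hd (g u) = e" using u by (metis hd_append2 list.sel(1))
      moreover have "hd (g u) \<in> set (g u)" using n by simp
      ultimately show False using n by auto
    qed
    then obtain e' where e': "u = i e'" "g u = [e']" using Cons.prems(2)[of u] v by auto
    then have eq: "e' = e" "concat (map g v1) = L @ R" using u by simp_all
    have "(\<exists>e. u = i e \<and> g u = [e]) \<or> g u \<noteq> [] \<and> set (g u) \<inter> set L = {}" if "u \<in> set v1" for u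
      using Cons.prems(2)[of u] that v by auto
    then obtain v' where "v1 = map i L @ v'" "concat (map g v') = R" using Cons.IH[OF eq(2)] by auto
    then show ?thesis using v e'(1) eq(1) by auto
  qed
qed

context ranked_globular_digraph
begin

lemma path_graph_gr: "awalk x p y \<Longrightarrow> path_graph G x p = gr G x (set p)"
  using set_awalk_verts[of x p y] by (simp add: path_graph_def gr_def)

lemma face_graph_gr:
  assumes "\<phi> \<in> interior_faces D G"
  shows "face_graph D G \<phi> = gr G (face_src D G \<phi>) (warcs [Fc \<phi>])"
proof -
  note b = bigonD[OF face_bigon(1)[OF assms]]
  show ?thesis unfolding face_graph_def path_graph_gr[OF b(3)] path_graph_gr[OF b(4)]
    by (auto simp: Digraph_Component.union_def gr_def)
qed

lemma union_gr:
  assumes "word x v y" "word y w z"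
  shows "union (gr G x (warcs v)) (gr G y (warcs w)) = gr G x (warcs (v @ w))"
  using word_gr(6)[OF assms(1)] by (auto simp: Digraph_Component.union_def gr_def)

definition chains :: "('v, 'e) pre_digraph set" where
  "chains = {gr G x (warcs w) |x w y. word x w y}"

lemma chainsI: "word x w y \<Longrightarrow> gr G x (warcs w) \<in> chains"
  unfolding chains_def by auto

text \<open>
  Thinness is inherited from the chain, and the source and the target of the subgraph supply the
  walks through each of its arcs, so that \<open>word_of_thin\<close> applies.
\<close>

lemma globular_subgraph_of_chain:
  assumes w: "word x w y" and sub: "subgraph K (gr G x (warcs w))" and gl: "globular D K"
  shows "\<exists>u w' v. word u w' v \<and> K = gr G u (warcs w') \<and> wfaces w' \<subseteq> wfaces w"
proof -
  have K: "verts K \<subseteq> verts (gr G x (warcs w))" "arcs K \<subseteq> warcs w" "tail K = tail G" "head K = head G" "wf_digraph K"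
    using sub by (auto simp: subgraph_def compatible_def)
  have V: "verts K \<subseteq> verts G" "arcs K \<subseteq> arcs G"
    using K(1,2) word_arcs[OF w] word_gr(1)[OF w] unfolding subgraph_def by (meson order_trans)+
  have Keq: "K = gr G u S" if "verts K = insert u (tail G ` S \<union> head G ` S)" "arcs K = S" for u S
    using that K(3,4) by (cases K) (simp add: gr_def)
  have cas: "pre_digraph.cas K = cas" by (rule compatible_cas) (simp add: compatible_def K)
  have wk: "awalk u p v \<and> set p \<subseteq> arcs K" if "pre_digraph.awalk K u p v" for u p v
    using that V by (auto simp: pre_digraph.awalk_def cas)
  show ?thesis
  proof (cases "trivial_graph K")
    case True
    then obtain u where u: "verts K = {u}" "arcs K = {}" unfolding trivial_graph_def by auto
    then have "K = gr G u (warcs [])" by (intro Keq) auto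
    moreover have "word u [] u" using u V by simp
    ultimately show ?thesis by (intro exI[of _ u] exI[of _ "[]"]) simp
  next
    case False
    then have st: "st_graph D K" using gl by (simp add: globular_def)
    then obtain s t where s: "is_source K s" and t: "is_target K t" unfolding st_graph_def by auto
    have sw: "\<exists>p. awalk s p v \<and> set p \<subseteq> arcs K" if "v \<in> verts K" for v
      using s that wk unfolding is_source_def by metis
    have tw: "\<exists>p. awalk v p t \<and> set p \<subseteq> arcs K" if "v \<in> verts K" for v
      using t that wk unfolding is_target_def by metis
    have sK: "s \<in> verts K" and tK: "t \<in> verts K" using s t by (simp_all add: is_source_def is_target_def)
    have ends: "tail G e \<in> verts K" "head G e \<in> verts K" if "e \<in> arcs K" for e
      using wf_digraph.tail_in_verts[OF K(5) that] wf_digraph.head_in_verts[OF K(5) that] K(3,4) by simp_all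
    have "thin (wfaces w) (arcs K)" using thin_mono[OF word_thin[OF w] K(2)] .
    moreover obtain p where "awalk s p t" "set p \<subseteq> arcs K" using sw[OF tK] by auto
    moreover have "(\<exists>p. awalk s p (tail G e) \<and> set p \<subseteq> arcs K) \<and> (\<exists>p. awalk (head G e) p t \<and> set p \<subseteq> arcs K)"
      if "e \<in> arcs K" for e using sw[OF ends(1)[OF that]] tw[OF ends(2)[OF that]] by (rule conjI)
    ultimately obtain w' where w': "word s w' t" "warcs w' = arcs K" "wfaces w' \<subseteq> wfaces w"
      using word_of_thin[OF _ word_faces[OF w] V(2)] by metis
    have "verts K = insert s (tail G ` arcs K \<union> head G ` arcs K)"
    proof
      show "insert s (tail G ` arcs K \<union> head G ` arcs K) \<subseteq> verts K" using sK ends by auto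
      show "verts K \<subseteq> insert s (tail G ` arcs K \<union> head G ` arcs K)"
      proof
        fix v assume "v \<in> verts K"
        then obtain p where p: "awalk s p v" "set p \<subseteq> arcs K" using sw by metis
        show "v \<in> insert s (tail G ` arcs K \<union> head G ` arcs K)"
        proof (cases "p = []")
          case True
          then show ?thesis using p(1) by (simp add: awalk_Nil_iff)
        next
          case False
          then have "v = head G (last p)" "last p \<in> arcs K"
            using head_last[OF p(1) False] p(2) last_in_set[OF False] by auto
          then show ?thesis by simp
        qed
      qed
    qed
    then have "K = gr G s (warcs w')" using w'(2) by (intro Keq) simp_all
    then show ?thesis using w'(1,3) by metis
  qed
qed

lemma chains_complete:
  assumes "globular D G" shows "complete_pasting_diagram D G chains"
proof -
  have 1: "subgraph H G \<and> globular D H" if H: "H \<in> chains" for H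
  proof -
    obtain x w y where "H = gr G x (warcs w)" "word x w y" using H unfolding chains_def by auto
    then show ?thesis using word_gr(1)[of x w y] word_glob(2)[of x w y] by simp
  qed
  have 2: "K \<in> chains" if K: "H \<in> chains" "subgraph K H" "globular D K" for H K
  proof -
    obtain x w y where H: "H = gr G x (warcs w)" "word x w y" using K(1) unfolding chains_def by auto
    obtain u w' v where "word u w' v" "K = gr G u (warcs w')"
      using globular_subgraph_of_chain[OF H(2) _ K(3)] K(2) H(1) by metis
    then show ?thesis using chainsI by simp
  qed
  have 3: "paths_of G \<subseteq> chains"
  proof
    fix H assume "H \<in> paths_of G"
    then obtain x p y where H: "H = path_graph G x p" "awalk x p y" unfolding paths_of_def by auto
    have "gr G x (warcs (map Ed p)) \<in> chains" by (rule chainsI[OF word_of_walk[OF H(2)]])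
    then show "H \<in> chains" using path_graph_gr[OF H(2)] H(1) by simp
  qed
  have 4: "union H K \<in> chains" if HK: "H \<in> chains" "K \<in> chains" "tgt H = src K" for H K
  proof -
    obtain x v y where H: "H = gr G x (warcs v)" "word x v y" using HK(1) unfolding chains_def by auto
    obtain y' w z where K: "K = gr G y' (warcs w)" "word y' w z" using HK(2) unfolding chains_def by auto
    have y: "y' = y" using HK(3) word_gr(5)[OF H(2)] word_gr(4)[OF K(2)] H(1) K(1) by simp
    have wv: "word y w z" using K(2) y by simp
    show ?thesis using union_gr[OF H(2) wv] chainsI[OF word_append[OF H(2) wv]] H(1) K(1) y by simp
  qed
  show ?thesis
    unfolding complete_pasting_diagram_def pasting_diagram_def using assms 1 2 3 4 by auto
qed

lemma chains_minimal:
  assumes S: "complete_pasting_diagram D G S" "S_min D G \<subseteq> S" and w: "word x w y"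
  shows "gr G x (warcs w) \<in> S"
  using w
proof (induction w arbitrary: x)
  case Nil
  then have "awalk x [] x" by (auto simp: awalk_Nil_iff)
  then have "path_graph G x [] \<in> paths_of G" unfolding paths_of_def by auto
  then have "path_graph G x [] \<in> S" using S(2) unfolding S_min_def by auto
  then show ?case using path_graph_gr[OF \<open>awalk x [] x\<close>] by simp
next
  case (Cons a w)
  then have a: "atom_in a" "asrc a = x" and w: "word (atgt a) w y" by auto
  have wa: "word x [a] (atgt a)" using a atom_walks(7)[OF a(1)] by simp
  have "gr G x (warcs [a]) \<in> S_min D G"
  proof (cases a)
    case (Ed e)
    then have "awalk x [e] (head G e)" using a by (auto simp: arc_implies_awalk)
    then have "path_graph G x [e] \<in> paths_of G" unfolding paths_of_def by blast
    moreover have "path_graph G x [e] = gr G x (warcs [a])"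
      using path_graph_gr[OF \<open>awalk x [e] (head G e)\<close>] Ed by simp
    ultimately show ?thesis by (simp add: S_min_def)
  next
    case (Fc \<phi>)
    then have i: "\<phi> \<in> interior_faces D G" and x: "face_src D G \<phi> = x" using a by auto
    have "face_graph D G \<phi> \<in> S_min D G" unfolding S_min_def using i by (intro UnI1 imageI)
    then show ?thesis unfolding face_graph_gr[OF i] x Fc .
  qed
  then have 1: "gr G x (warcs [a]) \<in> S" using S(2) by auto
  have 2: "gr G (atgt a) (warcs w) \<in> S" by (rule Cons.IH[OF w])
  have "tgt (gr G x (warcs [a])) = src (gr G (atgt a) (warcs w))"
    unfolding word_gr(5)[OF wa] word_gr(4)[OF w] ..
  then have "union (gr G x (warcs [a])) (gr G (atgt a) (warcs w)) \<in> S"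
    using S(1) 1 2 unfolding complete_pasting_diagram_def by blast
  then show ?case unfolding union_gr[OF wa w] by simp
qed

text \<open>
  Chains contain all faces and paths, and the closure properties make them a complete pasting diagram;
  conversely each chain is an iterated join of faces and single arcs.
\<close>

theorem S_min_complete_chains:
  assumes "globular D G" shows "S_min_complete D G = chains"
proof
  have "S_min D G \<subseteq> chains"
  proof
    fix H assume "H \<in> S_min D G"
    then have "H \<in> paths_of G \<or> (\<exists>\<phi>\<in>interior_faces D G. H = face_graph D G \<phi>)" unfolding S_min_def by auto
    then show "H \<in> chains"
    proof
      assume "H \<in> paths_of G"
      then show ?thesis using chains_complete[OF assms]
        unfolding complete_pasting_diagram_def pasting_diagram_def by auto
    next
      assume "\<exists>\<phi>\<in>interior_faces D G. H = face_graph D G \<phi>"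
      then obtain \<phi> where \<phi>: "\<phi> \<in> interior_faces D G" "H = face_graph D G \<phi>" by auto
      have "word (face_src D G \<phi>) [Fc \<phi>] (face_tgt D G \<phi>)"
        using \<phi>(1) atom_walks(7)[of "Fc \<phi>"] by simp
      then show ?thesis using chainsI face_graph_gr[OF \<phi>(1)] \<phi>(2) by metis
    qed
  qed
  then show "S_min_complete D G \<subseteq> chains"
    unfolding S_min_complete_def using chains_complete[OF assms] by auto
  show "chains \<subseteq> S_min_complete D G"
    unfolding S_min_complete_def chains_def using chains_minimal by auto
qed

section \<open>Simplices of the restricted nerves\<close>

lemma between_arcs: "e \<in> arcs (between G x y) \<longleftrightarrow> (\<exists>p. awalk x p y \<and> e \<in> set p)"
  and between_verts: "v \<in> verts (between G x y) \<longleftrightarrow> (\<exists>p. awalk x p y \<and> v \<in> set (awalk_verts x p))"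
  and between_ends [simp]: "tail (between G x y) = tail G" "head (between G x y) = head G"
  by (auto simp: between_def)

lemma between_awalk:
  "pre_digraph.awalk (between G x y) u p v \<longleftrightarrow>
    u \<in> verts (between G x y) \<and> set p \<subseteq> arcs (between G x y) \<and> cas u p v"
proof -
  have "pre_digraph.cas (between G x y) = cas" by (rule compatible_cas) (simp add: compatible_def)
  then show ?thesis by (simp add: pre_digraph.awalk_def)
qed

lemma between_subset: "verts (between G x y) \<subseteq> verts G" "arcs (between G x y) \<subseteq> arcs G"
proof -
  show "verts (between G x y) \<subseteq> verts G" unfolding subset_iff between_verts by (meson awalkE' subsetD)
  show "arcs (between G x y) \<subseteq> arcs G" unfolding subset_iff between_arcs by (meson awalk_arcs subsetD)
qed

lemma between_subgraph: "subgraph (between G x y) G" "wf_digraph (between G x y)"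
proof -
  have "tail G e \<in> verts (between G x y)" "head G e \<in> verts (between G x y)" if e: "e \<in> arcs (between G x y)" for e
  proof -
    obtain p where p: "awalk x p y" "e \<in> set p" using e unfolding between_arcs by auto
    then have "tail G e \<in> set (awalk_verts x p)" "head G e \<in> set (awalk_verts x p)"
      using set_awalk_verts[OF p(1)] by auto
    then show "tail G e \<in> verts (between G x y)" "head G e \<in> verts (between G x y)"
      using p(1) unfolding between_verts by auto
  qed
  then show wf: "wf_digraph (between G x y)" by (simp add: wf_digraph_def)
  show "subgraph (between G x y) G"
    using wf between_subset wf_digraph_axioms by (simp add: subgraph_def compatible_def)
qed

lemma between_st:
  assumes p0: "awalk x p0 y"
  shows "src (between G x y) = x" "tgt (between G x y) = y" "x \<in> verts (between G x y)" "y \<in> verts (between G x y)"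
proof -
  let ?B = "between G x y"
  show xB: "x \<in> verts ?B" and yB: "y \<in> verts ?B"
    unfolding between_verts using p0 hd_in_awalk_verts(1)[OF p0] last_in_awalk_verts[OF p0] by auto
  have wk: "(\<exists>q. pre_digraph.awalk ?B x q v) \<and> (\<exists>r. pre_digraph.awalk ?B v r y) \<and> rk x \<le> rk v \<and> rk v \<le> rk y"
    if v: "v \<in> verts ?B" for v
  proof -
    obtain p where p: "awalk x p y" "v \<in> set (awalk_verts x p)" using v unfolding between_verts by auto
    obtain q r where qr: "p = q @ r" "awalk x q v" "awalk v r y" using awalk_decomp[OF p] by metis
    have "set p \<subseteq> arcs ?B" unfolding subset_iff between_arcs using p(1) by blast
    then have "set q \<subseteq> arcs ?B" "set r \<subseteq> arcs ?B" by (simp_all add: qr(1))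
    then have "pre_digraph.awalk ?B x q v" "pre_digraph.awalk ?B v r y"
      unfolding between_awalk using xB v qr(2,3) by (simp_all add: awalk_def)
    then show ?thesis using rk_walk[OF qr(2)] rk_walk[OF qr(3)] by auto
  qed
  have up: "u = v" if "pre_digraph.awalk ?B u p v" "rk v \<le> rk u" for u p v
  proof -
    have "u \<in> verts ?B" "set p \<subseteq> arcs ?B" "cas u p v" using that(1) unfolding between_awalk by simp_all
    then have "awalk u p v" using between_subset[of x y] by (auto simp: awalk_def)
    then show ?thesis using rk_eq_walk[of u p v] that(2) by simp
  qed
  have S: "is_source ?B s \<longleftrightarrow> s = x" for s
  proof
    assume s: "is_source ?B s"
    then obtain p where "pre_digraph.awalk ?B s p x" unfolding is_source_def using xB by auto
    moreover have "s \<in> verts ?B" using s by (simp add: is_source_def)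
    ultimately show "s = x" using up[of s p x] wk[of s] by simp
  next
    assume "s = x" then show "is_source ?B s" unfolding is_source_def using wk xB by simp
  qed
  have T: "is_target ?B t \<longleftrightarrow> t = y" for t
  proof
    assume t: "is_target ?B t"
    then obtain p where "pre_digraph.awalk ?B y p t" unfolding is_target_def using yB by auto
    moreover have "t \<in> verts ?B" using t by (simp add: is_target_def)
    ultimately show "t = y" using up[of y p t] wk[of t] by simp
  next
    assume "t = y" then show "is_target ?B t" unfolding is_target_def using wk yB by simp
  qed
  show "src ?B = x" "tgt ?B = y" unfolding src_def tgt_def S T by simp_all
qed

lemma between_st_paths: "p \<in> st_paths (between G x y) \<longleftrightarrow> awalk x p y"
proof
  let ?B = "between G x y"
  assume "p \<in> st_paths ?B"
  then have p: "src ?B \<in> verts ?B" "set p \<subseteq> arcs ?B" "cas (src ?B) p (tgt ?B)"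
    unfolding st_paths_def mem_Collect_eq between_awalk by simp_all
  then obtain p0 where p0: "awalk x p0 y" unfolding between_verts by auto
  show "awalk x p y" using p between_subset[of x y] unfolding between_st[OF p0] by (auto simp: awalk_def)
next
  assume p: "awalk x p y"
  have "set p \<subseteq> arcs (between G x y)" unfolding subset_iff between_arcs using p by auto
  then show "p \<in> st_paths (between G x y)"
    unfolding st_paths_def mem_Collect_eq between_awalk between_st[OF p]
    using between_st(3)[OF p] p by (simp add: awalk_def)
qed

text \<open>Parallel simplices: each piece \<open>a\<close> of a chain runs along its domain in the first \<open>j\<close> rows and
  along its codomain in the later rows.\<close>

definition ev :: "(('e, complex set) atom \<times> nat) list \<Rightarrow> nat \<Rightarrow> 'e list" where
  "ev nw i = concat (map (\<lambda>(a, j). if i < j then adom a else acod a) nw)"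

definition evs :: "nat \<Rightarrow> (('e, complex set) atom \<times> nat) list \<Rightarrow> 'e list list" where
  "evs n nw = map (ev nw) [0..<Suc n]"

definition nword :: "'v \<Rightarrow> (('e, complex set) atom \<times> nat) list \<Rightarrow> 'v \<Rightarrow> bool" where
  "nword x nw y \<longleftrightarrow> word x (map fst nw) y"

text \<open>
  Excluded are faces that show the same side in all rows, since the arcs of that side would give the
  same rows. For arcs the row index is irrelevant and fixed to be \<open>0\<close>.
\<close>

definition normal :: "nat \<Rightarrow> (('e, complex set) atom \<times> nat) list \<Rightarrow> bool" where
  "normal n nw \<longleftrightarrow> (\<forall>(a, j)\<in>set nw. case a of Ed e \<Rightarrow> j = 0 | Fc \<phi> \<Rightarrow> 1 \<le> j \<and> j \<le> n)"

abbreviation edges :: "'e list \<Rightarrow> (('e, complex set) atom \<times> nat) list" where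
  "edges \<equiv> map (\<lambda>e. (Ed e, 0))"

lemma ev_simps [simp]: "ev [] i = []" "ev ((a, j) # nw) i = (if i < j then adom a else acod a) @ ev nw i"
  "ev (nv @ nw) i = ev nv i @ ev nw i" "ev (edges p) i = p"
  by (simp_all add: ev_def) (induction p; simp add: ev_def)

lemma nword_simps [simp]: "nword x [] y \<longleftrightarrow> x = y \<and> x \<in> verts G"
  "nword x ((a, j) # nw) y \<longleftrightarrow> atom_in a \<and> asrc a = x \<and> nword (atgt a) nw y"
  by (simp_all add: nword_def)

lemma normal_simps [simp]: "normal n []" "normal n ((Ed e, j) # nw) \<longleftrightarrow> j = 0 \<and> normal n nw"
  "normal n ((Fc \<phi>, j) # nw) \<longleftrightarrow> 1 \<le> j \<and> j \<le> n \<and> normal n nw"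
  "normal n (nv @ nw) \<longleftrightarrow> normal n nv \<and> normal n nw" "normal n (edges p)"
  by (auto simp: normal_def)

lemma length_evs [simp]: "length (evs n nw) = Suc n" by (simp add: evs_def)
lemma nth_evs: "i \<le> n \<Longrightarrow> evs n nw ! i = ev nw i" by (simp add: evs_def del: upt_Suc)

lemma nword_append: "nword x nv y \<Longrightarrow> nword y nw z \<Longrightarrow> nword x (nv @ nw) z"
  using word_append by (simp add: nword_def)

lemma nword_edges: "awalk x p y \<Longrightarrow> nword x (edges p) y"
  using word_of_walk[of x p y] by (simp add: nword_def comp_def)

lemma word_append_split: "word x (v @ w) y \<Longrightarrow> \<exists>z. word x v z \<and> word z w y"
proof (induction v arbitrary: x)
  case Nil
  then show ?case using word_ends(1)[of x w y] by auto
next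
  case (Cons a v)
  then show ?case by auto
qed

lemma word_edges_split:
  assumes "word x (map Ed p @ w) y" "awalk x p z" shows "word z w y"
proof -
  obtain z' where z': "word x (map Ed p) z'" "word z' w y" using word_append_split[OF assms(1)] by auto
  have "awalk x p z'" using word_walks(1)[OF z'(1)] by simp
  then have "z' = z" using awalk_suffix[of x p "[]" z' z] assms(2) by (simp add: awalk_Nil_iff)
  then show ?thesis using z'(2) by simp
qed

lemma ev_walk: "nword x nw y \<Longrightarrow> awalk x (ev nw i) y"
proof (induction nw arbitrary: x)
  case Nil
  then show ?case by (auto simp: awalk_Nil_iff)
next
  case (Cons aj nw)
  obtain a j where aj: "aj = (a, j)" by (cases aj)
  then have a: "atom_in a" "asrc a = x" "nword (atgt a) nw y" using Cons.prems by auto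
  have "awalk x (if i < j then adom a else acod a) (atgt a)" using atom_walks(1,2)[OF a(1)] a(2) by simp
  from awalk_appendI[OF this Cons.IH[OF a(3)]] show ?case unfolding aj ev_simps .
qed

text \<open>The chain of the pieces that change sides between the rows \<open>i\<close> and \<open>i + 1\<close>.\<close>

definition step :: "(('e, complex set) atom \<times> nat) list \<Rightarrow> nat \<Rightarrow> ('e, complex set) atom list" where
  "step nw i = concat (map (\<lambda>(a, j). if j = Suc i then [a] else map Ed (if i < j then adom a else acod a)) nw)"

text \<open>
  These chains witness the relations between consecutive rows.
\<close>

lemma step_word:
  assumes "nword x nw y"
  shows "word x (step nw i) y" "wdom (step nw i) = ev nw i" "wcod (step nw i) = ev nw (Suc i)"
    "warcs (step nw i) \<subseteq> warcs (map fst nw)"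
proof -
  have "word x (step nw i) y \<and> wdom (step nw i) = ev nw i \<and> wcod (step nw i) = ev nw (Suc i) \<and>
    warcs (step nw i) \<subseteq> warcs (map fst nw)" using assms
  proof (induction nw arbitrary: x)
    case Nil
    then show ?case by (auto simp: step_def)
  next
    case (Cons aj nw)
    obtain a j where aj: "aj = (a, j)" by (cases aj)
    then have a: "atom_in a" "asrc a = x" "nword (atgt a) nw y" using Cons.prems by auto
    note IH = Cons.IH[OF a(3)]
    let ?s = "if j = Suc i then [a] else map Ed (if i < j then adom a else acod a)"
    have st: "step ((a, j) # nw) i = ?s @ step nw i" by (simp add: step_def)
    have ws: "word x ?s (atgt a)"
      using a(1,2) atom_walks(7)[OF a(1)] word_of_walk[OF atom_walks(1)[OF a(1)]] word_of_walk[OF atom_walks(2)[OF a(1)]]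
      by simp
    have sides: "wdom ?s = (if i < j then adom a else acod a)" "wcod ?s = (if Suc i < j then adom a else acod a)"
      "warcs ?s \<subseteq> aarcs a" by (auto simp: aarcs_def)
    obtain t where t: "step ((a, j) # nw) i = t @ step nw i" "word x t (atgt a)"
      "wdom t = (if i < j then adom a else acod a)" "wcod t = (if Suc i < j then adom a else acod a)"
      "warcs t \<subseteq> aarcs a" using st ws sides by metis
    have "word x (t @ step nw i) y" using word_append[OF t(2)] IH by blast
    then show ?case using IH t(5) unfolding aj t(1) w_simps ev_simps t(3,4) by auto
  qed
  then show "word x (step nw i) y" "wdom (step nw i) = ev nw i" "wcod (step nw i) = ev nw (Suc i)"
    "warcs (step nw i) \<subseteq> warcs (map fst nw)" by simp_all
qed

lemma word_faces_disjoint: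
  assumes "word x w y" "\<phi> \<in> wfaces w" "\<psi> \<in> wfaces w"
  shows "set (fcod \<phi>) \<inter> set (fdom \<psi>) = {}"
  using assms
proof (induction w arbitrary: x)
  case Nil
  then show ?case by simp
next
  case (Cons a w)
  then have a: "atom_in a" "asrc a = x" and w: "word (atgt a) w y" by auto
  have disj: "aarcs a \<inter> warcs w = {}"
    using atom_tail_rank(3)[OF a(1)] word_tail_rank(1)[OF w] by fastforce
  have sub: "set (fcod \<xi>) \<union> set (fdom \<xi>) \<subseteq> warcs w" if "\<xi> \<in> wfaces w" for \<xi>
    using that by (force simp: wfaces_def warcs_def aarcs_def)
  have cases: "\<xi> \<in> wfaces w \<or> a = Fc \<xi>" if "\<xi> \<in> wfaces (a # w)" for \<xi> using that by (auto simp: wfaces_def)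
  have A: "set (fcod \<xi>) \<union> set (fdom \<xi>) \<subseteq> aarcs a" if "a = Fc \<xi>" for \<xi> using that by auto
  consider "\<phi> \<in> wfaces w" "\<psi> \<in> wfaces w" | "a = Fc \<phi>" "a = Fc \<psi>" | "\<phi> \<in> wfaces w" "a = Fc \<psi>" | "a = Fc \<phi>" "\<psi> \<in> wfaces w"
    using cases[OF Cons.prems(2)] cases[OF Cons.prems(3)] by metis
  then show ?case
  proof cases
    case 1 then show ?thesis by (rule Cons.IH[OF w])
  next
    case 2
    then have "\<psi> = \<phi>" "\<phi> \<in> interior_faces D G" using a(1) by auto
    then show ?thesis using bigonD(8)[OF face_bigon(1)] by (simp add: Int_commute)
  next
    case 3 then show ?thesis using sub[of \<phi>] A[of \<psi>] disj by auto
  next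
    case 4 then show ?thesis using sub[of \<psi>] A[of \<phi>] disj by auto
  qed
qed

text \<open>
  A row of flips can be appended to a parallel simplex, provided that no face of the new row uses an
  arc of the codomain of an earlier face: then the earlier faces and the new ones are separate
  pieces.
\<close>

lemma append_row:
  assumes "nword x nw y" "normal n nw" "word x s y" "wdom s = ev nw n"
    "wfaces (map fst nw) \<subseteq> \<Psi>" "wfaces s \<subseteq> \<Psi>"
    and \<Psi>: "\<forall>\<phi>\<in>\<Psi>. \<forall>\<psi>\<in>\<Psi>. set (fcod \<phi>) \<inter> set (fdom \<psi>) = {}"
  shows "\<exists>nw'. nword x nw' y \<and> normal (Suc n) nw' \<and> (\<forall>i\<le>n. ev nw' i = ev nw i) \<and>
    ev nw' (Suc n) = wcod s \<and> wfaces (map fst nw') \<subseteq> \<Psi>"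
  using assms(1-6)
proof (induction "length nw + length s" arbitrary: x nw s rule: less_induct)
  case less
  note nw = less.prems(1,2) and s = less.prems(3) and ds = less.prems(4) and \<Psi>1 = less.prems(5) and \<Psi>2 = less.prems(6)
  show ?case
  proof (cases s)
    case Nil
    then have "x = y" using s by simp
    have "nw = []"
    proof (rule ccontr)
      assume "nw \<noteq> []"
      have "wdom (map fst nw) \<noteq> []"
        using wdom_ne[of x "map fst nw" y] nw(1) \<open>nw \<noteq> []\<close> by (simp add: nword_def)
      moreover have "awalk x (wdom (map fst nw)) y" using word_walks(1) nw(1) by (simp add: nword_def)
      ultimately show False using \<open>x = y\<close> closed_walk_Nil[of x "wdom (map fst nw)"] by simp
    qed
    then show ?thesis using nw Nil by (intro exI[of _ "[]"]) auto
  next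
    case (Cons b s1)
    note sb = this
    have b: "atom_in b" "asrc b = x" "word (atgt b) s1 y" using s sb by auto
    show ?thesis
    proof (cases b)
      case (Fc \<psi>)
      then have \<psi>: "\<psi> \<in> interior_faces D G" "\<psi> \<in> \<Psi>" using b(1) \<Psi>2 sb by auto
      \<comment> \<open>the last row runs along the domain of the new face \<open>\<psi>\<close> by single arcs of \<open>nw\<close>, as these arcs are not on the codomain of an earlier face\<close>
      have "concat (map (\<lambda>(a, j). if n < j then adom a else acod a) nw) = fdom \<psi> @ wdom s1"
        using ds sb Fc by (simp add: ev_def)
      moreover have "(\<exists>e. u = (Ed e, 0) \<and> (\<lambda>(a, j). if n < j then adom a else acod a) u = [e]) \<or>
          (\<lambda>(a, j). if n < j then adom a else acod a) u \<noteq> [] \<and>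
          set ((\<lambda>(a, j). if n < j then adom a else acod a) u) \<inter> set (fdom \<psi>) = {}"
        if u: "u \<in> set nw" for u
      proof -
        obtain a j where aj: "u = (a, j)" by (cases u)
        show ?thesis
        proof (cases a)
          case (Ed e)
          then show ?thesis using nw(2) u aj by (auto simp: normal_def)
        next
          case (Fc \<phi>)
          then have "j \<le> n" using nw(2) u aj by (auto simp: normal_def)
          moreover have "\<phi> \<in> wfaces (map fst nw)" using u aj Fc by (force simp: wfaces_def)
          then have \<phi>: "\<phi> \<in> \<Psi>" "\<phi> \<in> interior_faces D G"
            using \<Psi>1 word_faces[OF nw(1)[unfolded nword_def]] by auto
          ultimately show ?thesis using \<Psi> \<psi>(2) aj Fc bigonD(2)[OF face_bigon(1)[OF \<phi>(2)]] by simp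
        qed
      qed
      ultimately obtain nw2 where nw2: "nw = edges (fdom \<psi>) @ nw2"
        "concat (map (\<lambda>(a, j). if n < j then adom a else acod a) nw2) = wdom s1"
        using prefix_of_singletons[of "\<lambda>(a, j). if n < j then adom a else acod a" nw "fdom \<psi>" "wdom s1" "\<lambda>e. (Ed e, 0)"]
        by auto
      have dw: "awalk x (fdom \<psi>) (atgt b)" using atom_walks(1)[OF b(1)] b(2) Fc by simp
      have "word x (map Ed (fdom \<psi>) @ map fst nw2) y" using nw(1) nw2(1) by (simp add: nword_def comp_def)
      then have "nword (atgt b) nw2 y" using word_edges_split[OF _ dw] by (simp add: nword_def)
      moreover have "normal n nw2" using nw(2) nw2(1) by simp
      moreover have "wdom s1 = ev nw2 n" using nw2(2) by (simp add: ev_def)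
      moreover have "wfaces (map fst nw2) \<subseteq> \<Psi>" "wfaces s1 \<subseteq> \<Psi>" using \<Psi>1 \<Psi>2 nw2(1) sb Fc by auto
      moreover have "length nw2 + length s1 < length nw + length s" using nw2(1) sb by simp
      ultimately obtain nw' where IH: "nword (atgt b) nw' y" "normal (Suc n) nw'" "\<forall>i\<le>n. ev nw' i = ev nw2 i"
        "ev nw' (Suc n) = wcod s1" "wfaces (map fst nw') \<subseteq> \<Psi>"
        using less.hyps[of nw2 s1 "atgt b"] b(3) by auto
      then show ?thesis using b(1,2) Fc \<psi>(2) nw2(1) sb
        by (intro exI[of _ "(b, Suc n) # nw'"]) simp
    next
      case (Ed f)
      note bf = this
      have "nw \<noteq> []"
      proof
        assume "nw = []"
        then show False using ds sb bf by simp
      qed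
      then obtain a j nw1 where nwa: "nw = (a, j) # nw1" by (cases nw) auto
      have a: "atom_in a" "asrc a = x" "nword (atgt a) nw1 y" using nw(1) nwa by auto
      show ?thesis
      proof (cases a)
        case (Ed e)
        then have j: "j = 0" "normal n nw1" using nw(2) nwa by auto
        have ef: "f = e" "wdom s1 = ev nw1 n" using ds sb bf nwa Ed j(1) by auto
        have "wfaces (map fst nw1) \<subseteq> \<Psi>" "wfaces s1 \<subseteq> \<Psi>" using \<Psi>1 \<Psi>2 nwa sb bf Ed by auto
        moreover have "word (atgt a) s1 y" using b(3) bf Ed ef(1) by simp
        moreover have "length nw1 + length s1 < length nw + length s" using nwa sb by simp
        ultimately obtain nw' where IH: "nword (atgt a) nw' y" "normal (Suc n) nw'" "\<forall>i\<le>n. ev nw' i = ev nw1 i"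
          "ev nw' (Suc n) = wcod s1" "wfaces (map fst nw') \<subseteq> \<Psi>"
          using less.hyps[of nw1 s1 "atgt a"] a(3) j(2) ef(2) by auto
        then show ?thesis using a(1,2) Ed nwa sb bf ef(1) j(1)
          by (intro exI[of _ "(a, 0) # nw'"]) simp
      next
        case (Fc \<phi>)
        then have j: "1 \<le> j" "j \<le> n" "normal n nw1" and \<phi>: "\<phi> \<in> interior_faces D G" "\<phi> \<in> \<Psi>"
          using nw(2) nwa a(1) \<Psi>1 by auto
        \<comment> \<open>likewise the new row runs along the codomain of the earlier face \<open>\<phi>\<close> by single arcs of \<open>s\<close>\<close>
        have "concat (map adom s) = fcod \<phi> @ ev nw1 n" using ds nwa Fc j(2) by (simp add: wdom_def)
        moreover have "(\<exists>e. u = Ed e \<and> adom u = [e]) \<or> adom u \<noteq> [] \<and> set (adom u) \<inter> set (fcod \<phi>) = {}"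
          if u: "u \<in> set s" for u
        proof (cases u)
          case (Ed e)
          then show ?thesis by simp
        next
          case (Fc \<psi>)
          then have w\<psi>: "\<psi> \<in> wfaces s" using u by (simp add: wfaces_def)
          have \<psi>: "\<psi> \<in> \<Psi>" using w\<psi> \<Psi>2 by (rule rev_subsetD)
          have i\<psi>: "\<psi> \<in> interior_faces D G" using w\<psi> word_faces[OF s] by (rule rev_subsetD)
          have "set (fcod \<phi>) \<inter> set (fdom \<psi>) = {}" using \<Psi> \<phi>(2) \<psi> by simp
          then show ?thesis using Fc bigonD(1)[OF face_bigon(1)[OF i\<psi>]] by (simp add: Int_commute)
        qed
        ultimately obtain s2 where s2: "s = map Ed (fcod \<phi>) @ s2" "concat (map adom s2) = ev nw1 n"
          using prefix_of_singletons[of adom s "fcod \<phi>" "ev nw1 n" Ed] by auto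
        have dw: "awalk x (fcod \<phi>) (atgt a)" using atom_walks(2)[OF a(1)] a(2) Fc by simp
        have "word x (map Ed (fcod \<phi>) @ s2) y" using s s2(1) by simp
        then have "word (atgt a) s2 y" using word_edges_split[OF _ dw] by simp
        moreover have "wdom s2 = ev nw1 n" using s2(2) by (simp add: wdom_def)
        moreover have "wfaces (map fst nw1) \<subseteq> \<Psi>" "wfaces s2 \<subseteq> \<Psi>" using \<Psi>1 \<Psi>2 s2(1) nwa Fc by auto
        moreover have "length nw1 + length s2 < length nw + length s" using s2(1) nwa by simp
        ultimately obtain nw' where IH: "nword (atgt a) nw' y" "normal (Suc n) nw'" "\<forall>i\<le>n. ev nw' i = ev nw1 i"
          "ev nw' (Suc n) = wcod s2" "wfaces (map fst nw') \<subseteq> \<Psi>"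
          using less.hyps[of nw1 s2 "atgt a"] a(3) j(3) by auto
        then show ?thesis using a(1,2) Fc nwa s2(1) j \<phi>(2)
          by (intro exI[of _ "(a, j) # nw'"]) simp
      qed
    qed
  qed
qed

lemma rows_nword:
  assumes "length ps = Suc n" "\<forall>p\<in>set ps. awalk x p y"
    "\<forall>i<n. \<exists>s. word x s y \<and> wdom s = ps ! i \<and> wcod s = ps ! Suc i \<and> wfaces s \<subseteq> \<Psi>"
    and \<Psi>: "\<forall>\<phi>\<in>\<Psi>. \<forall>\<psi>\<in>\<Psi>. set (fcod \<phi>) \<inter> set (fdom \<psi>) = {}"
  shows "\<exists>nw. nword x nw y \<and> normal n nw \<and> ps = evs n nw \<and> wfaces (map fst nw) \<subseteq> \<Psi>"
  using assms(1-3)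
proof (induction n arbitrary: ps)
  case 0
  then obtain p where p: "ps = [p]" "awalk x p y" by (cases ps) auto
  then show ?case using nword_edges[OF p(2)]
    by (intro exI[of _ "edges p"]) (simp add: evs_def comp_def)
next
  case (Suc n)
  define qs where "qs = butlast ps"
  have lps: "length qs = Suc n" using Suc.prems(1) by (simp add: qs_def)
  have nth: "ps ! i = qs ! i" if "i \<le> n" for i
    using that Suc.prems(1) by (simp add: qs_def nth_butlast)
  have "\<forall>p\<in>set qs. awalk x p y" using Suc.prems(2) by (auto simp: qs_def dest: in_set_butlastD)
  moreover have "\<forall>i<n. \<exists>s. word x s y \<and> wdom s = qs ! i \<and> wcod s = qs ! Suc i \<and> wfaces s \<subseteq> \<Psi>"
  proof (intro allI impI)
    fix i assume i: "i < n"
    have "\<exists>s. word x s y \<and> wdom s = ps ! i \<and> wcod s = ps ! Suc i \<and> wfaces s \<subseteq> \<Psi>"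
      using Suc.prems(3) i by simp
    then show "\<exists>s. word x s y \<and> wdom s = qs ! i \<and> wcod s = qs ! Suc i \<and> wfaces s \<subseteq> \<Psi>"
      using nth[of i] nth[of "Suc i"] i by simp
  qed
  ultimately obtain nw where nw: "nword x nw y" "normal n nw" "qs = evs n nw" "wfaces (map fst nw) \<subseteq> \<Psi>"
    using Suc.IH[OF lps] by auto
  obtain s where s: "word x s y" "wdom s = ps ! n" "wcod s = ps ! Suc n" "wfaces s \<subseteq> \<Psi>" using Suc.prems(3) by auto
  have "wdom s = ev nw n" using s(2) nth[of n] nw(3) nth_evs[of n n nw] by simp
  then obtain nw' where nw': "nword x nw' y" "normal (Suc n) nw'" "\<forall>i\<le>n. ev nw' i = ev nw i"
    "ev nw' (Suc n) = wcod s" "wfaces (map fst nw') \<subseteq> \<Psi>"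
    using append_row[OF nw(1,2) s(1) _ nw(4) s(4) \<Psi>] by auto
  have "ps = evs (Suc n) nw'"
  proof (rule nth_equalityI)
    show "length ps = length (evs (Suc n) nw')" using Suc.prems(1) by simp
    fix i assume "i < length ps"
    then have "i \<le> n \<or> i = Suc n" using Suc.prems(1) by auto
    then show "ps ! i = evs (Suc n) nw' ! i"
      using nth[of i] nw(3) nth_evs[of i n nw] nth_evs[of i "Suc n" nw'] nw'(3,4) s(3) by auto
  qed
  then show ?case using nw' by auto
qed

text \<open>
  For a simplex of the nerve, all witnesses are subgraphs of one chain \<open>A\<close>; each is a chain itself, whose
  faces are among those of \<open>A\<close>. As distinct pieces of \<open>A\<close> have no arc in common, the rows can be appended
  one by one by \<open>append_row\<close>. Conversely the pieces that switch in a given step are the faces of a witness.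
\<close>

theorem nerve_nwords:
  "ps \<in> nerve D (between G x y) (restricted G chains x y) n \<longleftrightarrow> (\<exists>nw. nword x nw y \<and> normal n nw \<and> ps = evs n nw)"
  "nword x nw y \<Longrightarrow> evs n nw \<in> nerve D (between G x y) (restricted G chains x y) n"
proof -
  let ?B = "between G x y"
  show simplices: "evs n nw \<in> nerve D ?B (restricted G chains x y) n" if nw: "nword x nw y" for nw
  proof -
    let ?w = "map fst nw"
    let ?A = "gr G x (warcs ?w)"
    have w: "word x ?w y" using nw by (simp add: nword_def)
    have p0: "awalk x (wdom ?w) y" by (rule word_walks(1)[OF w])
    note st = between_st[OF p0]
    have arcB: "warcs ?w \<subseteq> arcs ?B"
    proof
      fix e assume e: "e \<in> warcs ?w"
      then have eG: "e \<in> arcs G" using word_arcs[OF w] by auto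
      obtain p where p: "awalk x p (tail G e)" using word_vert_walks[OF w, of "tail G e"] e by auto
      obtain q where q: "awalk (head G e) q y" using word_vert_walks[OF w, of "head G e"] e by auto
      have "awalk (tail G e) (e # q) y" using q eG by (simp add: awalk_Cons_iff)
      from awalk_appendI[OF p this] show "e \<in> arcs ?B" unfolding between_arcs by (metis in_set_conv_decomp)
    qed
    have subB: "subgraph (gr G x S) ?B" if S: "S \<subseteq> warcs ?w" for S
    proof -
      have SB: "S \<subseteq> arcs ?B" using S arcB by simp
      have "tail G e \<in> verts ?B" "head G e \<in> verts ?B" if "e \<in> S" for e
        using wf_digraph.tail_in_verts[OF between_subgraph(2), of e x y] wf_digraph.head_in_verts[OF between_subgraph(2), of e x y] that SB by auto
      then have "verts (gr G x S) \<subseteq> verts ?B" using st(3) by auto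
      moreover have "wf_digraph (gr G x S)" by (simp add: wf_digraph_def)
      ultimately show ?thesis using SB between_subgraph(2) by (simp add: subgraph_def compatible_def)
    qed
    have A: "?A \<in> restricted G chains x y" unfolding restricted_def using chainsI[OF w] subB[of "warcs ?w"] by simp
    have wit: "witness D ?B (gr G x (warcs (step nw i))) (ev nw i) (ev nw (Suc i)) \<and>
        subgraph (gr G x (warcs (step nw i))) ?A" for i
    proof -
      note sw = step_word[OF nw, of i]
      note g = word_glob[OF sw(1)] and h = word_gr[OF sw(1)]
      have "pre_digraph.awalk ?B x [] x" "pre_digraph.awalk ?B y [] y" unfolding between_awalk using st(3,4) by simp_all
      then have "witness D ?B (gr G x (warcs (step nw i))) (ev nw i) (ev nw (Suc i))"
        unfolding witness_def st(1,2) h(4,5) g(3,4) sw(2,3) using subB[OF sw(4)] g(1)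
        by (intro conjI exI[of _ "[]"]) simp_all
      moreover have "subgraph (gr G x (warcs (step nw i))) ?A"
        using sw(4) by (auto simp: subgraph_def compatible_def wf_digraph_def)
      ultimately show ?thesis by simp
    qed
    have mem: "ev nw i \<in> st_paths ?B" for i unfolding between_st_paths by (rule ev_walk[OF nw])
    have gn: "evs n nw \<in> graph_nerve D ?B n"
    proof -
      have "set (evs n nw) \<subseteq> st_paths ?B" using mem by (auto simp: evs_def)
      moreover have "path_le D ?B (evs n nw ! i) (evs n nw ! Suc i)" if "Suc i < length (evs n nw)" for i
        using that mem wit[of i] nth_evs[of i n nw] nth_evs[of "Suc i" n nw] unfolding path_le_def by auto
      ultimately show ?thesis unfolding graph_nerve_def successively_conv_nth by simp
    qed
    moreover have "\<forall>i<n. \<exists>\<gamma>. subgraph \<gamma> ?A \<and> witness D ?B \<gamma> (evs n nw ! i) (evs n nw ! Suc i)"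
    proof (intro allI impI)
      fix i assume "i < n"
      then show "\<exists>\<gamma>. subgraph \<gamma> ?A \<and> witness D ?B \<gamma> (evs n nw ! i) (evs n nw ! Suc i)"
        using wit[of i] nth_evs[of i n nw] nth_evs[of "Suc i" n nw] by auto
    qed
    ultimately show ?thesis unfolding nerve_def using A by auto
  qed
  show "ps \<in> nerve D ?B (restricted G chains x y) n \<longleftrightarrow> (\<exists>nw. nword x nw y \<and> normal n nw \<and> ps = evs n nw)"
  proof
    assume "ps \<in> nerve D ?B (restricted G chains x y) n"
    then obtain A where ps: "ps \<in> graph_nerve D ?B n" and A: "A \<in> restricted G chains x y"
      and wit: "\<forall>i<n. \<exists>\<gamma>. subgraph \<gamma> A \<and> witness D ?B \<gamma> (ps ! i) (ps ! Suc i)" unfolding nerve_def by auto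
    have len: "length ps = Suc n" and wk: "\<forall>p\<in>set ps. awalk x p y"
      using ps between_st_paths unfolding graph_nerve_def by auto
    obtain u w v where w: "A = gr G u (warcs w)" "word u w v" using A unfolding restricted_def chains_def by auto
    have "ps ! 0 \<in> set ps" using len by (intro nth_mem) simp
    then have p0: "awalk x (ps ! 0) y" using wk by simp
    note st = between_st[OF p0]
    have BG: "awalk a p b" if "pre_digraph.awalk ?B a p b" for a p b
      using that between_subset[of x y] unfolding between_awalk by (auto simp: awalk_def)
    have rows: "\<forall>i<n. \<exists>s. word x s y \<and> wdom s = ps ! i \<and> wcod s = ps ! Suc i \<and> wfaces s \<subseteq> wfaces w"
    proof (intro allI impI)
      fix i assume "i < n"
      then obtain \<gamma> where \<gamma>: "subgraph \<gamma> A" "witness D ?B \<gamma> (ps ! i) (ps ! Suc i)" using wit by auto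
      then have "globular D \<gamma>" by (simp add: witness_def glob_def)
      then obtain u' w' v' where w': "word u' w' v'" "\<gamma> = gr G u' (warcs w')" "wfaces w' \<subseteq> wfaces w"
        using globular_subgraph_of_chain[OF w(2), of \<gamma>] \<gamma>(1) w(1) by auto
      note g = word_glob[OF w'(1)] and h = word_gr[OF w'(1)]
      obtain a b where ab: "pre_digraph.awalk ?B x a u'" "pre_digraph.awalk ?B v' b y"
        "ps ! i = a @ wdom w' @ b" "ps ! Suc i = a @ wcod w' @ b"
        using \<gamma>(2) unfolding witness_def w'(2) st(1,2) h(4,5) g(3,4) by auto
      have "word x (map Ed a @ w' @ map Ed b) y"
        using word_append[OF word_of_walk[OF BG[OF ab(1)]] word_append[OF w'(1) word_of_walk[OF BG[OF ab(2)]]]] .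
      then show "\<exists>s. word x s y \<and> wdom s = ps ! i \<and> wcod s = ps ! Suc i \<and> wfaces s \<subseteq> wfaces w"
        using ab(3,4) w'(3) by (intro exI[of _ "map Ed a @ w' @ map Ed b"]) simp
    qed
    have "\<forall>\<phi>\<in>wfaces w. \<forall>\<psi>\<in>wfaces w. set (fcod \<phi>) \<inter> set (fdom \<psi>) = {}"
      using word_faces_disjoint[OF w(2)] by simp
    from rows_nword[OF len wk rows this] show "\<exists>nw. nword x nw y \<and> normal n nw \<and> ps = evs n nw" by auto
  next
    assume "\<exists>nw. nword x nw y \<and> normal n nw \<and> ps = evs n nw"
    then show "ps \<in> nerve D ?B (restricted G chains x y) n" using simplices by auto
  qed
qed

text \<open>
  The face with the smaller target has both its sides as prefixes of the sides of the other one. The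
  latter sides meet in their end points only, so the targets agree.
\<close>

lemma faces_with_common_start:
  assumes \<phi>: "\<phi> \<in> interior_faces D G" and \<psi>: "\<psi> \<in> interior_faces D G"
    and s: "face_src D G \<phi> = face_src D G \<psi>" and le: "rk (face_tgt D G \<phi>) \<le> rk (face_tgt D G \<psi>)"
    and d: "fdom \<phi> @ r1 = fdom \<psi> @ r2" and c: "fcod \<phi> @ r3 = fcod \<psi> @ r4"
  shows "\<phi> = \<psi>"
proof -
  note b = bigonD[OF face_bigon(1)[OF \<phi>]] and b' = bigonD[OF face_bigon(1)[OF \<psi>]]
  have pre: "\<exists>r. q = p @ r \<and> awalk (face_tgt D G \<phi>) r (face_tgt D G \<psi>)"
    if pq: "p @ r1 = q @ r2" "awalk (face_src D G \<psi>) p (face_tgt D G \<phi>)" "awalk (face_src D G \<psi>) q (face_tgt D G \<psi>)"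
    for p q r1 r2 :: "'e list"
  proof -
    obtain us where "p = q @ us \<and> us @ r1 = r2 \<or> p @ us = q \<and> r1 = us @ r2"
      using pq(1) unfolding append_eq_append_conv2 by metis
    then show ?thesis
    proof
      assume *: "p = q @ us \<and> us @ r1 = r2"
      have "awalk (face_tgt D G \<psi>) us (face_tgt D G \<phi>)"
        using awalk_suffix[of _ q us _ "face_tgt D G \<psi>"] pq(2,3) * by metis
      from rk_eq_walk[OF this le] have "us = []" "face_tgt D G \<psi> = face_tgt D G \<phi>" by simp_all
      then show ?thesis using * pq(2) by (intro exI[of _ "[]"]) (simp add: awalk_Nil_iff awalk_last_in_verts[OF pq(2)])
    next
      assume *: "p @ us = q \<and> r1 = us @ r2"
      then have "awalk (face_tgt D G \<phi>) us (face_tgt D G \<psi>)" using awalk_suffix[of _ p us] pq(2,3) by metis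
      then show ?thesis using * by auto
    qed
  qed
  obtain r where r: "fdom \<psi> = fdom \<phi> @ r" "awalk (face_tgt D G \<phi>) r (face_tgt D G \<psi>)"
    using pre[OF d] b(3) b'(3) s by auto
  obtain r' where r': "fcod \<psi> = fcod \<phi> @ r'" "awalk (face_tgt D G \<phi>) r' (face_tgt D G \<psi>)"
    using pre[OF c] b(4) b'(4) s by auto
  have "face_tgt D G \<phi> \<in> head G ` set (fdom \<psi>)" "face_tgt D G \<phi> \<in> head G ` set (fcod \<psi>)"
    using head_last[OF b(3,1)] head_last[OF b(4,2)] last_in_set[OF b(1)] last_in_set[OF b(2)] r(1) r'(1)
    by (metis UnI1 imageI set_append)+
  then have "face_tgt D G \<phi> \<in> set (awalk_verts (face_src D G \<psi>) (fdom \<psi>)) \<inter> set (awalk_verts (face_src D G \<psi>) (fcod \<psi>))"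
    using set_awalk_verts[OF b'(3)] set_awalk_verts[OF b'(4)] by simp
  then have "face_tgt D G \<phi> = face_src D G \<psi> \<or> face_tgt D G \<phi> = face_tgt D G \<psi>" unfolding b'(9) by simp
  then have t: "face_tgt D G \<phi> = face_tgt D G \<psi>" using b(7) s by auto
  have "r = []" "r' = []" using closed_walk_Nil[of "face_tgt D G \<psi>"] r(2) r'(2) unfolding t by simp_all
  then show ?thesis using face_determined_by_arcs[OF \<phi> \<psi>] r(1) r'(1) by simp
qed

text \<open>
  By induction it suffices to recognise the first piece. A face of a normal word shows its domain in
  row \<open>0\<close> and its codomain in row \<open>n\<close>, which start with different arcs; so it is distinguished from an arc
  and is determined by these two rows, and \<open>j\<close> is the first row with the other first arc.
\<close>

theorem nword_unique:
  assumes "nword x nw y" "normal n nw" "nword x nw' z" "normal n nw'" "\<forall>i\<le>n. ev nw i = ev nw' i"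
  shows "nw = nw'"
  using assms
proof (induction nw arbitrary: x nw')
  case Nil
  show ?case
  proof (cases nw')
    case (Cons c nw1)
    then have "ev nw' 0 \<noteq> []"
      using Nil.prems(3) atom_walks(3,4) by (cases c) auto
    then show ?thesis using Nil.prems(5) by auto
  qed simp
next
  case (Cons c nw1)
  obtain a j where c: "c = (a, j)" by (cases c)
  have a: "atom_in a" "asrc a = x" "nword (atgt a) nw1 y" using Cons.prems(1) c by auto
  have "ev (c # nw1) 0 \<noteq> []" using c atom_walks(3,4)[OF a(1)] by simp
  then have "ev nw' 0 \<noteq> []" using Cons.prems(5) by auto
  then obtain b k nw2 where nw': "nw' = (b, k) # nw2" by (cases nw') auto
  have b: "atom_in b" "asrc b = x" "nword (atgt b) nw2 z" using Cons.prems(3) nw' by auto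
  have E: "(if i < j then adom a else acod a) @ ev nw1 i = (if i < k then adom b else acod b) @ ev nw2 i" if "i \<le> n" for i
    using Cons.prems(5) that c nw' by simp
  have hdF: "hd (fdom \<phi>) \<noteq> hd (fcod \<phi>)" if "\<phi> \<in> interior_faces D G" for \<phi>
    using bigonD(1,2,8)[OF face_bigon(1)[OF that]] hd_in_set by (metis disjoint_iff)
  have hdE: "hd (if i < j then adom a else acod a) = hd (if i < k then adom b else acod b)" if "i \<le> n" for i
    using arg_cong[OF E[OF that], of hd] atom_walks(3,4)[OF a(1)] atom_walks(3,4)[OF b(1)] by (simp add: hd_append split: if_splits)
  have mixed: False if m: "\<phi> \<in> interior_faces D G" "1 \<le> m" "m \<le> n"
    "\<forall>i\<le>n. hd (if i < m then fdom \<phi> else fcod \<phi>) = e" for \<phi> m and e :: 'e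
    using m(4)[rule_format, of 0] m(4)[rule_format, of n] m(2,3) hdF[OF m(1)] by simp
  have "a = b \<and> j = k"
  proof (cases a)
    case (Ed e)
    then have j: "j = 0" using Cons.prems(2) c by simp
    show ?thesis
    proof (cases b)
      case (Ed f)
      then have "k = 0" using Cons.prems(4) nw' by simp
      then show ?thesis using hdE[of 0] Ed \<open>a = Ed e\<close> j by simp
    next
      case (Fc \<psi>)
      then have k: "1 \<le> k" "k \<le> n" "\<psi> \<in> interior_faces D G" using Cons.prems(4) nw' b(1) by auto
      have "\<forall>i\<le>n. hd (if i < k then fdom \<psi> else fcod \<psi>) = e"
      proof (intro allI impI)
        fix i assume "i \<le> n"
        then show "hd (if i < k then fdom \<psi> else fcod \<psi>) = e"
          using hdE[of i] Fc \<open>a = Ed e\<close> by (simp split: if_splits)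
      qed
      from mixed[OF k(3,1,2) this] show ?thesis by (rule FalseE)
    qed
  next
    case (Fc \<phi>)
    then have j: "1 \<le> j" "j \<le> n" "\<phi> \<in> interior_faces D G" using Cons.prems(2) c a(1) by auto
    show ?thesis
    proof (cases b)
      case (Ed f)
      have "\<forall>i\<le>n. hd (if i < j then fdom \<phi> else fcod \<phi>) = f"
      proof (intro allI impI)
        fix i assume "i \<le> n"
        then show "hd (if i < j then fdom \<phi> else fcod \<phi>) = f"
          using hdE[of i] Ed \<open>a = Fc \<phi>\<close> by (simp split: if_splits)
      qed
      from mixed[OF j(3,1,2) this] show ?thesis by (rule FalseE)
    next
      case bF: (Fc \<psi>)
      then have k: "1 \<le> k" "k \<le> n" "\<psi> \<in> interior_faces D G" using Cons.prems(4) nw' b(1) by auto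
      have d: "fdom \<phi> @ ev nw1 0 = fdom \<psi> @ ev nw2 0" using E[of 0] j k Fc bF by simp
      have cc: "fcod \<phi> @ ev nw1 n = fcod \<psi> @ ev nw2 n" using E[of n] j k Fc bF by simp
      have s: "face_src D G \<phi> = face_src D G \<psi>" using a(2) b(2) Fc bF by simp
      have eq: "\<phi> = \<psi>"
      proof (cases "rk (face_tgt D G \<phi>) \<le> rk (face_tgt D G \<psi>)")
        case True
        show ?thesis by (rule faces_with_common_start[OF j(3) k(3) s True d cc])
      next
        case False
        then have "rk (face_tgt D G \<psi>) \<le> rk (face_tgt D G \<phi>)" by simp
        from faces_with_common_start[OF k(3) j(3) s[symmetric] this d[symmetric] cc[symmetric]]
        show ?thesis by simp
      qed
      have "\<not> j < k" using hdE[of j] j(2) hdF[OF j(3)] Fc bF eq by auto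
      moreover have "\<not> k < j" using hdE[of k] k(2) hdF[OF j(3)] Fc bF eq by auto
      ultimately show ?thesis using Fc bF eq by simp
    qed
  qed
  then have ab: "b = a" "k = j" by simp_all
  have "\<forall>i\<le>n. ev nw1 i = ev nw2 i" using E ab by simp
  moreover have "normal n nw1" "normal n nw2" using Cons.prems(2,4) c nw' by (auto simp: normal_def)
  ultimately have "nw1 = nw2" using Cons.IH[OF a(3)] b(3) ab(1) by simp
  then show ?case using c nw' ab by simp
qed

end

section \<open>Simplices pulled back from points and edges\<close>

lemma simplicial_setD:
  assumes "simplicial_set X"
  shows "a \<in> Simp X (Suc n) \<Longrightarrow> i \<le> Suc n \<Longrightarrow> Face X (Suc n) i a \<in> Simp X n"
    "a \<in> Simp X n \<Longrightarrow> i \<le> n \<Longrightarrow> Degen X n i a \<in> Simp X (Suc n)"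
    "a \<in> Simp X n \<Longrightarrow> j \<le> n \<Longrightarrow> i \<le> Suc n \<Longrightarrow> Face X (Suc n) i (Degen X n j a) =
          (if i < j then Degen X (n - 1) (j - 1) (Face X n i a)
           else if i \<le> Suc j then a else Degen X (n - 1) j (Face X n (i - 1) a))"
    "a \<in> Simp X n \<Longrightarrow> j \<le> n \<Longrightarrow> i \<le> j \<Longrightarrow>
        Degen X (Suc n) i (Degen X n j a) = Degen X (Suc n) (Suc j) (Degen X n i a)"
proof -
  note X = assms[unfolded simplicial_set_def]
  show "a \<in> Simp X (Suc n) \<Longrightarrow> i \<le> Suc n \<Longrightarrow> Face X (Suc n) i a \<in> Simp X n"
    by (rule X[THEN conjunct1, rule_format])
  show "a \<in> Simp X n \<Longrightarrow> i \<le> n \<Longrightarrow> Degen X n i a \<in> Simp X (Suc n)"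
    by (rule X[THEN conjunct2, THEN conjunct1, rule_format])
  show "a \<in> Simp X n \<Longrightarrow> j \<le> n \<Longrightarrow> i \<le> Suc n \<Longrightarrow> Face X (Suc n) i (Degen X n j a) =
          (if i < j then Degen X (n - 1) (j - 1) (Face X n i a)
           else if i \<le> Suc j then a else Degen X (n - 1) j (Face X n (i - 1) a))"
    by (rule X[THEN conjunct2, THEN conjunct2, THEN conjunct2, THEN conjunct1, rule_format])
  show "a \<in> Simp X n \<Longrightarrow> j \<le> n \<Longrightarrow> i \<le> j \<Longrightarrow>
        Degen X (Suc n) i (Degen X n j a) = Degen X (Suc n) (Suc j) (Degen X n i a)"
    by (rule X[THEN conjunct2, THEN conjunct2, THEN conjunct2, THEN conjunct2, rule_format])
qed

text \<open>
  The pullback of a \<open>0\<close>-simplex along \<open>[n] \<rightarrow> [0]\<close>.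
\<close>

primrec cst :: "'s sset \<Rightarrow> nat \<Rightarrow> 's \<Rightarrow> 's" where
  "cst X 0 v = v"
| "cst X (Suc n) v = Degen X n 0 (cst X n v)"

text \<open>
  The pullback of a \<open>1\<close>-simplex along the monotone map \<open>[n] \<rightarrow> [1]\<close> that takes the value \<open>0\<close> on the first \<open>j\<close>
  elements. The recursion writes this map as a composite of degeneracies of the identity of \<open>[1]\<close>, or,
  for \<open>n = 0\<close>, as a face map.
\<close>

fun par :: "'s sset \<Rightarrow> nat \<Rightarrow> nat \<Rightarrow> 's \<Rightarrow> 's" where
  "par X 0 j a = (if j = 0 then Face X 1 0 a else Face X 1 1 a)"
| "par X (Suc n) j a = (if n = 0 \<and> j = 1 then a
     else if j \<le> n then Degen X n n (par X n j a) else Degen X n 0 (par X n (j - 1) a))"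

declare par.simps(2) [simp del]

lemma idn_cst: "idn C x n = cst (Hom C x x) n (Idn C x)"
  by (induction n) simp_all

context
  fixes X :: "'s sset" assumes X: "simplicial_set X"
begin

lemma cst_in: "v \<in> Simp X 0 \<Longrightarrow> cst X n v \<in> Simp X n"
  by (induction n) (simp_all add: simplicial_setD(2)[OF X])

lemma cst_degen: "v \<in> Simp X 0 \<Longrightarrow> i \<le> n \<Longrightarrow> Degen X n i (cst X n v) = cst X (Suc n) v"
proof (induction n arbitrary: i)
  case (Suc n)
  show ?case
  proof (cases i)
    case (Suc k)
    then have "Degen X (Suc n) 0 (Degen X n k (cst X n v)) = Degen X (Suc n) (Suc k) (Degen X n 0 (cst X n v))"
      using Suc.prems simplicial_setD(4)[OF X cst_in[OF Suc.prems(1)], of k n 0] by simp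
    then show ?thesis using Suc.IH[of k] Suc.prems Suc by simp
  qed simp
qed simp

lemma cst_face: "v \<in> Simp X 0 \<Longrightarrow> i \<le> Suc n \<Longrightarrow> Face X (Suc n) i (cst X (Suc n) v) = cst X n v"
proof (induction n arbitrary: i)
  case 0
  then show ?case using simplicial_setD(3)[OF X, of v 0 0 i] by simp
next
  case (Suc n)
  have "Face X (Suc (Suc n)) i (cst X (Suc (Suc n)) v) = (if i \<le> Suc 0 then cst X (Suc n) v
    else Degen X n 0 (Face X (Suc n) (i - 1) (cst X (Suc n) v)))"
    using simplicial_setD(3)[OF X cst_in[OF Suc.prems(1), of "Suc n"], of 0 i] Suc.prems by simp
  then show ?case using Suc.IH[of "i - 1"] Suc.prems by simp
qed

lemma par_in: "a \<in> Simp X 1 \<Longrightarrow> j \<le> Suc n \<Longrightarrow> par X n j a \<in> Simp X n"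
proof (induction n arbitrary: j)
  case 0
  then show ?case using simplicial_setD(1)[OF X, of a 0] by simp
next
  case (Suc n)
  then show ?case using simplicial_setD(2)[OF X] by (simp add: par.simps(2))
qed

text \<open>
  In terms of monotone maps: precomposing with \<open>\<sigma>\<^sub>i\<close> doubles the element \<open>i\<close>, which increases the number of
  zeros if \<open>i < j\<close>. The proof has to commute \<open>s\<^sub>i\<close> past the last degeneracy in the definition.
\<close>

lemma par_degen:
  "a \<in> Simp X 1 \<Longrightarrow> i \<le> n \<Longrightarrow> j \<le> Suc n \<Longrightarrow>
    Degen X n i (par X n j a) = par X (Suc n) (if i < j then Suc j else j) a"
proof (induction n arbitrary: i j)
  case 0
  then have "j = 0 \<or> j = 1" by auto
  then show ?case using 0 by (auto simp: par.simps)
next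
  case (Suc m)
  note a = Suc.prems(1) and i = Suc.prems(2) and j = Suc.prems(3)
  consider "m = 0" "j = 1" | "\<not> (m = 0 \<and> j = 1)" "j \<le> m" | "\<not> (m = 0 \<and> j = 1)" "j \<ge> Suc m" by linarith
  then show ?case
  proof cases
    case 1
    then have "i = 0 \<or> i = 1" using i by auto
    moreover have "par X 1 1 a = a" by (simp add: par.simps)
    moreover have "par X (Suc 1) 2 a = Degen X 1 0 (par X 1 1 a)" "par X (Suc 1) 1 a = Degen X 1 1 (par X 1 1 a)"
      using par.simps(2)[of X 1 2 a] par.simps(2)[of X 1 1 a] by simp_all
    ultimately show ?thesis using 1 by (auto simp: numeral_2_eq_2)
  next
    case 2
    have p: "par X (Suc m) j a = Degen X m m (par X m j a)" using 2 by (auto simp: par.simps(2))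
    define j' where "j' = (if i < j then Suc j else j)"
    have r: "par X (Suc (Suc m)) j' a = Degen X (Suc m) (Suc m) (par X (Suc m) j' a)"
      using 2 by (auto simp: par.simps(2)[of X "Suc m"] j'_def)
    show ?thesis
    proof (cases "i = Suc m")
      case True
      then show ?thesis using 2 r by (simp add: j'_def)
    next
      case False
      then have im: "i \<le> m" using i by simp
      have "Degen X (Suc m) i (Degen X m m (par X m j a)) = Degen X (Suc m) (Suc m) (Degen X m i (par X m j a))"
        using simplicial_setD(4)[OF X par_in[OF a], of j m m i] im 2 by simp
      also have "Degen X m i (par X m j a) = par X (Suc m) j' a"
        using Suc.IH[OF a im, of j] 2 by (simp add: j'_def)
      finally show ?thesis unfolding j'_def[symmetric] p r .
    qed
  next
    case 3
    have p: "par X (Suc m) j a = Degen X m 0 (par X m (j - 1) a)" using 3 by (auto simp: par.simps(2))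
    show ?thesis
    proof (cases i)
      case 0
      then show ?thesis using 3 par.simps(2)[of X "Suc m" "Suc j" a] by simp
    next
      case (Suc k)
      have k: "k \<le> m" "j - 1 \<le> Suc m" using Suc i j by simp_all
      have "Degen X (Suc m) 0 (Degen X m k (par X m (j - 1) a)) = Degen X (Suc m) (Suc k) (Degen X m 0 (par X m (j - 1) a))"
        using simplicial_setD(4)[OF X par_in[OF a k(2)], of k 0] k(1) by simp
      then have e: "Degen X (Suc m) i (par X (Suc m) j a) =
          Degen X (Suc m) 0 (par X (Suc m) (if k < j - 1 then Suc (j - 1) else j - 1) a)"
        unfolding p Suc Suc.IH[OF a k] by simp
      show ?thesis
      proof (cases "i < j")
        case True
        then have "k < j - 1" "Suc (j - 1) = j" using Suc by simp_all
        then show ?thesis using e True 3 par.simps(2)[of X "Suc m" "Suc j" a] by simp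
      next
        case False
        then have ij: "i = Suc m" "j = Suc m" "k = m" "m \<noteq> 0" using 3 i Suc by auto
        have "par X (Suc m) m a = Degen X m m (par X m m a)" using ij by (simp add: par.simps(2))
        moreover have "par X (Suc m) (Suc m) a = Degen X m 0 (par X m m a)" using ij by (simp add: par.simps(2))
        moreover have "Degen X (Suc m) 0 (Degen X m m (par X m m a)) = Degen X (Suc m) (Suc m) (Degen X m 0 (par X m m a))"
          using simplicial_setD(4)[OF X par_in[OF a], of m m m 0] by simp
        moreover have "par X (Suc (Suc m)) (Suc m) a = Degen X (Suc m) (Suc m) (par X (Suc m) (Suc m) a)"
          by (simp add: par.simps(2)[of X "Suc m"])
        ultimately show ?thesis using e ij by simp
      qed
    qed
  qed
qed

text \<open>
  Precomposing with \<open>\<delta>\<^sub>i\<close> omits the element \<open>i\<close>, which decreases the number of zeros if \<open>i < j\<close>.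
\<close>

lemma par_face:
  "a \<in> Simp X 1 \<Longrightarrow> i \<le> Suc n \<Longrightarrow> j \<le> Suc (Suc n) \<Longrightarrow>
    Face X (Suc n) i (par X (Suc n) j a) = par X n (if i < j then j - 1 else j) a"
proof (induction n arbitrary: i j)
  case 0
  note a = 0(1)
  have pin: "par X 0 k a \<in> Simp X 0" if "k \<le> 1" for k using par_in[OF a, of k 0] that by simp
  have i: "i = 0 \<or> i = 1" using 0 by auto
  consider "j = 0" | "j = 1" | "j = 2" using 0 by linarith
  then show ?case
  proof cases
    case 1
    then show ?thesis using simplicial_setD(3)[OF X pin[of 0], of 0 i] i by (auto simp: par.simps(2))
  next
    case 2
    then show ?thesis using i by (auto simp: par.simps(2))
  next
    case 3
    then show ?thesis using simplicial_setD(3)[OF X pin[of 1], of 0 i] i by (auto simp: par.simps(2))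
  qed
next
  case (Suc m)
  note a = Suc.prems(1) and i = Suc.prems(2) and j = Suc.prems(3)
  let ?n = "Suc m"
  show ?case
  proof (cases "j \<le> ?n")
    case True
    have p: "par X (Suc ?n) j a = Degen X ?n ?n (par X ?n j a)" using True by (simp add: par.simps(2)[of X ?n])
    have pin: "par X ?n j a \<in> Simp X ?n" using par_in[OF a] True by simp
    have f: "Face X (Suc ?n) i (Degen X ?n ?n (par X ?n j a)) =
        (if i < ?n then Degen X m m (Face X ?n i (par X ?n j a)) else par X ?n j a)"
      using simplicial_setD(3)[OF X pin, of ?n i] i by simp
    show ?thesis
    proof (cases "i < ?n")
      case il: True
      define j' where "j' = (if i < j then j - 1 else j)"
      have j': "j' \<le> m" using True il by (auto simp: j'_def)
      have "Face X ?n i (par X ?n j a) = par X m j' a"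
        using Suc.IH[OF a, of i j] il True by (simp add: j'_def)
      moreover have "Degen X m m (par X m j' a) = par X ?n j' a" using par_degen[OF a, of m m j'] j' by simp
      ultimately show ?thesis using p f il unfolding j'_def by simp
    next
      case False
      then have "\<not> i < j" using True by simp
      then show ?thesis using p f False by simp
    qed
  next
    case False
    have p: "par X (Suc ?n) j a = Degen X ?n 0 (par X ?n (j - 1) a)" using False by (simp add: par.simps(2)[of X ?n])
    have pin: "par X ?n (j - 1) a \<in> Simp X ?n" using par_in[OF a] j by simp
    have f: "Face X (Suc ?n) i (Degen X ?n 0 (par X ?n (j - 1) a)) =
        (if i \<le> 1 then par X ?n (j - 1) a else Degen X m 0 (Face X ?n (i - 1) (par X ?n (j - 1) a)))"
      using simplicial_setD(3)[OF X pin, of 0 i] i by simp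
    show ?thesis
    proof (cases "i \<le> 1")
      case True
      then show ?thesis using p f False by simp
    next
      case i2: False
      define k where "k = (if i - 1 < j - 1 then j - 1 - 1 else j - 1)"
      have "Face X ?n (i - 1) (par X ?n (j - 1) a) = par X m k a"
        using Suc.IH[OF a, of "i - 1" "j - 1"] i j by (simp add: k_def)
      moreover have k: "0 < k" "k \<le> Suc m" "Suc k = (if i < j then j - 1 else j)"
        using False i2 i j by (auto simp: k_def)
      then have "Degen X m 0 (par X m k a) = par X ?n (Suc k) a" using par_degen[OF a, of 0 m k] by simp
      ultimately show ?thesis using p f i2 k(3) by simp
    qed
  qed
qed

lemma par_ends:
  assumes "a \<in> Simp X 1"
  shows "par X n 0 a = cst X n (Face X 1 0 a)" "par X n (Suc n) a = cst X n (Face X 1 1 a)"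
proof -
  have "Face X 1 0 a \<in> Simp X 0" using simplicial_setD(1)[OF X, of a 0 0] assms by simp
  note cd = cst_degen[OF this]
  show "par X n 0 a = cst X n (Face X 1 0 a)"
  proof (induction n)
    case (Suc n)
    then have "par X (Suc n) 0 a = Degen X n n (cst X n (Face X 1 0 a))" by (simp only: par.simps(2)) simp
    then show ?case by (simp only: cd[OF order.refl])
  qed (simp add: par.simps)
  show "par X n (Suc n) a = cst X n (Face X 1 1 a)"
  proof (induction n)
    case (Suc n)
    then show ?case by (simp add: par.simps(2)[of X n "Suc (Suc n)"])
  qed (simp add: par.simps)
qed

end

lemma simplicial_categoryD:
  assumes "simplicial_category C"
  shows "x \<in> Obj C \<Longrightarrow> y \<in> Obj C \<Longrightarrow> simplicial_set (Hom C x y)"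
    "x \<in> Obj C \<Longrightarrow> Idn C x \<in> Simp (Hom C x x) 0"
    "x \<in> Obj C \<Longrightarrow> y \<in> Obj C \<Longrightarrow> z \<in> Obj C \<Longrightarrow> f \<in> Simp (Hom C x y) n \<Longrightarrow> g \<in> Simp (Hom C y z) n \<Longrightarrow>
      Cmp C x y z n g f \<in> Simp (Hom C x z) n"
    "x \<in> Obj C \<Longrightarrow> y \<in> Obj C \<Longrightarrow> z \<in> Obj C \<Longrightarrow> f \<in> Simp (Hom C x y) (Suc n) \<Longrightarrow> g \<in> Simp (Hom C y z) (Suc n) \<Longrightarrow>
      i \<le> Suc n \<Longrightarrow> Face (Hom C x z) (Suc n) i (Cmp C x y z (Suc n) g f) =
             Cmp C x y z n (Face (Hom C y z) (Suc n) i g) (Face (Hom C x y) (Suc n) i f)"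
    "x \<in> Obj C \<Longrightarrow> y \<in> Obj C \<Longrightarrow> z \<in> Obj C \<Longrightarrow> f \<in> Simp (Hom C x y) n \<Longrightarrow> g \<in> Simp (Hom C y z) n \<Longrightarrow>
      i \<le> n \<Longrightarrow> Degen (Hom C x z) n i (Cmp C x y z n g f) =
             Cmp C x y z (Suc n) (Degen (Hom C y z) n i g) (Degen (Hom C x y) n i f)"
    "w \<in> Obj C \<Longrightarrow> x \<in> Obj C \<Longrightarrow> y \<in> Obj C \<Longrightarrow> z \<in> Obj C \<Longrightarrow> f \<in> Simp (Hom C w x) n \<Longrightarrow>
      g \<in> Simp (Hom C x y) n \<Longrightarrow> h \<in> Simp (Hom C y z) n \<Longrightarrow>
      Cmp C w x z n (Cmp C x y z n h g) f = Cmp C w y z n h (Cmp C w x y n g f)"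
    "x \<in> Obj C \<Longrightarrow> y \<in> Obj C \<Longrightarrow> f \<in> Simp (Hom C x y) n \<Longrightarrow> Cmp C x x y n f (idn C x n) = f"
    "x \<in> Obj C \<Longrightarrow> y \<in> Obj C \<Longrightarrow> f \<in> Simp (Hom C x y) n \<Longrightarrow> Cmp C x y y n (idn C y n) f = f"
proof -
  note C = assms[unfolded simplicial_category_def]
  note C3 = C[THEN conjunct2, THEN conjunct2, THEN conjunct1, rule_format]
  note C5 = C[THEN conjunct2, THEN conjunct2, THEN conjunct2, THEN conjunct2, rule_format]
  show "x \<in> Obj C \<Longrightarrow> y \<in> Obj C \<Longrightarrow> simplicial_set (Hom C x y)" by (rule C[THEN conjunct1, rule_format])
  show "x \<in> Obj C \<Longrightarrow> Idn C x \<in> Simp (Hom C x x) 0" by (rule C[THEN conjunct2, THEN conjunct1, rule_format])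
  show "x \<in> Obj C \<Longrightarrow> y \<in> Obj C \<Longrightarrow> z \<in> Obj C \<Longrightarrow> f \<in> Simp (Hom C x y) n \<Longrightarrow> g \<in> Simp (Hom C y z) n \<Longrightarrow>
      Cmp C x y z n g f \<in> Simp (Hom C x z) n" by (rule C3[THEN conjunct1])
  show "Face (Hom C x z) (Suc n) i (Cmp C x y z (Suc n) g f) =
      Cmp C x y z n (Face (Hom C y z) (Suc n) i g) (Face (Hom C x y) (Suc n) i f)"
    if v: "x \<in> Obj C" "y \<in> Obj C" "z \<in> Obj C" and f: "f \<in> Simp (Hom C x y) (Suc n)"
      and g: "g \<in> Simp (Hom C y z) (Suc n)" and i: "i \<le> Suc n"
    using C3[OF v f g, THEN conjunct2, THEN conjunct1] i by simp
  show "x \<in> Obj C \<Longrightarrow> y \<in> Obj C \<Longrightarrow> z \<in> Obj C \<Longrightarrow> f \<in> Simp (Hom C x y) n \<Longrightarrow> g \<in> Simp (Hom C y z) n \<Longrightarrow>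
      i \<le> n \<Longrightarrow> Degen (Hom C x z) n i (Cmp C x y z n g f) =
             Cmp C x y z (Suc n) (Degen (Hom C y z) n i g) (Degen (Hom C x y) n i f)"
    by (rule C3[THEN conjunct2, THEN conjunct2, rule_format])
  show "w \<in> Obj C \<Longrightarrow> x \<in> Obj C \<Longrightarrow> y \<in> Obj C \<Longrightarrow> z \<in> Obj C \<Longrightarrow> f \<in> Simp (Hom C w x) n \<Longrightarrow>
      g \<in> Simp (Hom C x y) n \<Longrightarrow> h \<in> Simp (Hom C y z) n \<Longrightarrow>
      Cmp C w x z n (Cmp C x y z n h g) f = Cmp C w y z n h (Cmp C w x y n g f)"
    by (rule C[THEN conjunct2, THEN conjunct2, THEN conjunct2, THEN conjunct1, rule_format])
  show "x \<in> Obj C \<Longrightarrow> y \<in> Obj C \<Longrightarrow> f \<in> Simp (Hom C x y) n \<Longrightarrow> Cmp C x x y n f (idn C x n) = f"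
    by (rule C5[THEN conjunct1])
  show "x \<in> Obj C \<Longrightarrow> y \<in> Obj C \<Longrightarrow> f \<in> Simp (Hom C x y) n \<Longrightarrow> Cmp C x y y n (idn C y n) f = f"
    by (rule C5[THEN conjunct2])
qed

context ranked_globular_digraph
begin

lemma nword_ends: "nword x nw y \<Longrightarrow> x \<in> verts G" "nword x nw y \<Longrightarrow> y \<in> verts G"
  using word_ends by (auto simp: nword_def)

end

section \<open>Values of chains under a labeling\<close>

locale labelled_diagram = ranked_globular_digraph D G rk
  for D :: "('v, 'e) drawing" and G :: "('v, 'e) pre_digraph" and rk +
  fixes A :: "('o, 'm) scat" and V :: "'v \<Rightarrow> 'o" and E :: "'e \<Rightarrow> 'm" and L :: "complex set \<Rightarrow> 'm"
  assumes A: "simplicial_category A"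
    and V: "x \<in> verts G \<Longrightarrow> V x \<in> Obj A"
    and E: "e \<in> arcs G \<Longrightarrow> E e \<in> Simp (Hom A (V (tail G e)) (V (head G e))) 0"
    and L: "\<phi> \<in> interior_faces D G \<Longrightarrow> L \<phi> \<in> Simp (Hom A (V (face_src D G \<phi>)) (V (face_tgt D G \<phi>))) 1"
begin

definition aval :: "nat \<Rightarrow> ('e, complex set) atom \<times> nat \<Rightarrow> 'm" where
  "aval n c = (case c of (a, j) \<Rightarrow> (case a of
     Ed e \<Rightarrow> cst (Hom A (V (tail G e)) (V (head G e))) n (E e)
   | Fc \<phi> \<Rightarrow> par (Hom A (V (face_src D G \<phi>)) (V (face_tgt D G \<phi>))) n j (L \<phi>)))"

fun val :: "nat \<Rightarrow> 'v \<Rightarrow> 'v \<Rightarrow> (('e, complex set) atom \<times> nat) list \<Rightarrow> 'm" where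
  "val n y x [] = idn A (V x) n"
| "val n y x (c # nw) = Cmp A (V x) (V (atgt (fst c))) (V y) n (val n y (atgt (fst c)) nw) (aval n c)"

text \<open>
  The row index \<open>Suc n\<close> means that the domain is used in all rows from \<open>0\<close> to \<open>n\<close>.
\<close>

definition bounded_rows :: "nat \<Rightarrow> (('e, complex set) atom \<times> nat) list \<Rightarrow> bool" where
  "bounded_rows n nw \<longleftrightarrow> (\<forall>c\<in>set nw. snd c \<le> Suc n)"

lemma bounded_rows_simps [simp]: "bounded_rows n []" "bounded_rows n (c # nw) \<longleftrightarrow> snd c \<le> Suc n \<and> bounded_rows n nw"
  by (auto simp: bounded_rows_def)

lemma normal_bounded_rows: "normal n nw \<Longrightarrow> bounded_rows n nw"
  unfolding normal_def bounded_rows_def by (fastforce split: atom.splits)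

lemma S: "x \<in> verts G \<Longrightarrow> y \<in> verts G \<Longrightarrow> simplicial_set (Hom A (V x) (V y))"
  using simplicial_categoryD(1)[OF A] V by simp

lemma aval_in:
  assumes "atom_in a" "j \<le> Suc n" shows "aval n (a, j) \<in> Simp (Hom A (V (asrc a)) (V (atgt a))) n"
proof (cases a)
  case (Ed e)
  then show ?thesis using assms cst_in[OF S[of "tail G e" "head G e"] E[of e]] by (simp add: aval_def)
next
  case (Fc \<phi>)
  then have i: "\<phi> \<in> interior_faces D G" using assms by simp
  have fv: "face_src D G \<phi> \<in> verts G" "face_tgt D G \<phi> \<in> verts G" using atom_walks(6,7)[OF assms(1)] Fc by simp_all
  then show ?thesis using par_in[OF S[OF fv] L[OF i] assms(2)] Fc by (simp add: aval_def)
qed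

lemma aval_face:
  assumes "atom_in a" "j \<le> Suc (Suc n)" "i \<le> Suc n"
  shows "Face (Hom A (V (asrc a)) (V (atgt a))) (Suc n) i (aval (Suc n) (a, j)) = aval n (a, if i < j then j - 1 else j)"
proof (cases a)
  case (Ed e)
  then show ?thesis using assms cst_face[OF S[of "tail G e" "head G e"] E[of e], of i n] by (simp add: aval_def del: cst.simps)
next
  case (Fc \<phi>)
  then have i: "\<phi> \<in> interior_faces D G" using assms by simp
  have fv: "face_src D G \<phi> \<in> verts G" "face_tgt D G \<phi> \<in> verts G" using atom_walks(6,7)[OF assms(1)] Fc by simp_all
  then show ?thesis using par_face[OF S[OF fv] L[OF i] assms(3,2)] Fc by (simp add: aval_def)
qed

lemma aval_degen:
  assumes "atom_in a" "j \<le> Suc n" "i \<le> n"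
  shows "Degen (Hom A (V (asrc a)) (V (atgt a))) n i (aval n (a, j)) = aval (Suc n) (a, if i < j then Suc j else j)"
proof (cases a)
  case (Ed e)
  then show ?thesis using assms cst_degen[OF S[of "tail G e" "head G e"] E[of e], of i n] by (simp add: aval_def del: cst.simps)
next
  case (Fc \<phi>)
  then have i: "\<phi> \<in> interior_faces D G" using assms by simp
  have fv: "face_src D G \<phi> \<in> verts G" "face_tgt D G \<phi> \<in> verts G" using atom_walks(6,7)[OF assms(1)] Fc by simp_all
  then show ?thesis using par_degen[OF S[OF fv] L[OF i] assms(3,2)] Fc by (simp add: aval_def)
qed

lemma val_in: "nword x nw y \<Longrightarrow> bounded_rows n nw \<Longrightarrow> val n y x nw \<in> Simp (Hom A (V x) (V y)) n"
proof (induction nw arbitrary: x)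
  case Nil
  then have x: "x = y" "x \<in> verts G" by auto
  then show ?case using cst_in[OF S[OF x(2) x(2)] simplicial_categoryD(2)[OF A V[OF x(2)]]] by (simp add: idn_cst)
next
  case (Cons c nw)
  obtain a j where c: "c = (a, j)" by (cases c)
  then have a: "atom_in a" "asrc a = x" "nword (atgt a) nw y" "j \<le> Suc n" "bounded_rows n nw" using Cons.prems by auto
  have v: "x \<in> verts G" "atgt a \<in> verts G" "y \<in> verts G" using atom_walks(6,7)[OF a(1)] nword_ends(2)[OF a(3)] a(2) by simp_all
  show ?case
    using simplicial_categoryD(3)[OF A V[OF v(1)] V[OF v(2)] V[OF v(3)] aval_in[OF a(1,4), unfolded a(2)] Cons.IH[OF a(3,5)]] c by simp
qed

lemma val_face:
  assumes "nword x nw y" "bounded_rows (Suc n) nw" "i \<le> Suc n"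
  shows "Face (Hom A (V x) (V y)) (Suc n) i (val (Suc n) y x nw) =
    val n y x (map (\<lambda>(a, j). (a, if i < j then j - 1 else j)) nw)"
  using assms(1,2)
proof (induction nw arbitrary: x)
  case Nil
  then have x: "x = y" "x \<in> verts G" by auto
  then show ?case using cst_face[OF S[OF x(2) x(2)] simplicial_categoryD(2)[OF A V[OF x(2)]], of i n] assms(3)
    unfolding val.simps list.map idn_cst by simp
next
  case (Cons c nw)
  obtain a j where c: "c = (a, j)" by (cases c)
  then have a: "atom_in a" "asrc a = x" "nword (atgt a) nw y" "j \<le> Suc (Suc n)" "bounded_rows (Suc n) nw" using Cons.prems by auto
  have v: "x \<in> verts G" "atgt a \<in> verts G" "y \<in> verts G" using atom_walks(6,7)[OF a(1)] nword_ends(2)[OF a(3)] a(2) by simp_all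
  show ?case
    using simplicial_categoryD(4)[OF A V[OF v(1)] V[OF v(2)] V[OF v(3)] aval_in[OF a(1,4), unfolded a(2)] val_in[OF a(3,5)] assms(3)]
      aval_face[OF a(1,4) assms(3)] Cons.IH[OF a(3,5)] a(2) c by simp
qed

lemma val_degen:
  assumes "nword x nw y" "bounded_rows n nw" "i \<le> n"
  shows "Degen (Hom A (V x) (V y)) n i (val n y x nw) =
    val (Suc n) y x (map (\<lambda>(a, j). (a, if i < j then Suc j else j)) nw)"
  using assms(1,2)
proof (induction nw arbitrary: x)
  case Nil
  then have x: "x = y" "x \<in> verts G" by auto
  then show ?case using cst_degen[OF S[OF x(2) x(2)] simplicial_categoryD(2)[OF A V[OF x(2)]], of i n] assms(3)
    unfolding val.simps list.map idn_cst by simp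
next
  case (Cons c nw)
  obtain a j where c: "c = (a, j)" by (cases c)
  then have a: "atom_in a" "asrc a = x" "nword (atgt a) nw y" "j \<le> Suc n" "bounded_rows n nw" using Cons.prems by auto
  have v: "x \<in> verts G" "atgt a \<in> verts G" "y \<in> verts G" using atom_walks(6,7)[OF a(1)] nword_ends(2)[OF a(3)] a(2) by simp_all
  show ?case
    using simplicial_categoryD(5)[OF A V[OF v(1)] V[OF v(2)] V[OF v(3)] aval_in[OF a(1,4), unfolded a(2)] val_in[OF a(3,5)] assms(3)]
      aval_degen[OF a(1,4) assms(3)] Cons.IH[OF a(3,5)] a(2) c by simp
qed

lemma val_append:
  assumes "nword x nv z" "bounded_rows n nv" "nword z nw y" "bounded_rows n nw"
  shows "val n y x (nv @ nw) = Cmp A (V x) (V z) (V y) n (val n y z nw) (val n z x nv)"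
  using assms(1,2)
proof (induction nv arbitrary: x)
  case Nil
  then have x: "x = z" "z \<in> verts G" "y \<in> verts G" using nword_ends[OF assms(3)] by auto
  then show ?case using simplicial_categoryD(7)[OF A V[OF x(2)] V[OF x(3)] val_in[OF assms(3,4)]] by simp
next
  case (Cons c nv)
  obtain a j where c: "c = (a, j)" by (cases c)
  then have a: "atom_in a" "asrc a = x" "nword (atgt a) nv z" "j \<le> Suc n" "bounded_rows n nv" using Cons.prems by auto
  have v: "x \<in> verts G" "atgt a \<in> verts G" "z \<in> verts G" "y \<in> verts G"
    using atom_walks(6,7)[OF a(1)] nword_ends[OF assms(3)] a(2) by simp_all
  show ?case
    using simplicial_categoryD(6)[OF A V[OF v(1)] V[OF v(2)] V[OF v(3)] V[OF v(4)] aval_in[OF a(1,4), unfolded a(2)]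
        val_in[OF a(3,5)] val_in[OF assms(3,4)]] Cons.IH[OF a(3,5)] c by simp
qed

lemma val_single:
  assumes "atom_in a" "j \<le> Suc n"
  shows "val n (atgt a) (asrc a) [(a, j)] = aval n (a, j)"
  using simplicial_categoryD(8)[OF A V[OF atom_walks(6)[OF assms(1)]] V[OF atom_walks(7)[OF assms(1)]] aval_in[OF assms]] by simp

lemma cst_Cmp:
  assumes "x \<in> verts G" "y \<in> verts G" "z \<in> verts G" "f \<in> Simp (Hom A (V x) (V y)) 0" "g \<in> Simp (Hom A (V y) (V z)) 0"
  shows "cst (Hom A (V x) (V z)) n (Cmp A (V x) (V y) (V z) 0 g f) =
    Cmp A (V x) (V y) (V z) n (cst (Hom A (V y) (V z)) n g) (cst (Hom A (V x) (V y)) n f)"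
proof (induction n)
  case (Suc n)
  then show ?case
    using simplicial_categoryD(5)[OF A V[OF assms(1)] V[OF assms(2)] V[OF assms(3)]
      cst_in[OF S[OF assms(1,2)] assms(4)] cst_in[OF S[OF assms(2,3)] assms(5)], of 0 n] by simp
qed simp

lemma path_label_in:
  assumes "awalk x p y" "p \<noteq> []"
  shows "path_label G A V E p \<in> Simp (Hom A (V x) (V y)) 0"
  using assms
proof (induction p arbitrary: x rule: induct_list012)
  case (2 e)
  then show ?case using E[of e] by (auto simp: awalk_Cons_iff awalk_Nil_iff)
next
  case (3 e f es)
  then have e: "e \<in> arcs G" "tail G e = x" "awalk (head G e) (f # es) y" by (auto simp: awalk_Cons_iff)
  have "head G (last (f # es)) = y" using head_last[OF e(3)] by simp
  then show ?case
    using simplicial_categoryD(3)[OF A V[OF tail_in_verts[OF e(1)]] V[OF head_in_verts[OF e(1)]]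
        V[OF awalk_last_in_verts[OF e(3)]] E[OF e(1)] 3(2)[OF e(3)]] e by simp
qed simp

lemma val_edges:
  assumes "awalk x p y" "p \<noteq> []"
  shows "val n y x (edges p) = cst (Hom A (V x) (V y)) n (path_label G A V E p)"
  using assms
proof (induction p arbitrary: x rule: induct_list012)
  case (2 e)
  then have e: "e \<in> arcs G" "tail G e = x" "head G e = y" by (auto simp: awalk_Cons_iff awalk_Nil_iff)
  then show ?case using val_single[of "Ed e" 0 n] by (simp add: aval_def)
next
  case (3 e f es)
  then have e: "e \<in> arcs G" "tail G e = x" "awalk (head G e) (f # es) y" by (auto simp: awalk_Cons_iff)
  have l: "head G (last (f # es)) = y" using head_last[OF e(3)] by simp
  have v: "x \<in> verts G" "head G e \<in> verts G" "y \<in> verts G" using e awalk_last_in_verts[OF e(3)] by auto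
  have ein: "E e \<in> Simp (Hom A (V x) (V (head G e))) 0" using E[OF e(1)] e(2) by simp
  have "val n y x (edges (e # f # es)) =
      Cmp A (V x) (V (head G e)) (V y) n (val n y (head G e) (edges (f # es))) (aval n (Ed e, 0))"
    by simp
  also have "\<dots> = Cmp A (V x) (V (head G e)) (V y) n
      (cst (Hom A (V (head G e)) (V y)) n (path_label G A V E (f # es))) (cst (Hom A (V x) (V (head G e))) n (E e))"
    using 3(2)[OF e(3)] e(2) by (simp add: aval_def)
  also have "\<dots> = cst (Hom A (V x) (V y)) n (path_label G A V E (e # f # es))"
    unfolding path_label.simps(3) l e(2) using cst_Cmp[OF v ein path_label_in[OF e(3)]] by simp
  finally show ?case .
qed simp

end

section \<open>The functor of a labeling\<close>

text \<open>
  The two conditions say that a face that shows the same side in all rows has the same value as the path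
  along this side.
\<close>

locale labelling = labelled_diagram D G rk A V E L
  for D :: "('v, 'e) drawing" and G :: "('v, 'e) pre_digraph" and rk
    and A :: "('o, 'm) scat" and V :: "'v \<Rightarrow> 'o" and E :: "'e \<Rightarrow> 'm" and L :: "complex set \<Rightarrow> 'm" +
  assumes face_labels: "\<phi> \<in> interior_faces D G \<Longrightarrow>
      Face (Hom A (V (face_src D G \<phi>)) (V (face_tgt D G \<phi>))) 1 0 (L \<phi>) = path_label G A V E (face_cod D G \<phi>)"
    "\<phi> \<in> interior_faces D G \<Longrightarrow>
      Face (Hom A (V (face_src D G \<phi>)) (V (face_tgt D G \<phi>))) 1 1 (L \<phi>) = path_label G A V E (face_dom D G \<phi>)"
begin

text \<open>
  One piece is brought into normal form: a face that does not switch is replaced by the path along its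
  visible side.
\<close>

definition norm1 :: "nat \<Rightarrow> ('e, complex set) atom \<times> nat \<Rightarrow> (('e, complex set) atom \<times> nat) list" where
  "norm1 n c = (case c of (a, j) \<Rightarrow> (case a of Ed e \<Rightarrow> [(Ed e, 0)]
     | Fc \<phi> \<Rightarrow> if 1 \<le> j \<and> j \<le> n then [(a, j)] else edges (if j = 0 then fcod \<phi> else fdom \<phi>)))"

lemma norm1:
  assumes a: "atom_in a" and j: "j \<le> Suc n"
  shows "nword (asrc a) (norm1 n (a, j)) (atgt a)" "normal n (norm1 n (a, j))"
    "i \<le> n \<Longrightarrow> ev (norm1 n (a, j)) i = ev [(a, j)] i"
    "val n (atgt a) (asrc a) (norm1 n (a, j)) = aval n (a, j)"
proof -
  note w = atom_walks[OF a]
  have "nword (asrc a) (norm1 n (a, j)) (atgt a) \<and> normal n (norm1 n (a, j)) \<and>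
    (i \<le> n \<longrightarrow> ev (norm1 n (a, j)) i = ev [(a, j)] i) \<and> val n (atgt a) (asrc a) (norm1 n (a, j)) = aval n (a, j)"
  proof (cases a)
    case (Ed e)
    then show ?thesis using a w val_single[of "Ed e" 0 n] by (simp add: norm1_def aval_def)
  next
    case (Fc \<phi>)
    then have i: "\<phi> \<in> interior_faces D G" using a by simp
    have "face_src D G \<phi> \<in> verts G" "face_tgt D G \<phi> \<in> verts G" using w(6,7) Fc by simp_all
    note pe = par_ends[OF S[OF this] L[OF i]]
    consider "1 \<le> j" "j \<le> n" | "j = 0" | "j = Suc n" using j by linarith
    then show ?thesis
    proof cases
      case 1
      then show ?thesis using a Fc w val_single[OF a j] by (simp add: norm1_def)
    next
      case 2
      have wc: "awalk (face_src D G \<phi>) (fcod \<phi>) (face_tgt D G \<phi>)" "fcod \<phi> \<noteq> []" using w(2,4) Fc by simp_all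
      show ?thesis
        using nword_edges[OF wc(1)] val_edges[OF wc] pe(1) w(6,7) face_labels(1)[OF i] Fc 2
        by (simp add: norm1_def aval_def)
    next
      case 3
      have wc: "awalk (face_src D G \<phi>) (fdom \<phi>) (face_tgt D G \<phi>)" "fdom \<phi> \<noteq> []" using w(1,3) Fc by simp_all
      show ?thesis
        using nword_edges[OF wc(1)] val_edges[OF wc] pe(2) w(6,7) face_labels(2)[OF i] Fc 3
        by (simp add: norm1_def aval_def)
    qed
  qed
  then show "nword (asrc a) (norm1 n (a, j)) (atgt a)" "normal n (norm1 n (a, j))"
    "i \<le> n \<Longrightarrow> ev (norm1 n (a, j)) i = ev [(a, j)] i"
    "val n (atgt a) (asrc a) (norm1 n (a, j)) = aval n (a, j)" by simp_all
qed

text \<open>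
  Thus the value of a word depends only on the simplex that it represents, which makes it a function
  on simplices that is compatible with the simplicial operators.
\<close>

lemma normal_form:
  assumes "nword x nw y" "bounded_rows n nw"
  shows "\<exists>nv. nword x nv y \<and> normal n nv \<and> evs n nv = evs n nw \<and> val n y x nv = val n y x nw"
proof -
  have "\<exists>nv. nword x nv y \<and> normal n nv \<and> (\<forall>i\<le>n. ev nv i = ev nw i) \<and> val n y x nv = val n y x nw"
    using assms
  proof (induction nw arbitrary: x)
    case Nil
    then show ?case by (intro exI[of _ "[]"]) auto
  next
    case (Cons c nw)
    obtain a j where c: "c = (a, j)" by (cases c)
    then have a: "atom_in a" "asrc a = x" "nword (atgt a) nw y" "j \<le> Suc n" "bounded_rows n nw" using Cons.prems by auto
    obtain nv where nv: "nword (atgt a) nv y" "normal n nv" "\<forall>i\<le>n. ev nv i = ev nw i" "val n y (atgt a) nv = val n y (atgt a) nw"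
      using Cons.IH[OF a(3,5)] by auto
    note N = norm1[OF a(1,4)]
    have "val n y x (norm1 n (a, j) @ nv) = Cmp A (V x) (V (atgt a)) (V y) n (val n y (atgt a) nv) (val n (atgt a) x (norm1 n (a, j)))"
      using val_append[OF N(1) normal_bounded_rows[OF N(2)] nv(1) normal_bounded_rows[OF nv(2)]] a(2) by simp
    then have "val n y x (norm1 n (a, j) @ nv) = val n y x (c # nw)" using nv(4) N(4) a(2) c by simp
    moreover have "nword x (norm1 n (a, j) @ nv) y" using nword_append[OF N(1) nv(1)] a(2) by simp
    moreover have "normal n (norm1 n (a, j) @ nv)" using N(2) nv(2) by simp
    moreover have "\<forall>i\<le>n. ev (norm1 n (a, j) @ nv) i = ev (c # nw) i" using N(3) nv(3) c by simp
    ultimately show ?case by (intro exI[of _ "norm1 n (a, j) @ nv"]) simp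
  qed
  then show ?thesis unfolding evs_def by auto
qed

definition ufun :: "'v \<Rightarrow> 'v \<Rightarrow> nat \<Rightarrow> 'e list list \<Rightarrow> 'm" where
  "ufun x y n ps = (if \<exists>nw. nword x nw y \<and> normal n nw \<and> ps = evs n nw
     then val n y x (THE nw. nword x nw y \<and> normal n nw \<and> ps = evs n nw) else undefined)"

lemma ufun_evs:
  assumes "nword x nw y" "bounded_rows n nw" shows "ufun x y n (evs n nw) = val n y x nw"
proof -
  obtain nv where nv: "nword x nv y" "normal n nv" "evs n nv = evs n nw" "val n y x nv = val n y x nw"
    using normal_form[OF assms] by auto
  have "(THE nv'. nword x nv' y \<and> normal n nv' \<and> evs n nw = evs n nv') = nv"
  proof (rule the_equality)
    show "nword x nv y \<and> normal n nv \<and> evs n nw = evs n nv" using nv by simp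
    fix nv' assume nv': "nword x nv' y \<and> normal n nv' \<and> evs n nw = evs n nv'"
    have "\<forall>i\<le>n. ev nv' i = ev nv i"
      using nv' nv(3) nth_evs[of _ n nv'] nth_evs[of _ n nv] by metis
    then show "nv' = nv" using nword_unique[of x nv' y n nv y] nv nv' by simp
  qed
  moreover have "\<exists>nv. nword x nv y \<and> normal n nv \<and> evs n nw = evs n nv" using nv by metis
  ultimately show ?thesis unfolding ufun_def using nv(4) by simp
qed

end

context ranked_globular_digraph
begin

lemma evs_face:
  assumes "i \<le> Suc n"
  shows "take i (evs (Suc n) nw) @ drop (Suc i) (evs (Suc n) nw) = evs n (map (\<lambda>(a, j). (a, if i < j then j - 1 else j)) nw)"
proof (rule nth_equalityI)
  have e1: "ev (map (\<lambda>(a, j). (a, if i < j then j - 1 else j)) nw) k = ev nw (if k < i then k else Suc k)" for k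
  proof (induction nw)
    case (Cons c nw)
    obtain a j where "c = (a, j)" by (cases c)
    moreover have "(k < (if i < j then j - 1 else j)) = ((if k < i then k else Suc k) < j)" by auto
    ultimately show ?case using Cons by simp
  qed simp
  fix k assume "k < length (take i (evs (Suc n) nw) @ drop (Suc i) (evs (Suc n) nw))"
  then have k: "k \<le> n" using assms by simp
  show "(take i (evs (Suc n) nw) @ drop (Suc i) (evs (Suc n) nw)) ! k = evs n (map (\<lambda>(a, j). (a, if i < j then j - 1 else j)) nw) ! k"
    unfolding nth_evs[OF k] e1 using assms k by (simp add: nth_append nth_evs)
qed (use assms in simp)

lemma evs_degen:
  assumes "i \<le> n"
  shows "take (Suc i) (evs n nw) @ drop i (evs n nw) = evs (Suc n) (map (\<lambda>(a, j). (a, if i < j then Suc j else j)) nw)"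
proof (rule nth_equalityI)
  have e1: "ev (map (\<lambda>(a, j). (a, if i < j then Suc j else j)) nw) k = ev nw (if k \<le> i then k else k - 1)" for k
  proof (induction nw)
    case (Cons c nw)
    obtain a j where "c = (a, j)" by (cases c)
    moreover have "(k < (if i < j then Suc j else j)) = ((if k \<le> i then k else k - 1) < j)" by auto
    ultimately show ?case using Cons by simp
  qed simp
  fix k assume "k < length (take (Suc i) (evs n nw) @ drop i (evs n nw))"
  then have k: "k \<le> Suc n" using assms by simp
  show "(take (Suc i) (evs n nw) @ drop i (evs n nw)) ! k = evs (Suc n) (map (\<lambda>(a, j). (a, if i < j then Suc j else j)) nw) ! k"
    unfolding nth_evs[OF k] e1 using assms k by (auto simp add: nth_append nth_evs Suc_diff_Suc min_def)
qed (use assms in simp)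

lemma evs_append: "map2 (@) (evs n nv) (evs n nw) = evs n (nv @ nw)"
  by (rule nth_equalityI) (auto simp: nth_evs)

abbreviation path_cat where "path_cat \<equiv> path_scat D G chains"

lemma path_cat_simps [simp]: "Obj path_cat = verts G"
  "Simp (Hom path_cat x y) n = nerve D (between G x y) (restricted G chains x y) n"
  "Face (Hom path_cat x y) n i ps = take i ps @ drop (Suc i) ps"
  "Degen (Hom path_cat x y) n i ps = take (Suc i) ps @ drop i ps"
  "Idn path_cat x = [[]]" "Cmp path_cat x y z n qs ps = map2 (@) ps qs"
  by (simp_all add: path_scat_def path_sset_def)

end

section \<open>Functors are determined by their labelings\<close>

locale path_functor = ranked_globular_digraph D G rk
  for D :: "('v, 'e) drawing" and G :: "('v, 'e) pre_digraph" and rk +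
  fixes A :: "('o, 'm) scat" and F :: "'v \<Rightarrow> 'o" and u :: "'v \<Rightarrow> 'v \<Rightarrow> nat \<Rightarrow> 'e list list \<Rightarrow> 'm"
  assumes target: "simplicial_category A"
    and fctor: "(F, u) \<in> sCat path_cat A"
begin

lemma F_obj: "F \<in> verts G \<rightarrow>\<^sub>E Obj A"
  and u_undefined: "\<not> (x \<in> verts G \<and> y \<in> verts G \<and> a \<in> Simp (Hom path_cat x y) n) \<Longrightarrow> u x y n a = undefined"
  and u_idn: "x \<in> verts G \<Longrightarrow> u x x 0 [[]] = Idn A (F x)"
proof -
  note c = fctor[unfolded sCat_def mem_Collect_eq case_prod_conv]
  have f1: "F \<in> Obj path_cat \<rightarrow>\<^sub>E Obj A" using c by (elim conjE)
  have f2: "\<forall>x y n a. \<not> (x \<in> Obj path_cat \<and> y \<in> Obj path_cat \<and> a \<in> Simp (Hom path_cat x y) n) \<longrightarrow> u x y n a = undefined"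
    using c by (elim conjE)
  have f3: "\<forall>x\<in>Obj path_cat. u x x 0 (Idn path_cat x) = Idn A (F x)" using c by (elim conjE)
  show "F \<in> verts G \<rightarrow>\<^sub>E Obj A" using f1 by simp
  show "u x y n a = undefined" if "\<not> (x \<in> verts G \<and> y \<in> verts G \<and> a \<in> Simp (Hom path_cat x y) n)"
    using f2[rule_format, of x y a n] that by simp
  show "u x x 0 [[]] = Idn A (F x)" if "x \<in> verts G" using f3[rule_format, of x] that by simp
qed

lemma u_evs:
  assumes nw: "nword x nw y"
  shows "u x y n (evs n nw) \<in> Simp (Hom A (F x) (F y)) n"
    "n = Suc m \<Longrightarrow> i \<le> n \<Longrightarrow> u x y m (evs m (map (\<lambda>(a, j). (a, if i < j then j - 1 else j)) nw)) =
      Face (Hom A (F x) (F y)) n i (u x y n (evs n nw))"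
    "i \<le> n \<Longrightarrow> u x y (Suc n) (evs (Suc n) (map (\<lambda>(a, j). (a, if i < j then Suc j else j)) nw)) =
      Degen (Hom A (F x) (F y)) n i (u x y n (evs n nw))"
proof -
  have f: "\<forall>x\<in>Obj path_cat. \<forall>y\<in>Obj path_cat. \<forall>n. \<forall>a\<in>Simp (Hom path_cat x y) n.
           u x y n a \<in> Simp (Hom A (F x) (F y)) n \<and>
           (\<forall>i\<le>n. n > 0 \<longrightarrow>
              u x y (n - 1) (Face (Hom path_cat x y) n i a) = Face (Hom A (F x) (F y)) n i (u x y n a)) \<and>
           (\<forall>i\<le>n.
              u x y (Suc n) (Degen (Hom path_cat x y) n i a) = Degen (Hom A (F x) (F y)) n i (u x y n a))"
    using fctor unfolding sCat_def mem_Collect_eq case_prod_conv by (elim conjE)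
  have "x \<in> Obj path_cat" "y \<in> Obj path_cat" "evs n nw \<in> Simp (Hom path_cat x y) n"
    using nword_ends[OF nw] nerve_nwords(2)[OF nw] by simp_all
  note g = f[rule_format, OF this, simplified path_cat_simps]
  show "u x y n (evs n nw) \<in> Simp (Hom A (F x) (F y)) n" using g by simp
  show "u x y m (evs m (map (\<lambda>(a, j). (a, if i < j then j - 1 else j)) nw)) =
      Face (Hom A (F x) (F y)) n i (u x y n (evs n nw))" if "n = Suc m" "i \<le> n"
    using g[THEN conjunct2, THEN conjunct1, rule_format, of i] evs_face[of i m nw] that by simp
  show "u x y (Suc n) (evs (Suc n) (map (\<lambda>(a, j). (a, if i < j then Suc j else j)) nw)) =
      Degen (Hom A (F x) (F y)) n i (u x y n (evs n nw))" if "i \<le> n"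
    using g[THEN conjunct2, THEN conjunct2, rule_format, of i] evs_degen[of i n nw] that by simp
qed

lemma u_append:
  assumes nv: "nword x nv y" and nw: "nword y nw z"
  shows "u x z n (evs n (nv @ nw)) = Cmp A (F x) (F y) (F z) n (u y z n (evs n nw)) (u x y n (evs n nv))"
proof -
  have f: "\<forall>x\<in>Obj path_cat. \<forall>y\<in>Obj path_cat. \<forall>z\<in>Obj path_cat. \<forall>n.
           \<forall>a\<in>Simp (Hom path_cat x y) n. \<forall>b\<in>Simp (Hom path_cat y z) n.
             u x z n (Cmp path_cat x y z n b a) = Cmp A (F x) (F y) (F z) n (u y z n b) (u x y n a)"
    using fctor unfolding sCat_def mem_Collect_eq case_prod_conv by (elim conjE)
  have "x \<in> Obj path_cat" "y \<in> Obj path_cat" "z \<in> Obj path_cat"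
    "evs n nv \<in> Simp (Hom path_cat x y) n" "evs n nw \<in> Simp (Hom path_cat y z) n"
    using nword_ends[OF nv] nword_ends[OF nw] nerve_nwords(2)[OF nv] nerve_nwords(2)[OF nw] by simp_all
  from f[rule_format, OF this] show ?thesis by (simp only: path_cat_simps evs_append)
qed

definition E\<^sub>u where "E\<^sub>u = (\<lambda>e\<in>arcs G. u (tail G e) (head G e) 0 [[e]])"
definition L\<^sub>u where "L\<^sub>u = (\<lambda>\<phi>\<in>interior_faces D G. u (face_src D G \<phi>) (face_tgt D G \<phi>) 1 [fdom \<phi>, fcod \<phi>])"

lemma E\<^sub>u: "e \<in> arcs G \<Longrightarrow> E\<^sub>u e = u (tail G e) (head G e) 0 [[e]]"
  and L\<^sub>u: "\<phi> \<in> interior_faces D G \<Longrightarrow> L\<^sub>u \<phi> = u (face_src D G \<phi>) (face_tgt D G \<phi>) 1 [fdom \<phi>, fcod \<phi>]"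
  by (simp_all add: E\<^sub>u_def L\<^sub>u_def)

lemma associated_labeling_eq: "associated_labeling D G (F, u) = (F, E\<^sub>u, L\<^sub>u)"
  using F_obj by (simp add: associated_labeling_def E\<^sub>u_def L\<^sub>u_def PiE_def extensional_restrict)

lemma nword_atom: "atom_in a \<Longrightarrow> nword (asrc a) [(a, j)] (atgt a)"
  using atom_walks(7)[of a] by simp

lemma evs_generators: "evs 0 [(Ed e, j)] = [[e]]" "evs 1 [(Fc \<phi>, 1)] = [fdom \<phi>, fcod \<phi>]"
  by (simp_all add: evs_def)

sublocale lab: labelled_diagram D G rk A F "E\<^sub>u" "L\<^sub>u"
proof
  show "simplicial_category A" by (rule target)
  show "F x \<in> Obj A" if "x \<in> verts G" for x using F_obj that by auto
  show "E\<^sub>u e \<in> Simp (Hom A (F (tail G e)) (F (head G e))) 0" if "e \<in> arcs G" for e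
    using u_evs(1)[OF nword_atom[of "Ed e" 0], of 0] that by (simp add: evs_generators E\<^sub>u)
  show "L\<^sub>u \<phi> \<in> Simp (Hom A (F (face_src D G \<phi>)) (F (face_tgt D G \<phi>))) 1" if "\<phi> \<in> interior_faces D G" for \<phi>
    using u_evs(1)[OF nword_atom[of "Fc \<phi>" 1], of 1] that by (simp add: evs_generators[simplified] L\<^sub>u)
qed

text \<open>
  The simplices of single pieces obey the recursion that defines \<open>par\<close>, and functors preserve the
  degeneracies and faces in it.
\<close>

lemma u_atom:
  assumes a: "atom_in a" and "j \<le> Suc n"
  shows "u (asrc a) (atgt a) n (evs n [(a, j)]) = lab.aval n (a, j)"
proof (cases a)
  case (Ed e)
  have ed: "evs n [(Ed e, j)] = evs n [(Ed e, 0)]" for n by (simp add: evs_def ev_def)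
  have "u (asrc a) (atgt a) n (evs n [(Ed e, 0)]) = lab.aval n (a, j)"
  proof (induction n)
    case 0
    then show ?case using a Ed by (simp add: evs_generators lab.aval_def E\<^sub>u)
  next
    case (Suc n)
    show ?case using u_evs(3)[OF nword_atom[OF a, of 0], of 0 n] Suc Ed by (simp add: lab.aval_def)
  qed
  then show ?thesis using ed Ed by simp
next
  case (Fc \<phi>)
  let ?X = "Hom A (F (face_src D G \<phi>)) (F (face_tgt D G \<phi>))"
  note w = nword_atom[OF a]
  have L: "L\<^sub>u \<phi> = u (asrc a) (atgt a) 1 (evs 1 [(a, 1)])" using a Fc by (simp add: evs_generators[simplified] L\<^sub>u)
  have "u (asrc a) (atgt a) n (evs n [(a, j)]) = par ?X n j (L\<^sub>u \<phi>)" using assms(2)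
  proof (induction n arbitrary: j)
    case 0
    have "u (asrc a) (atgt a) 0 (evs 0 [(a, 0)]) = Face ?X 1 0 (L\<^sub>u \<phi>)"
      unfolding L using u_evs(2)[OF w[of 1], of 1 0 0] Fc by simp
    moreover have "u (asrc a) (atgt a) 0 (evs 0 [(a, 1)]) = Face ?X 1 1 (L\<^sub>u \<phi>)"
      unfolding L using u_evs(2)[OF w[of 1], of 1 0 1] Fc by simp
    moreover have "j = 0 \<or> j = 1" using 0 by auto
    ultimately show ?case by (elim disjE; simp only: par.simps(1)) simp_all
  next
    case (Suc m)
    consider "m = 0" "j = 1" | "\<not> (m = 0 \<and> j = 1)" "j \<le> m" | "\<not> (m = 0 \<and> j = 1)" "j \<ge> Suc m" by linarith
    then show ?case
    proof cases
      case 1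
      then show ?thesis unfolding L by (simp add: par.simps(2))
    next
      case 2
      have "par ?X (Suc m) j (L\<^sub>u \<phi>) = Degen ?X m m (par ?X m j (L\<^sub>u \<phi>))"
        using 2 by (simp only: par.simps(2)) auto
      moreover have "u (asrc a) (atgt a) (Suc m) (evs (Suc m) [(a, j)]) = Degen ?X m m (u (asrc a) (atgt a) m (evs m [(a, j)]))"
        using u_evs(3)[OF w[of j], of m m] 2 Fc by simp
      ultimately show ?thesis using Suc.IH[of j] 2 by (simp only:)
    next
      case 3
      have "par ?X (Suc m) j (L\<^sub>u \<phi>) = Degen ?X m 0 (par ?X m (j - 1) (L\<^sub>u \<phi>))"
        using 3 by (simp only: par.simps(2)) auto
      moreover have "0 < j - 1" "Suc (j - 1) = j" using 3 by auto
      then have "u (asrc a) (atgt a) (Suc m) (evs (Suc m) [(a, j)]) = Degen ?X m 0 (u (asrc a) (atgt a) m (evs m [(a, j - 1)]))"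
        using u_evs(3)[OF w[of "j - 1"], of 0 m] Fc by simp
      ultimately show ?thesis using Suc.IH[of "j - 1"] Suc.prems by (simp only:)
    qed
  qed
  then show ?thesis using Fc by (simp add: lab.aval_def)
qed

text \<open>
  A word is the composite of its pieces, and functors preserve composites and identities.
\<close>

theorem u_val: "nword x nw y \<Longrightarrow> lab.bounded_rows n nw \<Longrightarrow> u x y n (evs n nw) = lab.val n y x nw"
proof (induction nw arbitrary: x)
  case Nil
  then have x: "x = y" "x \<in> verts G" by auto
  have "u x x n (evs n []) = idn A (F x) n"
  proof (induction n)
    case 0
    then show ?case using u_idn[OF x(2)] by (simp add: evs_def ev_def)
  next
    case (Suc n)
    then show ?case using u_evs(3)[of x "[]" x 0 n] x(2) by simp
  qed
  then show ?case using x by simp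
next
  case (Cons c nw)
  obtain a j where c: "c = (a, j)" by (cases c)
  then have a: "atom_in a" "asrc a = x" "nword (atgt a) nw y" "j \<le> Suc n" "lab.bounded_rows n nw"
    using Cons.prems by auto
  have "u x y n (evs n ([(a, j)] @ nw)) =
      Cmp A (F x) (F (atgt a)) (F y) n (u (atgt a) y n (evs n nw)) (u x (atgt a) n (evs n [(a, j)]))"
    using u_append[OF nword_atom[OF a(1)] a(3), of n j] a(2) by simp
  then show ?case using Cons.IH[OF a(3,5)] u_atom[OF a(1,4)] a(2) c by simp
qed

sublocale labelling D G rk A F "E\<^sub>u" "L\<^sub>u"
proof
  fix \<phi> assume \<phi>: "\<phi> \<in> interior_faces D G"
  let ?s = "face_src D G \<phi>" and ?t = "face_tgt D G \<phi>"
  have a: "atom_in (Fc \<phi>)" using \<phi> by simp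
  note w = atom_walks[OF a, simplified]
  have row: "par (Hom A (F ?s) (F ?t)) 0 j (L\<^sub>u \<phi>) = path_label G A F E\<^sub>u p"
    if j: "j \<le> 1" and p: "p = (if j = 0 then fcod \<phi> else fdom \<phi>)" for j p
  proof -
    have p': "awalk ?s p ?t" "p \<noteq> []" using w(1-4) p by (cases "j = 0"; simp)+
    have e: "evs 0 [(Fc \<phi>, j)] = evs 0 (edges p)" using p by (simp add: evs_def)
    have "par (Hom A (F ?s) (F ?t)) 0 j (L\<^sub>u \<phi>) = u ?s ?t 0 (evs 0 [(Fc \<phi>, j)])"
      using u_atom[OF a, of j 0] j by (simp add: lab.aval_def)
    also have "\<dots> = lab.val 0 ?t ?s (edges p)"
      unfolding e by (rule u_val[OF nword_edges[OF p'(1)]]) (simp add: lab.bounded_rows_def)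
    also have "\<dots> = path_label G A F E\<^sub>u p" using lab.val_edges[OF p', of 0] by simp
    finally show ?thesis .
  qed
  show "Face (Hom A (F ?s) (F ?t)) 1 0 (L\<^sub>u \<phi>) = path_label G A F E\<^sub>u (fcod \<phi>)" using row[of 0 "fcod \<phi>"] by simp
  show "Face (Hom A (F ?s) (F ?t)) 1 1 (L\<^sub>u \<phi>) = path_label G A F E\<^sub>u (fdom \<phi>)" using row[of 1 "fdom \<phi>"] by simp
qed

lemma labeling_of_functor: "associated_labeling D G (F, u) \<in> labelings D G A"
  unfolding associated_labeling_eq labelings_def mem_Collect_eq case_prod_conv
proof (intro conjI PiE_I ballI)
  show "E\<^sub>u e = undefined" if "e \<notin> arcs G" for e using that by (simp add: E\<^sub>u_def)
  show "L\<^sub>u \<phi> = undefined" if "\<phi> \<notin> interior_faces D G" for \<phi> using that by (simp add: L\<^sub>u_def)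
  show "F x \<in> Obj A" if "x \<in> verts G" for x using F_obj that by (rule PiE_mem)
  show "F x = undefined" if "x \<notin> verts G" for x using F_obj that by (rule PiE_arb)
qed (fact lab.E lab.L face_labels)+

lemma functor_from_labels: "u = ufun"
proof (intro ext)
  fix x y n ps
  show "u x y n ps = ufun x y n ps"
  proof (cases "\<exists>nw. nword x nw y \<and> normal n nw \<and> ps = evs n nw")
    case True
    then obtain nw where nw: "nword x nw y" "normal n nw" "ps = evs n nw" by auto
    show ?thesis unfolding nw(3) using u_val[OF nw(1)] ufun_evs[OF nw(1)] lab.normal_bounded_rows[OF nw(2)] by simp
  next
    case False
    then have "ufun x y n ps = undefined" unfolding ufun_def by (rule if_not_P)
    moreover have "u x y n ps = undefined" by (rule u_undefined) (use False in \<open>simp add: nerve_nwords(1)\<close>)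
    ultimately show ?thesis by simp
  qed
qed

end

context labelling
begin

text \<open>
  Faces and degeneracies shift the row indices of a word; this may destroy normality, but by \<open>ufun_evs\<close>
  the value can be computed with an arbitrary word.
\<close>

lemma ufun_functor:
  assumes V': "V \<in> verts G \<rightarrow>\<^sub>E Obj A"
  shows "(V, ufun) \<in> sCat path_cat A"
proof -
  have simplex: "\<exists>nw. nword x nw y \<and> bounded_rows n nw \<and> ps = evs n nw"
    if "ps \<in> Simp (Hom path_cat x y) n" for x y n ps
    using that normal_bounded_rows unfolding path_cat_simps nerve_nwords(1) by blast
  have shift: "nword x (map (\<lambda>(a, j). (a, f j)) nw) y" if "nword x nw y" for x nw y f
  proof -
    have fst: "map fst (map (\<lambda>(a, j). (a, f j)) nw) = map fst nw" by (induction nw) auto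
    show ?thesis using that unfolding nword_def fst .
  qed
  have 1: "ufun x y n ps = undefined"
    if "\<not> (x \<in> Obj path_cat \<and> y \<in> Obj path_cat \<and> ps \<in> Simp (Hom path_cat x y) n)" for x y n ps
    using that nword_ends unfolding ufun_def path_cat_simps nerve_nwords(1) by (metis (no_types, lifting))
  have 2: "ufun x y n ps \<in> Simp (Hom A (V x) (V y)) n" if ps: "ps \<in> Simp (Hom path_cat x y) n" for x y n ps
  proof -
    obtain nw where nw: "nword x nw y" "bounded_rows n nw" "ps = evs n nw" using simplex[OF ps] by auto
    show ?thesis using ufun_evs[OF nw(1,2)] val_in[OF nw(1,2)] nw(3) by simp
  qed
  have 3: "ufun x y (n - 1) (Face (Hom path_cat x y) n i ps) = Face (Hom A (V x) (V y)) n i (ufun x y n ps)"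
    if ps: "ps \<in> Simp (Hom path_cat x y) n" and i: "i \<le> n" "0 < n" for x y n ps i
  proof -
    obtain m where m: "n = Suc m" using i(2) by (cases n) auto
    obtain nw where nw: "nword x nw y" "bounded_rows (Suc m) nw" "ps = evs (Suc m) nw" using simplex[OF ps] m by auto
    let ?nw = "map (\<lambda>(a, j). (a, if i < j then j - 1 else j)) nw"
    have b: "bounded_rows m ?nw" using nw(2) i(1) m by (fastforce simp: bounded_rows_def)
    show ?thesis
      using evs_face[of i m nw] ufun_evs[OF shift[OF nw(1)] b] ufun_evs[OF nw(1,2)] val_face[OF nw(1,2), of i] i(1) m nw(3)
      by simp
  qed
  have 4: "ufun x y (Suc n) (Degen (Hom path_cat x y) n i ps) = Degen (Hom A (V x) (V y)) n i (ufun x y n ps)"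
    if ps: "ps \<in> Simp (Hom path_cat x y) n" and i: "i \<le> n" for x y n ps i
  proof -
    obtain nw where nw: "nword x nw y" "bounded_rows n nw" "ps = evs n nw" using simplex[OF ps] by auto
    let ?nw = "map (\<lambda>(a, j). (a, if i < j then Suc j else j)) nw"
    have b: "bounded_rows (Suc n) ?nw" using nw(2) by (fastforce simp: bounded_rows_def)
    show ?thesis
      using evs_degen[OF i, of nw] ufun_evs[OF shift[OF nw(1)] b] ufun_evs[OF nw(1,2)] val_degen[OF nw(1,2) i] nw(3)
      by simp
  qed
  have 5: "ufun x x 0 (Idn path_cat x) = Idn A (V x)" if "x \<in> Obj path_cat" for x
    using ufun_evs[of x "[]" x 0] that by (simp add: evs_def ev_def)
  have 6: "ufun x z n (Cmp path_cat x y z n qs ps) = Cmp A (V x) (V y) (V z) n (ufun y z n qs) (ufun x y n ps)"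
    if ps: "ps \<in> Simp (Hom path_cat x y) n" and qs: "qs \<in> Simp (Hom path_cat y z) n" for x y z n ps qs
  proof -
    obtain nv where nv: "nword x nv y" "bounded_rows n nv" "ps = evs n nv" using simplex[OF ps] by auto
    obtain nw where nw: "nword y nw z" "bounded_rows n nw" "qs = evs n nw" using simplex[OF qs] by auto
    have b: "bounded_rows n (nv @ nw)" using nv(2) nw(2) by (auto simp: bounded_rows_def)
    show ?thesis unfolding path_cat_simps nv(3) nw(3) evs_append
      using ufun_evs[OF nword_append[OF nv(1) nw(1)] b] ufun_evs[OF nv(1,2)] ufun_evs[OF nw(1,2)]
        val_append[OF nv(1,2) nw(1,2)] by simp
  qed
  show ?thesis unfolding sCat_def mem_Collect_eq case_prod_conv
  proof (intro conjI allI impI ballI)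
    show "V \<in> Obj path_cat \<rightarrow>\<^sub>E Obj A" using V' by simp
  qed (erule 1 2 3 4 5 6; assumption)+
qed

lemma ufun_labels:
  assumes V': "V \<in> extensional (verts G)" and E': "E \<in> extensional (arcs G)"
    and L': "L \<in> extensional (interior_faces D G)"
  shows "associated_labeling D G (V, ufun) = (V, E, L)"
proof -
  have "ufun (tail G e) (head G e) 0 [[e]] = E e" if "e \<in> arcs G" for e
  proof -
    have "nword (tail G e) [(Ed e, 0)] (head G e)" using that by simp
    from ufun_evs[OF this, of 0] val_single[of "Ed e" 0 0] that show ?thesis by (simp add: evs_def aval_def)
  qed
  moreover have "ufun (face_src D G \<phi>) (face_tgt D G \<phi>) 1 [fdom \<phi>, fcod \<phi>] = L \<phi>" if i: "\<phi> \<in> interior_faces D G" for \<phi>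
  proof -
    have a: "atom_in (Fc \<phi>)" using i by simp
    have "nword (face_src D G \<phi>) [(Fc \<phi>, 1)] (face_tgt D G \<phi>)" using atom_walks(7)[OF a] a by simp
    from ufun_evs[OF this, of 1] val_single[OF a, of 1 1] show ?thesis by (simp add: evs_def aval_def par.simps(2))
  qed
  ultimately show ?thesis using assms
    by (auto simp: associated_labeling_def extensional_restrict fun_eq_iff restrict_def extensional_def)
qed

end

context ranked_globular_digraph
begin

theorem associated_labeling_bij:
  fixes A :: "('o, 'm) scat"
  assumes A: "simplicial_category A"
  shows "bij_betw (associated_labeling D G) (sCat path_cat A) (labelings D G A)"
proof (rule bij_betw_byWitness)
  let ?g = "\<lambda>(V, E, L). (V, labelling.ufun D G A V E L)"
  have func: "path_functor D G rk A F u" if "(F, u) \<in> sCat path_cat A" for F u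
    by unfold_locales (rule A that)+
  show "\<forall>fu\<in>sCat path_cat A. ?g (associated_labeling D G fu) = fu"
  proof
    fix fu assume fu: "fu \<in> sCat path_cat A"
    obtain F u where Fu: "fu = (F, u)" by (cases fu)
    interpret path_functor D G rk A F u using func fu Fu by simp
    show "?g (associated_labeling D G fu) = fu"
      unfolding Fu associated_labeling_eq case_prod_conv functor_from_labels[symmetric] ..
  qed
  show "associated_labeling D G ` sCat path_cat A \<subseteq> labelings D G A"
  proof
    fix l assume "l \<in> associated_labeling D G ` sCat path_cat A"
    then obtain F u where Fu: "(F, u) \<in> sCat path_cat A" "l = associated_labeling D G (F, u)" by auto
    interpret path_functor D G rk A F u using func Fu by simp
    show "l \<in> labelings D G A" unfolding Fu(2) by (rule labeling_of_functor)
  qed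
  have lab: "labelling D G rk A V E L" "V \<in> verts G \<rightarrow>\<^sub>E Obj A" "V \<in> extensional (verts G)"
    "E \<in> extensional (arcs G)" "L \<in> extensional (interior_faces D G)" if l: "(V, E, L) \<in> labelings D G A" for V E L
  proof -
    note c = l[unfolded labelings_def mem_Collect_eq case_prod_conv]
    have V: "V \<in> verts G \<rightarrow>\<^sub>E Obj A" using c by (elim conjE)
    have E: "E \<in> (\<Pi>\<^sub>E e\<in>arcs G. Simp (Hom A (V (tail G e)) (V (head G e))) 0)"
      using c by (elim conjE)
    have L: "L \<in> (\<Pi>\<^sub>E \<phi>\<in>interior_faces D G. Simp (Hom A (V (face_src D G \<phi>)) (V (face_tgt D G \<phi>))) 1)"
      using c by (elim conjE)
    have f: "\<forall>\<phi>\<in>interior_faces D G.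
           Face (Hom A (V (face_src D G \<phi>)) (V (face_tgt D G \<phi>))) 1 0 (L \<phi>) = path_label G A V E (fcod \<phi>) \<and>
           Face (Hom A (V (face_src D G \<phi>)) (V (face_tgt D G \<phi>))) 1 1 (L \<phi>) = path_label G A V E (fdom \<phi>)"
      using c by (elim conjE)
    show "labelling D G rk A V E L"
    proof
      show "simplicial_category A" by (rule A)
      show "V x \<in> Obj A" if "x \<in> verts G" for x using V that by (rule PiE_mem)
      show "E e \<in> Simp (Hom A (V (tail G e)) (V (head G e))) 0" if "e \<in> arcs G" for e using E that by (rule PiE_mem)
      fix \<phi> assume i: "\<phi> \<in> interior_faces D G"
      show "L \<phi> \<in> Simp (Hom A (V (face_src D G \<phi>)) (V (face_tgt D G \<phi>))) 1" using L i by (rule PiE_mem)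
      show "Face (Hom A (V (face_src D G \<phi>)) (V (face_tgt D G \<phi>))) 1 0 (L \<phi>) = path_label G A V E (fcod \<phi>)"
        "Face (Hom A (V (face_src D G \<phi>)) (V (face_tgt D G \<phi>))) 1 1 (L \<phi>) = path_label G A V E (fdom \<phi>)"
        using f i by simp_all
    qed
    show "V \<in> verts G \<rightarrow>\<^sub>E Obj A" by (rule V)
    show "V \<in> extensional (verts G)" "E \<in> extensional (arcs G)" "L \<in> extensional (interior_faces D G)"
      using V E L by (simp_all add: PiE_def)
  qed
  show "\<forall>l\<in>labelings D G A. associated_labeling D G (?g l) = l"
  proof
    fix l assume l: "l \<in> labelings D G A"
    obtain V E L where VEL: "l = (V, E, L)" by (cases l)
    note b = lab[OF l[unfolded VEL]]
    interpret labelling D G rk A V E L by (rule b(1))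
    show "associated_labeling D G (?g l) = l"
      unfolding VEL case_prod_conv by (rule ufun_labels[OF b(3-5)])
  qed
  show "?g ` labelings D G A \<subseteq> sCat path_cat A"
  proof
    fix fu assume "fu \<in> ?g ` labelings D G A"
    then obtain V E L where l: "(V, E, L) \<in> labelings D G A" "fu = (V, labelling.ufun D G A V E L)" by auto
    note b = lab[OF l(1)]
    interpret labelling D G rk A V E L by (rule b(1))
    show "fu \<in> sCat path_cat A" unfolding l(2) by (rule ufun_functor[OF b(2)])
  qed
qed

end

section \<open>The correspondence\<close>

text \<open>
  With this the single vertex is covered by the general argument.
\<close>

lemma trivial_graph_is_st:
  assumes "trivial_graph G"
  shows "st_graph D G" "interior_faces D G = {}"
proof -
  obtain v where v: "verts G = {v}" and a: "arcs G = {}" using assms by (auto simp: trivial_graph_def)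
  have fin: "fin_digraph G" by unfold_locales (simp_all add: v a)
  have loop: "pre_digraph.awalk G v [] v" by (simp add: pre_digraph.awalk_def pre_digraph.cas.simps v)
  have s: "is_source G w \<longleftrightarrow> w = v" "is_target G w \<longleftrightarrow> w = v" for w
    using loop by (auto simp: is_source_def is_target_def v)
  then have s': "is_source G = (\<lambda>w. w = v)" "is_target G = (\<lambda>w. w = v)" by auto
  have sup: "support D G = {vpt D v}" by (simp add: support_def v a)
  have ext: "exterior D G = - {vpt D v}" unfolding exterior_def sup by (rule outside_convex) simp
  have st: "src G = v" "tgt G = v" by (simp_all add: src_def tgt_def s)
  have "frontier (exterior D G) = {vpt D v}" unfolding ext frontier_complement by (simp add: frontier_def)
  moreover have "plane_graph D G" using fin by (simp add: plane_graph_def v a)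
  ultimately show "st_graph D G" unfolding st_graph_def st by (simp add: s')
  have conn: "connected (- {vpt D v})" by (rule connected_punctured_universe) simp
  have "C = - {vpt D v}" if "C \<in> components (- {vpt D v})" for C
    using that connected_component_eq_self[OF conn] unfolding components_iff by auto
  then show "interior_faces D G = {}" unfolding interior_faces_def faces_def sup ext by auto
qed

theorem theoremA:
  fixes D :: "('v, 'e) drawing" and G :: "('v, 'e) pre_digraph" and A :: "('o, 'm) scat"
  assumes "globular D G"
    and "simplicial_category A"
  shows "bij_betw (associated_labeling D G)
           (sCat (path_scat D G (S_min_complete D G)) A)
           (labelings D G A)"
proof -
  have "st_graph D G \<and> (\<forall>\<phi>\<in>interior_faces D G. globular_face D G \<phi>)"
  proof (cases "trivial_graph G")
    case True
    then show ?thesis using trivial_graph_is_st(1,2)[OF True] by simp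
  next
    case False
    then show ?thesis using assms(1) by (simp add: globular_def interior_faces_def)
  qed
  then have st: "st_graph D G" and gf: "\<And>\<phi>. \<phi> \<in> interior_faces D G \<Longrightarrow> globular_face D G \<phi>" by simp_all
  interpret globular_plane_digraph D G
    using st gf by unfold_locales (auto simp: st_graph_def)
  obtain rk :: "'v \<Rightarrow> nat" where rk: "\<forall>e\<in>arcs G. rk (tail G e) < rk (head G e)" using rank_exists by blast
  interpret ranked_globular_digraph D G rk by unfold_locales (use rk in blast)
  show ?thesis unfolding S_min_complete_chains[OF assms(1)] by (rule associated_labeling_bij[OF assms(2)])
qed

end
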